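(* Every definable bounded distributive lattice $(H,\sqsubseteq_H)$ with $\dim H=1$ embeds definably (as a bounded distributive lattice) into a definable Heyting algebra.
   Context: Fix an o-minimal structure $R$ expanding a real-closed field. "Definable" means definable in $R$ with parameters; a definable lattice (or Heyting algebra) is one whose underlying set is a definable subset of some $R^n$ and whose order relation is definable (the operations are then definable too); $\dim$ is o-minimal dimension. A definable embedding of bounded distributive lattices is a definable injective map preserving binary meets, binary joins, the least element and the greatest element. A Heyting algebra is a bounded distributive lattice $(L,\sqsubseteq)$ in which for all $x,y\in L$ the set $\{z\in L : x\sqcap z\sqsubseteq y\}$ has a maximum element, denoted $x\Rightarrow y$. *)

theory Defs
  imports "HOL-Algebra.Lattice" "HOL-Library.Extended_Real" "HOL-Library.More_List"
begin

class real_closed_field = linordered_field +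
  assumes nonneg_is_square: "0 \<le> a \<Longrightarrow> \<exists>x. x * x = a"
    and odd_degree_has_root:
      "odd d \<Longrightarrow> c d \<noteq> 0 \<Longrightarrow> \<exists>x. (\<Sum>k\<le>d. c k * x ^ k) = 0"


text \<open>
  First-order structures expanding the ordered field \<^typ>\<open>'a\<close>: the symbols for
  \<open>+\<close>, \<open>*\<close>, \<open><\<close> are built into the syntax and always have their field meaning; the record
  interprets the additional function and relation symbols.  Symbols are not tied to an arity; a
  symbol of arity \<open>k\<close> is one whose interpretation only matters on lists of length \<open>k\<close>
  (elsewhere it may be taken to be constantly \<open>0\<close>, respectively \<open>False\<close>).
  The constructor \<open>Param\<close> makes every element of the field available as a parameter.
\<close>

record ('f, 'r, 'a) fo_structure =
  fun_interp :: "'f \<Rightarrow> 'a list \<Rightarrow> 'a"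
  rel_interp :: "'r \<Rightarrow> 'a list \<Rightarrow> bool"

datatype ('f, 'a) fo_term =
    Var nat
  | Param 'a
  | Add "('f, 'a) fo_term" "('f, 'a) fo_term"
  | Mul "('f, 'a) fo_term" "('f, 'a) fo_term"
  | Fun 'f "('f, 'a) fo_term list"

datatype ('f, 'r, 'a) fo_formula =
    Eq "('f, 'a) fo_term" "('f, 'a) fo_term"
  | Less "('f, 'a) fo_term" "('f, 'a) fo_term"
  | Rel 'r "('f, 'a) fo_term list"
  | Neg "('f, 'r, 'a) fo_formula"
  | Conj "('f, 'r, 'a) fo_formula" "('f, 'r, 'a) fo_formula"
  | Ex nat "('f, 'r, 'a) fo_formula"

primrec fo_value ::
  "('f, 'r, 'a::linordered_field) fo_structure \<Rightarrow> (nat \<Rightarrow> 'a) \<Rightarrow> ('f, 'a) fo_term \<Rightarrow> 'a"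
where
  "fo_value M v (Var i) = v i"
| "fo_value M v (Param a) = a"
| "fo_value M v (Add s t) = fo_value M v s + fo_value M v t"
| "fo_value M v (Mul s t) = fo_value M v s * fo_value M v t"
| "fo_value M v (Fun f ts) = fun_interp M f (map (fo_value M v) ts)"

primrec fo_sat ::
  "('f, 'r, 'a::linordered_field) fo_structure \<Rightarrow> (nat \<Rightarrow> 'a) \<Rightarrow> ('f, 'r, 'a) fo_formula \<Rightarrow> bool"
where
  "fo_sat M v (Eq s t) \<longleftrightarrow> fo_value M v s = fo_value M v t"
| "fo_sat M v (Less s t) \<longleftrightarrow> fo_value M v s < fo_value M v t"
| "fo_sat M v (Rel r ts) \<longleftrightarrow> rel_interp M r (map (fo_value M v) ts)"
| "fo_sat M v (Neg \<phi>) \<longleftrightarrow> \<not> fo_sat M v \<phi>"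
| "fo_sat M v (Conj \<phi> \<psi>) \<longleftrightarrow> fo_sat M v \<phi> \<and> fo_sat M v \<psi>"
| "fo_sat M v (Ex i \<phi>) \<longleftrightarrow> (\<exists>a. fo_sat M (v(i := a)) \<phi>)"


text \<open>
  Points of \<open>R\<^sup>n\<close> are lists of length \<open>n\<close>.  A free variable with index \<open>\<ge> n\<close> is evaluated
  at \<open>0\<close>, which amounts to substituting the parameter \<open>0\<close> for it.
\<close>

definition definable ::
  "('f, 'r, 'a::linordered_field) fo_structure \<Rightarrow> nat \<Rightarrow> 'a list set \<Rightarrow> bool" where
  "definable M n X \<longleftrightarrow>
     (\<exists>\<phi>. X = {xs. length xs = n \<and> fo_sat M (nth_default 0 xs) \<phi>})"

definition definable_map ::
  "('f, 'r, 'a::linordered_field) fo_structure \<Rightarrow> nat \<Rightarrow> nat \<Rightarrow> 'a list set \<Rightarrow>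
     ('a list \<Rightarrow> 'a list) \<Rightarrow> bool" where
  "definable_map M m n X f \<longleftrightarrow>
     definable M m X \<and> definable M (m + n) {xs @ f xs | xs. xs \<in> X}"

definition point_or_open_interval :: "'a::linorder set \<Rightarrow> bool" where
  "point_or_open_interval I \<longleftrightarrow>
     (\<exists>a. I = {a}) \<or> (\<exists>a b. I = {a<..<b}) \<or> (\<exists>a. I = {a<..}) \<or> (\<exists>b. I = {..<b}) \<or> I = UNIV"

definition o_minimal :: "('f, 'r, 'a::linordered_field) fo_structure \<Rightarrow> bool" where
  "o_minimal M \<longleftrightarrow>
     (\<forall>X. definable M 1 X \<longrightarrow>
        (\<exists>\<I>. finite \<I> \<and> (\<forall>I\<in>\<I>. point_or_open_interval I) \<and> {x. [x] \<in> X} = \<Union>\<I>))"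


text \<open>
  Continuity is with respect to the order topology of \<^typ>\<open>'a\<close>
  and the induced topology on \<open>C\<close>.
\<close>

definition cont_on :: "'a::linordered_field list set \<Rightarrow> ('a list \<Rightarrow> 'a) \<Rightarrow> bool" where
  "cont_on C f \<longleftrightarrow>
     (\<forall>xs\<in>C. \<forall>\<epsilon>>0. \<exists>\<delta>>0. \<forall>ys\<in>C.
        list_all2 (\<lambda>x y. \<bar>y - x\<bar> < \<delta>) xs ys \<longrightarrow> \<bar>f ys - f xs\<bar> < \<epsilon>)"

definition definable_cont ::
  "('f, 'r, 'a::linordered_field) fo_structure \<Rightarrow> nat \<Rightarrow> 'a list set \<Rightarrow> ('a list \<Rightarrow> 'a) \<Rightarrow> bool" where
  "definable_cont M n C f \<longleftrightarrow> definable_map M n 1 C (\<lambda>xs. [f xs]) \<and> cont_on C f"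

text \<open>
  \<open>cell M is C\<close>: \<open>C\<close> is an \<open>(i\<^sub>1,\<dots>,i\<^sub>n)\<close>-cell, where \<open>is = [i\<^sub>1,\<dots>,i\<^sub>n]\<close> and all \<open>i\<^sub>j \<in> {0, 1}\<close>.
  The recursion starts from the one-point space \<open>R\<^sup>0\<close>.  The bounds of a band are definable
  continuous functions or infinite: \<^term>\<open>None\<close> stands for \<open>-\<infinity>\<close> as a lower and for \<open>+\<infinity>\<close> as an
  upper bound.
\<close>

inductive cell ::
  "('f, 'r, 'a::linordered_field) fo_structure \<Rightarrow> nat list \<Rightarrow> 'a list set \<Rightarrow> bool"
  for M where
  cell_Nil: "cell M [] {[]}"
| cell_graph: "cell M (is @ [0]) {xs @ [f xs] | xs. xs \<in> C}"
    if "cell M is C" and "definable_cont M (length is) C f"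
| cell_band: "cell M (is @ [1])
     {xs @ [y] | xs y. xs \<in> C \<and> (\<forall>f. lo = Some f \<longrightarrow> f xs < y) \<and> (\<forall>g. up = Some g \<longrightarrow> y < g xs)}"
    if "cell M is C"
      and "\<And>f. lo = Some f \<Longrightarrow> definable_cont M (length is) C f"
      and "\<And>g. up = Some g \<Longrightarrow> definable_cont M (length is) C g"
      and "\<And>f g xs. lo = Some f \<Longrightarrow> up = Some g \<Longrightarrow> xs \<in> C \<Longrightarrow> f xs < g xs"

text \<open>For \<open>X \<subseteq> R\<^sup>n\<close> the supremum is a maximum, except that the empty set has dimension \<open>-\<infinity>\<close>.\<close>

definition o_dim :: "('f, 'r, 'a::linordered_field) fo_structure \<Rightarrow> 'a list set \<Rightarrow> ereal" where
  "o_dim M X = Sup {ereal (real (sum_list is)) | is C. cell M is C \<and> C \<subseteq> X}"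


text \<open>
  The locale \<open>bounded_lattice\<close> and the operations \<open>\<sqinter>\<close>, \<open>\<squnion>\<close>, \<open>\<bottom>\<close>, \<open>\<top>\<close> are those of
  \<^theory>\<open>HOL-Algebra.Lattice\<close>, derived from the order on the carrier.
\<close>

definition bounded_distrib_lattice :: "'b gorder \<Rightarrow> bool" where
  "bounded_distrib_lattice L \<longleftrightarrow>
     bounded_lattice L \<and>
     (\<forall>x\<in>carrier L. \<forall>y\<in>carrier L. \<forall>z\<in>carrier L.
        x \<sqinter>\<^bsub>L\<^esub> (y \<squnion>\<^bsub>L\<^esub> z) = (x \<sqinter>\<^bsub>L\<^esub> y) \<squnion>\<^bsub>L\<^esub> (x \<sqinter>\<^bsub>L\<^esub> z))"

definition heyting_algebra :: "'b gorder \<Rightarrow> bool" where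
  "heyting_algebra L \<longleftrightarrow>
     bounded_distrib_lattice L \<and>
     (\<forall>x\<in>carrier L. \<forall>y\<in>carrier L. \<exists>m. greatest L m {z \<in> carrier L. x \<sqinter>\<^bsub>L\<^esub> z \<sqsubseteq>\<^bsub>L\<^esub> y})"

definition definable_order ::
  "('f, 'r, 'a::linordered_field) fo_structure \<Rightarrow> nat \<Rightarrow> 'a list gorder \<Rightarrow> bool" where
  "definable_order M n L \<longleftrightarrow>
     definable M n (carrier L) \<and>
     definable M (n + n) {xs @ ys | xs ys. xs \<in> carrier L \<and> ys \<in> carrier L \<and> xs \<sqsubseteq>\<^bsub>L\<^esub> ys}"

definition definable_embedding ::
  "('f, 'r, 'a::linordered_field) fo_structure \<Rightarrow> nat \<Rightarrow> 'a list gorder \<Rightarrow>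
     nat \<Rightarrow> 'a list gorder \<Rightarrow> ('a list \<Rightarrow> 'a list) \<Rightarrow> bool" where
  "definable_embedding M m L n K h \<longleftrightarrow>
     definable_map M m n (carrier L) h \<and>
     h \<in> carrier L \<rightarrow> carrier K \<and>
     inj_on h (carrier L) \<and>
     meet_pres L K h \<and>
     join_pres L K h \<and>
     h \<bottom>\<^bsub>L\<^esub> = \<bottom>\<^bsub>K\<^esub> \<and>
     h \<top>\<^bsub>L\<^esub> = \<top>\<^bsub>K\<^esub>"

end

theory Submission
  imports Defs
begin

text \<open>
  Since \<open>H\<close> contains no two-dimensional cell, it is covered by finitely many definable curves, so by
  definable choice it may be identified with a definable lattice on a subset \<open>S\<close> of the line.
  There is no definable finite-to-one map from a box to the line; hence on a suitable subinterval
  of any given interval the join of \<open>x < y\<close> depends on only one of \<open>x\<close> and \<open>y\<close>, and so does the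
  meet.  By distributivity the lattice order on that subinterval is a chain, increasing or
  decreasing.  Thus \<open>S\<close> is a finite union of definable chains, and a definable ideal is determined by
  its cuts in these chains.  So the definable ideals form a single definable family, they form a
  Heyting algebra under inclusion, and \<open>x\<close> is mapped to the principal ideal of \<open>x\<close>.
\<close>

section \<open>Definable predicates and terms\<close>

text \<open>In \<open>H\<close> the elements whose meet with \<open>x\<close> lies below
  \<open>y\<close> form an ideal, but this ideal may have no largest element; taking ideals as the
  new elements repairs exactly that. Down-sets would repair it too, but the passage to principal
  down-sets does not turn joins into unions. The difficulty is to keep the new algebra definable:
  ideals are sets, and only their description by a fixed number of cuts turns them into tuples of
  fixed length. One ideal then has many tuples, so definable choice is needed a second time, to
  select a single code for each ideal.

  The field need not be complete, hence suprema and connectedness are available for definable sets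
  only. Pointwise statements are made uniform by shrinking intervals again and again; statements
  that hold on some subinterval of every interval take the place of the full monotonicity and cell
  decomposition theorems.\<close>

definition dfn :: "('f, 'r, 'a::linordered_field) fo_structure \<Rightarrow> ((nat \<Rightarrow> 'a) \<Rightarrow> bool) \<Rightarrow> bool" where
  "dfn M P \<longleftrightarrow> (\<exists>\<phi>. \<forall>v. P v = fo_sat M v \<phi>)"

text \<open>As in \<open>dfn\<close>, objects live on environments rather than on tuples of a fixed
  arity, so that the closure rules below compose without arity bookkeeping. Entry \<open>0\<close>
  holds the value and the arguments are shifted, the same convention as for a bound
  variable.\<close>

definition dft :: "('f, 'r, 'a::linordered_field) fo_structure \<Rightarrow> ((nat \<Rightarrow> 'a) \<Rightarrow> 'a) \<Rightarrow> bool" where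
  "dft M t \<longleftrightarrow> dfn M (\<lambda>v. v 0 = t (\<lambda>i. v (Suc i)))"

definition dfl :: "('f, 'r, 'a::linordered_field) fo_structure \<Rightarrow> nat \<Rightarrow> ((nat \<Rightarrow> 'a) \<Rightarrow> 'a list) \<Rightarrow> bool" where
  "dfl M n l \<longleftrightarrow> (\<forall>v. length (l v) = n) \<and> (\<forall>i<n. dft M (\<lambda>v. l v ! i))"

abbreviation "dfn1 M P \<equiv> dfn M (\<lambda>v. P (v 0))"
abbreviation "dfn2 M P \<equiv> dfn M (\<lambda>v. P (v 0) (v (Suc 0)))"
abbreviation "dfn3 M P \<equiv> dfn M (\<lambda>v. P (v 0) (v (Suc 0)) (v (Suc (Suc 0))))"
abbreviation "dft1 M f \<equiv> dft M (\<lambda>v. f (v 0))"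
abbreviation "dft2 M f \<equiv> dft M (\<lambda>v. f (v 0) (v (Suc 0)))"
abbreviation "dfl1 M n f \<equiv> dfl M n (\<lambda>v. f (v 0))"
abbreviation "dfl2 M n f \<equiv> dfl M n (\<lambda>v. f (v 0) (v (Suc 0)))"

section \<open>Renaming variables in formulas\<close>

fun tm_bound :: "('f, 'a) fo_term \<Rightarrow> nat" where
  "tm_bound (Var i) = Suc i"
| "tm_bound (Param a) = 0"
| "tm_bound (Add s t) = max (tm_bound s) (tm_bound t)"
| "tm_bound (Mul s t) = max (tm_bound s) (tm_bound t)"
| "tm_bound (Fun f ts) = Max (insert 0 (tm_bound ` set ts))"

text \<open>Bound indices are counted as well. An over-estimate suffices: truth depends on finitely
  many entries, and every index from the bound on is fresh.\<close>

fun fm_bound :: "('f, 'r, 'a) fo_formula \<Rightarrow> nat" where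
  "fm_bound (Eq s t) = max (tm_bound s) (tm_bound t)"
| "fm_bound (Less s t) = max (tm_bound s) (tm_bound t)"
| "fm_bound (Rel r ts) = Max (insert 0 (tm_bound ` set ts))"
| "fm_bound (Neg \<phi>) = fm_bound \<phi>"
| "fm_bound (Conj \<phi> \<psi>) = max (fm_bound \<phi>) (fm_bound \<psi>)"
| "fm_bound (Ex i \<phi>) = max (Suc i) (fm_bound \<phi>)"

lemma tm_bound_le: "t \<in> set ts \<Longrightarrow> tm_bound t \<le> Max (insert 0 (tm_bound ` set ts))"
  by (intro Max_ge) auto

lemma fo_value_cong:
  "(\<And>i. i < tm_bound t \<Longrightarrow> v i = w i) \<Longrightarrow> fo_value M v t = fo_value M w t"
proof (induction t)
  case (Fun f ts)
  have "fo_value M v t = fo_value M w t" if "t \<in> set ts" for t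
  proof (rule Fun.IH[OF that])
    fix i assume "i < tm_bound t"
    then show "v i = w i"
      by (intro Fun.prems) (use tm_bound_le[OF that] in simp)
  qed
  then have "map (fo_value M v) ts = map (fo_value M w) ts" by simp
  then show ?case by (simp del: map_eq_conv)
qed auto

lemma fo_sat_cong:
  "(\<And>i. i < fm_bound \<phi> \<Longrightarrow> v i = w i) \<Longrightarrow> fo_sat M v \<phi> = fo_sat M w \<phi>"
proof (induction \<phi> arbitrary: v w)
  case (Eq s t)
  have "fo_value M v s = fo_value M w s" "fo_value M v t = fo_value M w t"
    by (rule fo_value_cong, use Eq.prems in simp)+
  then show ?case by simp
next
  case (Less s t)
  have "fo_value M v s = fo_value M w s" "fo_value M v t = fo_value M w t"
    by (rule fo_value_cong, use Less.prems in simp)+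
  then show ?case by simp
next
  case (Rel r ts)
  have "fo_value M v t = fo_value M w t" if "t \<in> set ts" for t
  proof (rule fo_value_cong)
    fix i assume "i < tm_bound t"
    then show "v i = w i"
      by (intro Rel.prems) (use tm_bound_le[OF that] in simp)
  qed
  then have "map (fo_value M v) ts = map (fo_value M w) ts" by simp
  then show ?case by (simp del: map_eq_conv)
next
  case (Conj \<phi> \<psi>)
  have "fo_sat M v \<phi> = fo_sat M w \<phi>" "fo_sat M v \<psi> = fo_sat M w \<psi>"
    by (rule Conj.IH, use Conj.prems in simp)+
  then show ?case by simp
next
  case (Ex i \<phi>)
  have "fo_sat M (v(i := a)) \<phi> = fo_sat M (w(i := a)) \<phi>" for a
    by (rule Ex.IH) (use Ex.prems in auto)
  then show ?case by simp
next
  case (Neg \<phi>)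
  have "fo_sat M v \<phi> = fo_sat M w \<phi>" by (rule Neg.IH) (use Neg.prems in simp)
  then show ?case by simp
qed

fun tm_ren :: "(nat \<Rightarrow> nat) \<Rightarrow> ('f, 'a) fo_term \<Rightarrow> ('f, 'a) fo_term" where
  "tm_ren g (Var i) = Var (g i)"
| "tm_ren g (Param a) = Param a"
| "tm_ren g (Add s t) = Add (tm_ren g s) (tm_ren g t)"
| "tm_ren g (Mul s t) = Mul (tm_ren g s) (tm_ren g t)"
| "tm_ren g (Fun f ts) = Fun f (map (tm_ren g) ts)"

lemma fo_value_ren: "fo_value M v (tm_ren g t) = fo_value M (\<lambda>i. v (g i)) t"
proof (induction t)
  case (Fun f ts)
  have "map (fo_value M v) (map (tm_ren g) ts) = map (fo_value M (\<lambda>i. v (g i))) ts"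
    unfolding map_map by (rule map_cong) (simp_all add: Fun.IH)
  then show ?case by (simp del: map_eq_conv map_map)
qed simp_all

lemma fresh_index: "\<exists>j::nat. \<forall>k<(N::nat). g k < j"
  by (rule exI[of _ "Suc (Max (g ` {..<N}))"]) (auto simp: less_Suc_eq_le intro: Max_ge)

lemma fo_sat_ren: "\<exists>\<psi>. \<forall>v. fo_sat M v \<psi> = fo_sat M (\<lambda>i. v (g i)) \<phi>"
proof (induction \<phi> arbitrary: g)
  case (Eq s t)
  show ?case by (rule exI[of _ "Eq (tm_ren g s) (tm_ren g t)"]) (simp add: fo_value_ren)
next
  case (Less s t)
  show ?case by (rule exI[of _ "Less (tm_ren g s) (tm_ren g t)"]) (simp add: fo_value_ren)
next
  case (Rel r ts)
  have "map (fo_value M v) (map (tm_ren g) ts) = map (fo_value M (\<lambda>i. v (g i))) ts" for v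
    unfolding map_map by (rule map_cong) (simp_all add: fo_value_ren)
  then show ?case
    by (intro exI[of _ "Rel r (map (tm_ren g) ts)"]) (simp del: map_eq_conv map_map)
next
  case (Neg \<phi>)
  obtain \<psi> where "\<And>v. fo_sat M v \<psi> = fo_sat M (\<lambda>i. v (g i)) \<phi>" using Neg.IH by blast
  then show ?case by (intro exI[of _ "Neg \<psi>"]) simp
next
  case (Conj \<phi> \<psi>)
  obtain \<phi>' \<psi>' where "\<And>v. fo_sat M v \<phi>' = fo_sat M (\<lambda>i. v (g i)) \<phi>" "\<And>v. fo_sat M v \<psi>' = fo_sat M (\<lambda>i. v (g i)) \<psi>"
    using Conj.IH by metis
  then show ?case by (intro exI[of _ "Conj \<phi>' \<psi>'"]) simp
next
  case (Ex i \<phi>)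
  \<comment> \<open>The renaming \<open>g\<close> need not be injective. The bound variable is sent
    to an index above the image of every variable of \<open>\<phi>\<close>, so nothing is
    captured.\<close>
  obtain j where j: "\<And>k. k < fm_bound \<phi> \<Longrightarrow> g k < j" using fresh_index[of "fm_bound \<phi>" g] by blast
  obtain \<psi> where \<psi>: "\<And>v. fo_sat M v \<psi> = fo_sat M (\<lambda>k. v ((g(i := j)) k)) \<phi>" using Ex.IH by blast
  have "fo_sat M (v(j := a)) \<psi> = fo_sat M ((\<lambda>i. v (g i))(i := a)) \<phi>" for v a
    unfolding \<psi> by (rule fo_sat_cong) (use j in fastforce)
  then show ?case by (intro exI[of _ "Ex j \<psi>"]) simp
qed

section \<open>Logical closure and substitution\<close>

context
  fixes M :: "('f, 'r, 'a::linordered_field) fo_structure"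
begin

lemma dfn_ren: "dfn M P \<Longrightarrow> dfn M (\<lambda>v. P (\<lambda>i. v (g i)))"
  unfolding dfn_def using fo_sat_ren[of M g] by auto metis

lemma dfn_not: "dfn M P \<Longrightarrow> dfn M (\<lambda>v. \<not> P v)"
  unfolding dfn_def using fo_sat.simps(4)[of M] by metis

lemma dfn_conj: "dfn M P \<Longrightarrow> dfn M Q \<Longrightarrow> dfn M (\<lambda>v. P v \<and> Q v)"
  unfolding dfn_def using fo_sat.simps(5)[of M] by metis

lemma dfn_cong: "dfn M P \<Longrightarrow> (\<And>v. P v = Q v) \<Longrightarrow> dfn M Q"
  unfolding dfn_def by simp

lemma dfn_disj:
  assumes "dfn M P" "dfn M Q"
  shows "dfn M (\<lambda>v. P v \<or> Q v)"
  by (rule dfn_cong[OF dfn_not[OF dfn_conj[OF dfn_not[OF assms(1)] dfn_not[OF assms(2)]]]]) simp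

lemma dfn_imp:
  assumes "dfn M P" "dfn M Q"
  shows "dfn M (\<lambda>v. P v \<longrightarrow> Q v)"
  by (rule dfn_cong[OF dfn_disj[OF dfn_not[OF assms(1)] assms(2)]]) simp

lemma dfn_iff:
  assumes "dfn M P" "dfn M Q"
  shows "dfn M (\<lambda>v. P v \<longleftrightarrow> Q v)"
  by (rule dfn_cong[OF dfn_conj[OF dfn_imp[OF assms] dfn_imp[OF assms(2,1)]]]) blast

lemma dfn_const: "dfn M (\<lambda>v. c)"
proof -
  have "\<forall>v. fo_sat M v (if c then Eq (Var 0) (Var 0) else Less (Var 0) (Var 0)) = c" by simp
  then show ?thesis unfolding dfn_def by metis
qed

text \<open>The body of a quantifier is stated in the environment whose entry \<open>0\<close> is the bound variable.\<close>

lemma dfn_ex: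
  assumes "dfn M (\<lambda>v. Q (\<lambda>i. v (Suc i)) (v 0))"
  shows "dfn M (\<lambda>v. \<exists>a. Q v a)"
proof -
  obtain \<phi> where \<phi>: "\<And>v. Q (\<lambda>i. v (Suc i)) (v 0) = fo_sat M v \<phi>"
    using assms unfolding dfn_def by blast
  \<comment> \<open>The other entries move down by one, and entry \<open>0\<close> is renamed to an
    index that none of them can reach; one named quantifier over \<open>j\<close> then does the
    work.\<close>
  define j where "j = Suc (fm_bound \<phi>)"
  obtain \<psi> where \<psi>: "\<And>v. fo_sat M v \<psi> = fo_sat M (\<lambda>k. v (case_nat j (\<lambda>i. i) k)) \<phi>"
    using fo_sat_ren by blast
  have "fo_sat M (v(j := a)) \<psi> = fo_sat M (case_nat a v) \<phi>" for v a
    unfolding \<psi> by (rule fo_sat_cong) (auto simp: j_def split: nat.split)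
  moreover have "Q v a = fo_sat M (case_nat a v) \<phi>" for v a
    using \<phi>[of "case_nat a v"] by simp
  ultimately have "(\<exists>a. Q v a) = fo_sat M v (Ex j \<psi>)" for v by simp
  then show ?thesis unfolding dfn_def by blast
qed

lemma dfn_all:
  assumes "dfn M (\<lambda>v. Q (\<lambda>i. v (Suc i)) (v 0))"
  shows "dfn M (\<lambda>v. \<forall>a. Q v a)"
  by (rule dfn_cong[OF dfn_not[OF dfn_ex[of "\<lambda>v a. \<not> Q v a"]]]) (use dfn_not[OF assms] in simp_all)

text \<open>The list occupies the first \<open>n\<close> entries of the environment. Its last
  component is quantified outermost, the order in which \<open>chl\<close> later chooses.\<close>

lemma dfn_exl:
  assumes "dfn M (\<lambda>v. Q (\<lambda>i. v (i + n)) (map v [0..<n]))"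
  shows "dfn M (\<lambda>v. \<exists>xs. length xs = n \<and> Q v xs)"
  using assms
proof (induction n arbitrary: Q)
  case (Suc n)
  have "dfn M (\<lambda>v. \<exists>x xs. length xs = n \<and> Q v (xs @ [x]))"
    by (rule dfn_ex, rule Suc.IH) (use Suc.prems in simp)
  moreover have "(\<exists>x xs. length xs = n \<and> Q v (xs @ [x])) = (\<exists>xs. length xs = Suc n \<and> Q v xs)" for v
    by (auto simp: length_Suc_conv_rev)
  ultimately show ?case by (rule dfn_cong)
qed simp

lemma dfn_all_less: "(\<And>i::nat. i < n \<Longrightarrow> dfn M (\<lambda>v. P i v)) \<Longrightarrow> dfn M (\<lambda>v. \<forall>i<n. P i v)"
proof (induction n)
  case (Suc n)
  then have "dfn M (\<lambda>v. (\<forall>i<n. P i v) \<and> P n v)" by (intro dfn_conj) auto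
  then show ?case by (rule dfn_cong) (auto simp: less_Suc_eq)
qed (simp add: dfn_const)

lemma dfn_ex_less: "(\<And>i::nat. i < n \<Longrightarrow> dfn M (\<lambda>v. P i v)) \<Longrightarrow> dfn M (\<lambda>v. \<exists>i<n. P i v)"
  by (rule dfn_cong[OF dfn_not[OF dfn_all_less[of n "\<lambda>i v. \<not> P i v"]]]) (auto intro: dfn_not)

text \<open>A formula sees only its first \<open>N\<close> entries, so substituting
  \<open>\<sigma>\<close> amounts to quantifying over \<open>N\<close> reals constrained to be the
  substituted values. This also covers functions that are given only through a definable
  graph.\<close>

lemma dfn_subst:
  assumes P: "dfn M P" and \<sigma>: "\<And>i. dft M (\<lambda>v. \<sigma> v i)"
  shows "dfn M (\<lambda>v. P (\<sigma> v))"
proof -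
  obtain \<phi> where \<phi>: "\<And>v. P v = fo_sat M v \<phi>" using P unfolding dfn_def by blast
  define N where "N = fm_bound \<phi>"
  have cong: "P v = P w" if "\<And>i. i < N \<Longrightarrow> v i = w i" for v w
    unfolding \<phi> by (rule fo_sat_cong) (use that N_def in auto)
  have "dfn M (\<lambda>v. v i = \<sigma> (\<lambda>j. v (j + N)) i)" for i
    using dfn_ren[OF \<sigma>[of i, unfolded dft_def], of "case_nat i (\<lambda>j. j + N)"] by simp
  then have "dfn M (\<lambda>v. (\<forall>i<N. v i = \<sigma> (\<lambda>j. v (j + N)) i) \<and> P v)"
    by (intro dfn_conj dfn_all_less P)
  then have "dfn M (\<lambda>v. \<exists>xs. length xs = N \<and> (\<forall>i<N. xs ! i = \<sigma> v i) \<and> P (nth xs))"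
  proof (intro dfn_exl, elim dfn_cong)
    fix v :: "nat \<Rightarrow> 'a"
    have "P v = P (nth (map v [0..<N]))" by (rule cong) simp
    then show "((\<forall>i<N. v i = \<sigma> (\<lambda>j. v (j + N)) i) \<and> P v) =
      ((\<forall>i<N. map v [0..<N] ! i = \<sigma> (\<lambda>i. v (i + N)) i) \<and> P (nth (map v [0..<N])))"
      by simp
  qed
  then show ?thesis
  proof (rule dfn_cong)
    fix v
    show "(\<exists>xs. length xs = N \<and> (\<forall>i<N. xs ! i = \<sigma> v i) \<and> P (nth xs)) = P (\<sigma> v)"
    proof
      assume *: "P (\<sigma> v)"
      have "P (nth (map (\<sigma> v) [0..<N])) = P (\<sigma> v)" by (rule cong) simp
      with * show "\<exists>xs. length xs = N \<and> (\<forall>i<N. xs ! i = \<sigma> v i) \<and> P (nth xs)"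
        by (intro exI[of _ "map (\<sigma> v) [0..<N]"]) simp
    next
      assume "\<exists>xs. length xs = N \<and> (\<forall>i<N. xs ! i = \<sigma> v i) \<and> P (nth xs)"
      then obtain xs where "\<And>i. i < N \<Longrightarrow> xs ! i = \<sigma> v i" "P (nth xs)" by blast
      then show "P (\<sigma> v)" using cong[of "nth xs" "\<sigma> v"] by simp
    qed
  qed
qed

section \<open>Definable functions, field operations and tuples\<close>

lemma dft_var: "dft M (\<lambda>v. v i)"
  unfolding dft_def dfn_def by (rule exI[of _ "Eq (Var 0) (Var (Suc i))"]) simp

lemma dft_const: "dft M (\<lambda>v. c)"
  unfolding dft_def dfn_def by (rule exI[of _ "Eq (Var 0) (Param c)"]) simp

lemma dfn_app1:
  assumes "dfn1 M R" "dft M s"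
  shows "dfn M (\<lambda>v. R (s v))"
  using dfn_subst[OF assms(1), of "\<lambda>v _. s v"] assms(2) by simp

lemma dfn_app2:
  assumes "dfn2 M R" "dft M s" "dft M t"
  shows "dfn M (\<lambda>v. R (s v) (t v))"
proof -
  have "dft M (\<lambda>v. case_nat (s v) (\<lambda>_. t v) i)" for i
    by (cases i) (simp_all add: assms)
  from dfn_subst[OF assms(1), where \<sigma> = "\<lambda>v. case_nat (s v) (\<lambda>_. t v)", OF this] show ?thesis by simp
qed

lemma dfn_app3:
  assumes "dfn3 M R" "dft M s" "dft M t" "dft M u"
  shows "dfn M (\<lambda>v. R (s v) (t v) (u v))"
proof -
  have "dft M (\<lambda>v. case_nat (s v) (case_nat (t v) (\<lambda>_. u v)) i)" for i
    by (cases i; cases "i - 1") (simp_all add: assms)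
  from dfn_subst[OF assms(1), where \<sigma> = "\<lambda>v. case_nat (s v) (case_nat (t v) (\<lambda>_. u v))", OF this] show ?thesis by simp
qed

lemma dfn_app_env:
  assumes "dfn M (\<lambda>v. Q (\<lambda>i. v (Suc i)) (v 0))" "\<And>i. dft M (\<lambda>v. s v i)" "dft M t"
  shows "dfn M (\<lambda>v. Q (s v) (t v))"
proof -
  have "dft M (\<lambda>v. case_nat (t v) (s v) i)" for i
    by (cases i) (simp_all add: assms)
  from dfn_subst[OF assms(1), where \<sigma> = "\<lambda>v. case_nat (t v) (s v)", OF this] show ?thesis by simp
qed

lemma dfn_eq: "dft M s \<Longrightarrow> dft M t \<Longrightarrow> dfn M (\<lambda>v. s v = t v)"
  by (rule dfn_app2[where R = "(=)"])
    (auto simp: dfn_def intro: exI[of _ "Eq (Var 0) (Var (Suc 0))"])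

lemma dfn_less: "dft M s \<Longrightarrow> dft M t \<Longrightarrow> dfn M (\<lambda>v. s v < t v)"
  by (rule dfn_app2[where R = "(<)"])
    (auto simp: dfn_def intro: exI[of _ "Less (Var 0) (Var (Suc 0))"])

lemma dfn_le: "dft M s \<Longrightarrow> dft M t \<Longrightarrow> dfn M (\<lambda>v. s v \<le> t v)"
  by (rule dfn_cong[OF dfn_not[OF dfn_less[of t s]]]) auto

lemma dft_ren: "dft M t \<Longrightarrow> dft M (\<lambda>v. t (\<lambda>i. v (g i)))"
  unfolding dft_def using dfn_ren[of "\<lambda>v. v 0 = t (\<lambda>i. v (Suc i))" "case_nat 0 (\<lambda>i. Suc (g i))"]
  by simp

lemma dft_graph:
  assumes "dfn M (\<lambda>v. G (\<lambda>i. v (Suc i)) (v 0))" "\<And>v y. G v y \<longleftrightarrow> y = t v"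
  shows "dft M t"
  using assms by (simp add: dft_def)

lemma dft_app1:
  assumes "dft1 M f" "dft M s"
  shows "dft M (\<lambda>v. f (s v))"
proof -
  have "dfn M (\<lambda>v. v 0 = f (v (Suc 0)))" using assms(1) by (simp add: dft_def)
  from dfn_app2[where R = "\<lambda>x y. x = f y", OF this dft_var dft_ren[OF assms(2)]]
  show ?thesis by (simp add: dft_def)
qed

lemma dft_app2:
  assumes "dft2 M f" "dft M s" "dft M t"
  shows "dft M (\<lambda>v. f (s v) (t v))"
proof -
  have "dfn M (\<lambda>v. v 0 = f (v (Suc 0)) (v (Suc (Suc 0))))" using assms(1) by (simp add: dft_def)
  from dfn_app3[where R = "\<lambda>x y z. x = f y z", OF this dft_var dft_ren[OF assms(2)] dft_ren[OF assms(3)]]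
  show ?thesis by (simp add: dft_def)
qed

lemma dft_add: "dft M s \<Longrightarrow> dft M t \<Longrightarrow> dft M (\<lambda>v. s v + t v)"
  by (rule dft_app2[where f = "(+)"])
    (auto simp: dft_def dfn_def intro: exI[of _ "Eq (Var 0) (Add (Var (Suc 0)) (Var (Suc (Suc 0))))"])

lemma dft_mult: "dft M s \<Longrightarrow> dft M t \<Longrightarrow> dft M (\<lambda>v. s v * t v)"
  by (rule dft_app2[where f = "(*)"])
    (auto simp: dft_def dfn_def intro: exI[of _ "Eq (Var 0) (Mul (Var (Suc 0)) (Var (Suc (Suc 0))))"])

lemma dft_uminus: "dft M s \<Longrightarrow> dft M (\<lambda>v. - s v)"
  using dft_mult[OF dft_const[of "-1"]] by fastforce

lemma dft_diff:
  assumes "dft M s" "dft M t"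
  shows "dft M (\<lambda>v. s v - t v)"
  using dft_add[OF assms(1) dft_uminus[OF assms(2)]] by simp

lemma dft_if:
  assumes "dfn M c" "dft M s" "dft M t"
  shows "dft M (\<lambda>v. if c v then s v else t v)"
proof (rule dft_graph)
  show "dfn M (\<lambda>v. (\<lambda>v y. (c v \<and> y = s v) \<or> (\<not> c v \<and> y = t v)) (\<lambda>i. v (Suc i)) (v 0))"
    by (intro dfn_disj dfn_conj dfn_not dfn_eq dft_var dft_ren[OF assms(2)] dft_ren[OF assms(3)]
        dfn_ren[OF assms(1)])
qed auto

lemma dft_abs: "dft M s \<Longrightarrow> dft M (\<lambda>v. \<bar>s v\<bar>)"
  unfolding abs_if by (intro dft_if dfn_less dft_uminus dft_const)

lemma dft_inverse: "dft M s \<Longrightarrow> dft M (\<lambda>v. inverse (s v))"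
proof (rule dft_app1[where f = inverse], rule dft_graph)
  \<comment> \<open>The first disjunct accounts for the convention that \<open>inverse 0\<close> is
    \<open>0\<close>.\<close>
  show "dfn M (\<lambda>v. (\<lambda>v y. v 0 = 0 \<and> y = 0 \<or> y * v 0 = 1) (\<lambda>i. v (Suc i)) (v 0))"
    by (intro dfn_disj dfn_conj dfn_eq dft_var dft_const dft_mult)
  show "(v 0 = 0 \<and> y = 0 \<or> y * v 0 = 1) = (y = inverse (v 0))" for v :: "nat \<Rightarrow> 'a" and y
    by (cases "v 0 = 0") (auto simp: inverse_eq_divide eq_divide_eq)
qed

lemma dft_divide: "dft M s \<Longrightarrow> dft M t \<Longrightarrow> dft M (\<lambda>v. s v / t v)"
  unfolding divide_inverse by (intro dft_mult dft_inverse)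

lemma dft_subst:
  assumes "dft M t" "\<And>i. dft M (\<lambda>v. \<sigma> v i)"
  shows "dft M (\<lambda>v. t (\<sigma> v))"
proof -
  have "dfn M (\<lambda>v. case_nat (v 0) (\<sigma> (\<lambda>i. v (Suc i))) 0
      = t (\<lambda>i. case_nat (v 0) (\<sigma> (\<lambda>i. v (Suc i))) (Suc i)))"
  proof (rule dfn_subst[OF assms(1)[unfolded dft_def]])
    show "dft M (\<lambda>v. case_nat (v 0) (\<sigma> (\<lambda>i. v (Suc i))) i)" for i
      by (cases i) (simp_all add: dft_var dft_ren[OF assms(2)])
  qed
  then show ?thesis by (simp add: dft_def)
qed

lemma dfl_nth: "dfl M n l \<Longrightarrow> i < n \<Longrightarrow> dft M (\<lambda>v. l v ! i)"
  by (simp add: dfl_def)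

lemma dfl_length: "dfl M n l \<Longrightarrow> length (l v) = n"
  by (simp add: dfl_def)

lemma dfl_map_env: "dfl M n (\<lambda>v. map v [0..<n])"
  by (simp add: dfl_def dft_var)

lemma dfl_map_env_shift: "dfl M n (\<lambda>v. map (\<lambda>i. v (g i)) [0..<n])"
  by (simp add: dfl_def dft_var)

lemma dfl_const: "length xs = n \<Longrightarrow> dfl M n (\<lambda>v. xs)"
  by (simp add: dfl_def dft_const)

lemma dfl_ren: "dfl M n l \<Longrightarrow> dfl M n (\<lambda>v. l (\<lambda>i. v (g i)))"
  by (simp add: dfl_def dft_ren[of "\<lambda>v. l v ! _"])

lemma dfl_subst: "dfl M n l \<Longrightarrow> (\<And>i. dft M (\<lambda>v. \<sigma> v i)) \<Longrightarrow> dfl M n (\<lambda>v. l (\<sigma> v))"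
  by (simp add: dfl_def dft_subst[of "\<lambda>v. l v ! _"])

lemma dfl_app1: "dfl1 M n f \<Longrightarrow> dft M s \<Longrightarrow> dfl M n (\<lambda>v. f (s v))"
  using dfl_subst[of n "\<lambda>v. f (v 0)" "\<lambda>v _. s v"] by simp

lemma dfl_app2:
  assumes "dfl2 M n f" "dft M s" "dft M t"
  shows "dfl M n (\<lambda>v. f (s v) (t v))"
proof -
  have "dft M (\<lambda>v. case_nat (s v) (\<lambda>_. t v) i)" for i
    by (cases i) (simp_all add: assms)
  from dfl_subst[OF assms(1), where \<sigma> = "\<lambda>v. case_nat (s v) (\<lambda>_. t v)", OF this] show ?thesis by simp
qed

lemma dfl_snoc: "dfl M n l \<Longrightarrow> dft M t \<Longrightarrow> dfl M (Suc n) (\<lambda>v. l v @ [t v])"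
  by (auto simp: dfl_def nth_append less_Suc_eq)

lemma dfl_Cons: "dft M t \<Longrightarrow> dfl M n l \<Longrightarrow> dfl M (Suc n) (\<lambda>v. t v # l v)"
  unfolding dfl_def by (auto simp: less_Suc_eq_0_disj)

lemma dfn_list_eq:
  assumes "dfl M n l" "dfl M n k"
  shows "dfn M (\<lambda>v. l v = k v)"
proof -
  have "dfn M (\<lambda>v. \<forall>i<n. l v ! i = k v ! i)"
    by (intro dfn_all_less dfn_eq dfl_nth[OF assms(1)] dfl_nth[OF assms(2)])
  then show ?thesis by (rule dfn_cong) (use assms in \<open>auto simp: dfl_def list_eq_iff_nth_eq\<close>)
qed

lemma dfn_app_list:
  assumes "dfn M (\<lambda>v. Q (\<lambda>i. v (i + n)) (map v [0..<n]))"
    "\<And>i. dft M (\<lambda>v. s v i)" "dfl M n l"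
  shows "dfn M (\<lambda>v. Q (s v) (l v))"
proof -
  define \<sigma> where "\<sigma> v i = (if i < n then l v ! i else s v (i - n))" for v i
  have "dft M (\<lambda>v. \<sigma> v i)" for i
    by (cases "i < n") (use assms in \<open>auto simp: \<sigma>_def dfl_def\<close>)
  from dfn_subst[OF assms(1) this]
  have "dfn M (\<lambda>v. Q (\<lambda>i. \<sigma> v (i + n)) (map (\<sigma> v) [0..<n]))" .
  moreover have "map (\<sigma> v) [0..<n] = l v" for v
    using assms(3) by (auto simp: \<sigma>_def dfl_def list_eq_iff_nth_eq)
  ultimately show ?thesis by (simp add: \<sigma>_def)
qed

text \<open>The bridge between sets of lists and environments. The length condition stands apart
  because \<open>map v [0..<n]\<close> always has length \<open>n\<close>; in the other direction
  \<open>nth_default 0\<close> supplies the missing entries.\<close>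

lemma definable_iff_dfn:
  "definable M n X \<longleftrightarrow> (\<forall>xs\<in>X. length xs = n) \<and> dfn M (\<lambda>v. map v [0..<n] \<in> X)"
proof
  assume "definable M n X"
  then obtain \<phi> where \<phi>: "X = {xs. length xs = n \<and> fo_sat M (nth_default 0 xs) \<phi>}"
    unfolding definable_def by blast
  have "dfn M (\<lambda>v. fo_sat M v \<phi>)" by (auto simp: dfn_def)
  moreover have "dft M (\<lambda>v. nth_default 0 (map v [0..<n]) i)" for i
    by (cases "i < n") (auto simp: nth_default_def dft_var dft_const)
  ultimately have "dfn M (\<lambda>v. fo_sat M (nth_default 0 (map v [0..<n])) \<phi>)" by (rule dfn_subst)
  then show "(\<forall>xs\<in>X. length xs = n) \<and> dfn M (\<lambda>v. map v [0..<n] \<in> X)" by (simp add: \<phi>)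
next
  assume *: "(\<forall>xs\<in>X. length xs = n) \<and> dfn M (\<lambda>v. map v [0..<n] \<in> X)"
  then obtain \<phi> where \<phi>: "\<And>v. (map v [0..<n] \<in> X) = fo_sat M v \<phi>" unfolding dfn_def by blast
  have "xs \<in> X \<longleftrightarrow> fo_sat M (nth_default 0 xs) \<phi>" if "length xs = n" for xs
  proof -
    have "map (nth_default 0 xs) [0..<n] = xs"
      using that by (auto simp: list_eq_iff_nth_eq nth_default_def)
    then show ?thesis using \<phi>[of "nth_default 0 xs"] by simp
  qed
  then have "X = {xs. length xs = n \<and> fo_sat M (nth_default 0 xs) \<phi>}"
    using * by blast
  then show "definable M n X" unfolding definable_def by blast
qed

lemma dfn_mem:
  assumes "definable M n X" "dfl M n l"
  shows "dfn M (\<lambda>v. l v \<in> X)"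
proof -
  have "dfn M (\<lambda>v. map v [0..<n] \<in> X)" using assms(1) by (simp add: definable_iff_dfn)
  from dfn_app_list[where Q = "\<lambda>_ xs. xs \<in> X", OF this dft_var assms(2)] show ?thesis .
qed

lemma definableI:
  "(\<And>xs. xs \<in> X \<Longrightarrow> length xs = n) \<Longrightarrow> dfn M (\<lambda>v. map v [0..<n] \<in> X) \<Longrightarrow> definable M n X"
  by (simp add: definable_iff_dfn)

lemma definable_relI:
  assumes P: "dfn M (\<lambda>v. P (map v [0..<m]) (map (\<lambda>i. v (i + m)) [0..<n]))"
    and len: "\<And>xs ys. P xs ys \<Longrightarrow> length xs = m \<and> length ys = n"
  shows "definable M (m + n) {xs @ ys |xs ys. P xs ys}"
proof (rule definableI)
  show "length zs = m + n" if "zs \<in> {xs @ ys |xs ys. P xs ys}" for zs using that len by auto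
  show "dfn M (\<lambda>v. map v [0..<m + n] \<in> {xs @ ys |xs ys. P xs ys})"
  proof (rule dfn_cong[OF P])
    fix v :: "nat \<Rightarrow> 'a"
    have "map v [0..<m + n] = map v [0..<m] @ map (\<lambda>i. v (i + m)) [0..<n]"
      by (auto simp: list_eq_iff_nth_eq nth_append)
    moreover have "map v [0..<m] = xs \<and> map (\<lambda>i. v (i + m)) [0..<n] = ys"
      if "map v [0..<m] @ map (\<lambda>i. v (i + m)) [0..<n] = xs @ ys" "P xs ys" for xs ys
      using that(1) len[OF that(2)] by (simp add: append_eq_append_conv)
    ultimately show "P (map v [0..<m]) (map (\<lambda>i. v (i + m)) [0..<n]) = (map v [0..<m + n] \<in> {xs @ ys |xs ys. P xs ys})"
      by (simp del: upt_Suc map_eq_conv) metis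
  qed
qed

lemma definable_mapI:
  assumes X: "definable M m X" and f: "dfl M n (\<lambda>v. f (map v [0..<m]))"
  shows "definable_map M m n X f"
proof -
  have len: "length (f xs) = n" if "length xs = m" for xs
  proof -
    have "map (nth xs) [0..<m] = xs" using that by (auto simp: list_eq_iff_nth_eq)
    then show ?thesis using dfl_length[OF f, of "nth xs"] by simp
  qed
  have "definable M (m + n) {xs @ ys |xs ys. xs \<in> X \<and> ys = f xs}"
    using X len by (intro definable_relI dfn_conj dfn_mem[OF X] dfl_map_env dfn_list_eq[OF _ f] dfl_map_env_shift)
      (auto simp: definable_iff_dfn)
  moreover have "{xs @ ys |xs ys. xs \<in> X \<and> ys = f xs} = {xs @ f xs |xs. xs \<in> X}" by blast
  ultimately show ?thesis using X by (simp add: definable_map_def)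
qed

end

lemmas dfn_intros = dfn_not dfn_conj dfn_disj dfn_imp dfn_iff dfn_ex dfn_all dfn_eq dfn_less dfn_le
lemmas dft_intros = dft_var dft_const dft_add dft_mult dft_uminus dft_diff dft_if dft_abs dft_divide

section \<open>One-variable o-minimality\<close>

text \<open>A relation, since the field need not be complete: infima are shown to exist for
  definable predicates only.\<close>

definition is_inf :: "('a::linorder \<Rightarrow> bool) \<Rightarrow> 'a \<Rightarrow> bool" where
  "is_inf Q a \<longleftrightarrow> (\<forall>x. Q x \<longrightarrow> a \<le> x) \<and> (\<forall>b. (\<forall>x. Q x \<longrightarrow> b \<le> x) \<longrightarrow> b \<le> a)"

definition is_sup :: "('a::linorder \<Rightarrow> bool) \<Rightarrow> 'a \<Rightarrow> bool" where
  "is_sup Q a \<longleftrightarrow> (\<forall>x. Q x \<longrightarrow> x \<le> a) \<and> (\<forall>b. (\<forall>x. Q x \<longrightarrow> x \<le> b) \<longrightarrow> a \<le> b)"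

lemma is_inf_unique: "is_inf Q a \<Longrightarrow> is_inf Q b \<Longrightarrow> a = b"
  by (simp add: is_inf_def order.antisym)

lemma is_inf_approx: "is_inf Q a \<Longrightarrow> a < b \<Longrightarrow> \<exists>x. Q x \<and> a \<le> x \<and> x < b"
  by (metis is_inf_def not_le)

lemma is_sup_approx: "is_sup Q a \<Longrightarrow> b < a \<Longrightarrow> \<exists>x. Q x \<and> x \<le> a \<and> b < x"
  by (metis is_sup_def not_le)

lemma infinite_interval: "a < b \<Longrightarrow> infinite {x. a < x \<and> x < b}" for a b :: "'a::linordered_field"
  using infinite_Ioo[of a b] by (simp only: greaterThanLessThan_eq[symmetric] greaterThanLessThan_iff Collect_conj_eq greaterThanLessThan_def greaterThan_def lessThan_def not_False_eq_True)

lemma infinite_no_least: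
  fixes S :: "'a::linorder set"
  assumes "S \<noteq> {}" "\<And>x. x \<in> S \<Longrightarrow> \<exists>y\<in>S. y < x"
  shows "infinite S"
proof
  assume "finite S"
  then have "Min S \<in> S" using assms(1) by simp
  then obtain y where "y \<in> S" "y < Min S" using assms(2) by blast
  then show False using Min_le[OF \<open>finite S\<close>, of y] by simp
qed

locale omin_structure =
  fixes M :: "('f, 'r, 'a::linordered_field) fo_structure"
  assumes omin: "o_minimal M"
begin

lemma definable_pieces:
  assumes "dfn1 M Q"
  shows "\<exists>\<I>. finite \<I> \<and> (\<forall>I\<in>\<I>. point_or_open_interval I) \<and> {x. Q x} = \<Union>\<I>"
proof -
  have "definable M 1 {[x] |x. Q x}"
    by (rule definableI) (use assms in auto)
  with omin have "\<exists>\<I>. finite \<I> \<and> (\<forall>I\<in>\<I>. point_or_open_interval I) \<and> {x. [x] \<in> {[x] |x. Q x}} = \<Union>\<I>"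
    unfolding o_minimal_def by (elim allE impE)
  then show ?thesis by simp
qed

text \<open>Of finitely many pieces with infinite union one is infinite, and an infinite piece is
  not a point.\<close>

lemma infinite_has_interval:
  assumes "dfn1 M Q" "infinite {x. Q x}"
  shows "\<exists>a b. a < b \<and> (\<forall>x\<in>{a<..<b}. Q x)"
proof -
  obtain \<I> where \<I>: "finite \<I>" "\<And>I. I \<in> \<I> \<Longrightarrow> point_or_open_interval I" "{x. Q x} = \<Union>\<I>"
    using definable_pieces[OF assms(1)] by blast
  then obtain I where I: "I \<in> \<I>" "infinite I" using assms(2) by fastforce
  have "\<exists>a b. a < b \<and> {a<..<b} \<subseteq> I"
    using \<I>(2)[OF I(1)] unfolding point_or_open_interval_def
  proof (elim disjE exE)
    fix a b assume "I = {a<..<b}"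
    then show ?thesis using I(2) by (cases "a < b") auto
  next
    fix a assume "I = {a<..}"
    then show ?thesis by (intro exI[of _ a] exI[of _ "a + 1"]) auto
  next
    fix a assume "I = {..<a}"
    then show ?thesis by (intro exI[of _ "a - 1"] exI[of _ a]) auto
  next
    assume "I = UNIV"
    then show ?thesis by (intro exI[of _ 0] exI[of _ 1]) auto
  qed (use I(2) in auto)
  then show ?thesis using \<I>(3) I(1) by blast
qed

lemma infinite_has_subinterval:
  assumes "dfn1 M Q" "infinite {x. l < x \<and> x < r \<and> Q x}"
  shows "\<exists>a b. l \<le> a \<and> a < b \<and> b \<le> r \<and> (\<forall>x\<in>{a<..<b}. Q x)"
proof -
  have "dfn M (\<lambda>v. l < v 0 \<and> v 0 < r \<and> Q (v 0))"
    by (intro dfn_intros dft_intros assms)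
  from infinite_has_interval[OF this assms(2)] obtain a b
    where ab: "a < b" "\<And>x. a < x \<Longrightarrow> x < b \<Longrightarrow> l < x \<and> x < r \<and> Q x" by auto
  obtain m where "a < m" "m < b" using dense[OF ab(1)] by blast
  with ab(2)[of m] have "l < m" "m < r" by simp_all
  with \<open>a < m\<close> \<open>m < b\<close> have "max a l < min b r" by auto
  with ab(2) show ?thesis
    by (intro exI[of _ "max a l"] exI[of _ "min b r"]) simp
qed

lemma interval_split:
  assumes "dfn1 M Q" "a < b"
  shows "\<exists>c d. a \<le> c \<and> c < d \<and> d \<le> b \<and> ((\<forall>x\<in>{c<..<d}. Q x) \<or> (\<forall>x\<in>{c<..<d}. \<not> Q x))"
proof (cases "finite {x. a < x \<and> x < b \<and> Q x}")
  case True
  have "infinite ({x. a < x \<and> x < b} - {x. a < x \<and> x < b \<and> Q x})"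
    using True infinite_interval[OF assms(2)] by (rule Diff_infinite_finite)
  also have "{x. a < x \<and> x < b} - {x. a < x \<and> x < b \<and> Q x} = {x. a < x \<and> x < b \<and> \<not> Q x}" by auto
  finally have "infinite {x. a < x \<and> x < b \<and> \<not> Q x}" .
  from infinite_has_subinterval[OF dfn_not[OF assms(1)] this] show ?thesis by blast
qed (use infinite_has_subinterval[OF assms(1)] in blast)

text \<open>A single point or interval either contains or misses a whole right neighbourhood of
  \<open>a\<close>, and for finitely many pieces the least radius serves for all.\<close>

lemma germ_right:
  assumes "dfn1 M Q"
  shows "\<exists>e>0. (\<forall>x. a < x \<and> x < a + e \<longrightarrow> Q x) \<or> (\<forall>x. a < x \<and> x < a + e \<longrightarrow> \<not> Q x)"
proof -
  obtain \<I> where \<I>: "finite \<I>" "\<And>I. I \<in> \<I> \<Longrightarrow> point_or_open_interval I" "{x. Q x} = \<Union>\<I>"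
    using definable_pieces[OF assms] by blast
  have "\<exists>e>0. (\<forall>x. a < x \<and> x < a + e \<longrightarrow> x \<in> \<Union>\<I>) \<or> (\<forall>x. a < x \<and> x < a + e \<longrightarrow> x \<notin> \<Union>\<I>)"
    using \<I>(1,2)
  proof (induction \<I>)
    case empty
    then show ?case by (auto intro: exI[of _ 1])
  next
    case (insert I \<I>)
    have "\<exists>e>0. (\<forall>x. a < x \<and> x < a + e \<longrightarrow> x \<in> I) \<or> (\<forall>x. a < x \<and> x < a + e \<longrightarrow> x \<notin> I)"
    proof -
      have pt: "\<exists>e>0. (\<forall>x. a < x \<and> x < a + e \<longrightarrow> x < b) \<or> (\<forall>x. a < x \<and> x < a + e \<longrightarrow> b < x)" for b
        by (cases "a < b") (auto intro: exI[of _ "b - a"] exI[of _ 1])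
      have "point_or_open_interval I" using insert.prems by simp
      then show ?thesis unfolding point_or_open_interval_def
      proof (elim disjE exE)
        fix b c assume I: "I = {b<..<c}"
        obtain e f where "e > 0" "f > 0"
          and "(\<forall>x. a < x \<and> x < a + e \<longrightarrow> x < b) \<or> (\<forall>x. a < x \<and> x < a + e \<longrightarrow> b < x)"
          and "(\<forall>x. a < x \<and> x < a + f \<longrightarrow> x < c) \<or> (\<forall>x. a < x \<and> x < a + f \<longrightarrow> c < x)"
          using pt[of b] pt[of c] by blast
        then show ?thesis using I by (intro exI[of _ "min e f"]) (auto simp: min_less_iff_conj)
      next
        fix b assume "I = {b}"
        then show ?thesis using pt[of b] by (metis less_irrefl singletonD)
      next
        fix b assume "I = {b<..}"
        then show ?thesis using pt[of b] by (meson greaterThan_iff less_asym)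
      next
        fix b assume "I = {..<b}"
        then show ?thesis using pt[of b] by (meson lessThan_iff less_asym)
      next
        assume "I = UNIV"
        then show ?thesis by (auto intro: exI[of _ 1])
      qed
    qed
    then obtain e where e: "e > 0" "(\<forall>x. a < x \<and> x < a + e \<longrightarrow> x \<in> I) \<or> (\<forall>x. a < x \<and> x < a + e \<longrightarrow> x \<notin> I)"
      by blast
    obtain f where f: "f > 0" "(\<forall>x. a < x \<and> x < a + f \<longrightarrow> x \<in> \<Union>\<I>) \<or> (\<forall>x. a < x \<and> x < a + f \<longrightarrow> x \<notin> \<Union>\<I>)"
      using insert by auto
    show ?case using e f by (intro exI[of _ "min e f"]) (auto simp: min_less_iff_conj)
  qed
  then show ?thesis by (simp only: \<I>(3)[symmetric] mem_Collect_eq)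
qed

text \<open>The infimum of a finite union is the least of the infima of its nonempty pieces; the
  lower bound \<open>b\<close> rules out pieces that are unbounded below.\<close>

lemma inf_exists:
  assumes "dfn1 M Q" "Q x" "\<And>y. Q y \<Longrightarrow> b \<le> y"
  shows "\<exists>a. is_inf Q a"
proof -
  obtain \<I> where \<I>: "finite \<I>" "\<And>I. I \<in> \<I> \<Longrightarrow> point_or_open_interval I" "{x. Q x} = \<Union>\<I>"
    using definable_pieces[OF assms(1)] by blast
  have "\<Union>\<I> \<noteq> {} \<Longrightarrow> \<forall>y\<in>\<Union>\<I>. b \<le> y \<Longrightarrow> \<exists>a. is_inf (\<lambda>x. x \<in> \<Union>\<I>) a"
    using \<I>(1,2)
  proof (induction \<I>)
    case (insert I \<I>)
    have un: "x \<in> \<Union>(insert I \<I>) \<longleftrightarrow> x \<in> I \<or> x \<in> \<Union>\<I>" for x by simp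
    have one: "\<exists>a. is_inf (\<lambda>x. x \<in> I) a" if ne: "I \<noteq> {}"
    proof -
      have lb: "\<forall>y\<in>I. b \<le> y" using insert.prems by blast
      have "point_or_open_interval I" using insert.prems by simp
      then show ?thesis unfolding point_or_open_interval_def
      proof (elim disjE exE)
        fix c d assume "I = {c<..<d}"
        with ne have "is_inf (\<lambda>x. x \<in> I) c"
          by (auto simp: is_inf_def not_le intro: dense_ge_bounded)
        then show ?thesis by blast
      next
        fix c assume "I = {c<..}"
        then have "is_inf (\<lambda>x. x \<in> I) c"
          by (auto simp: is_inf_def intro: dense_ge)
        then show ?thesis by blast
      next
        fix c assume I: "I = {..<c}"
        then have "min (c - 1) (b - 1) \<in> I" by (simp add: min_less_iff_disj)
        then have False using lb by fastforce
        then show ?thesis ..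
      next
        assume "I = UNIV"
        then have "b - 1 \<in> I" by simp
        then have False using lb by fastforce
        then show ?thesis ..
      qed (auto simp: is_inf_def)
    qed
    show ?case
    proof (cases "I = {} \<or> \<Union>\<I> = {}")
      case True
      then show ?thesis
      proof
        assume "I = {}"
        then show ?thesis using insert.IH insert.prems by (simp add: un del: Union_iff)
      next
        assume "\<Union>\<I> = {}"
        then have "I \<noteq> {}" using insert.prems(1) by auto
        then show ?thesis using one unfolding un \<open>\<Union>\<I> = {}\<close> by simp
      qed
    next
      case False
      then obtain c d where c: "is_inf (\<lambda>x. x \<in> I) c" and d: "is_inf (\<lambda>x. x \<in> \<Union>\<I>) d"
        using one insert by auto
      have "is_inf (\<lambda>x. x \<in> \<Union>(insert I \<I>)) (min c d)"
        using c d unfolding is_inf_def by (auto simp: min_le_iff_disj)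
      then show ?thesis by blast
    qed
  qed simp
  then have "\<exists>a. is_inf (\<lambda>x. x \<in> {x. Q x}) a" unfolding \<I>(3)[symmetric] using assms by blast
  then show ?thesis by simp
qed

lemma sup_exists:
  assumes "dfn1 M Q" "Q x" "\<And>y. Q y \<Longrightarrow> y \<le> b"
  shows "\<exists>a. is_sup Q a"
proof -
  have "dfn M (\<lambda>v. Q (- v 0))" by (rule dfn_app1[OF assms(1)]) (intro dft_intros)
  then obtain a where "is_inf (\<lambda>x. Q (- x)) a"
    using inf_exists[of "\<lambda>x. Q (- x)" "- x" "- b"] assms by (metis add.inverse_inverse neg_le_iff_le)
  then have "is_sup Q (- a)" unfolding is_inf_def is_sup_def
    by (metis add.inverse_inverse neg_le_iff_le)
  then show ?thesis by blast
qed

text \<open>Definable connectedness of a closed interval: the supremum of the initial segments on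
  which \<open>Q\<close> holds can always be passed by local constancy. It replaces completeness of
  the field wherever local information is made global.\<close>

lemma locally_constant_imp_constant:
  assumes "dfn1 M Q" "x \<le> y" "Q x"
    and loc: "\<And>s. x \<le> s \<Longrightarrow> s \<le> y \<Longrightarrow> \<exists>e>0. \<forall>u. x \<le> u \<and> u \<le> y \<and> \<bar>u - s\<bar> < e \<longrightarrow> Q u = Q s"
  shows "Q y"
proof -
  define T where "T t \<longleftrightarrow> x \<le> t \<and> t \<le> y \<and> (\<forall>u. x \<le> u \<and> u \<le> t \<longrightarrow> Q u)" for t
  have "dfn1 M T" unfolding T_def
    by (intro dfn_intros dft_intros dfn_app1[OF assms(1)])
  moreover have Tx: "T x" using assms by (auto simp: T_def)
  ultimately obtain s where s: "is_sup T s" using sup_exists[of T x y] by (auto simp: T_def)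
  have xs: "x \<le> s" "s \<le> y" using s Tx by (auto simp: is_sup_def T_def)
  obtain e where e: "e > 0" "\<And>u. x \<le> u \<Longrightarrow> u \<le> y \<Longrightarrow> \<bar>u - s\<bar> < e \<Longrightarrow> Q u = Q s"
    using loc[OF xs] by blast
  obtain t where t: "T t" "t \<le> s" "s - e < t" using is_sup_approx[OF s, of "s - e"] e(1) by auto
  have Qt: "Q t" "x \<le> t" "t \<le> y" using t(1) by (auto simp: T_def)
  then have Qs: "Q s" using e(2)[of t] t by auto
  \<comment> \<open>Half the radius beyond \<open>s\<close>, unless the end point comes first: z
    \<le> s is then possible only if \<open>s\<close> is the end point.\<close>
  define z where "z = min y (s + e / 2)"
  have "T z" unfolding T_def
  proof (intro conjI allI impI)
    fix u assume u: "x \<le> u \<and> u \<le> z"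
    show "Q u"
    proof (cases "u \<le> t")
      case True then show ?thesis using t(1) u by (auto simp: T_def)
    next
      case False
      then have "\<bar>u - s\<bar> < e" "u \<le> y" using t u e(1) by (auto simp: z_def abs_less_iff field_simps)
      then show ?thesis using e(2) u Qs by blast
    qed
  qed (use xs e(1) in \<open>auto simp: z_def\<close>)
  then have "z \<le> s" using s by (simp add: is_sup_def)
  then have "y \<le> s" using e(1) by (auto simp: z_def min_le_iff_disj)
  then show ?thesis using Qs xs by simp
qed

text \<open>
  If \<open>R x e\<close> held for only finitely many \<open>x\<close> for each fixed \<open>e\<close>, then the points \<open>y\<close> that satisfy
  \<open>R y e\<close> for some \<open>e\<close> for which no smaller \<open>x\<close> does would be coinitial in \<open>(a, b)\<close> and hence
  contain an interval, on which the admissible \<open>e\<close> grow with \<open>y\<close>.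
\<close>

lemma uniform_on_subinterval:
  assumes R: "dfn2 M R" and ab: "a < b"
    and ex: "\<And>x. a < x \<Longrightarrow> x < b \<Longrightarrow> \<exists>e>0. R x e"
    and down: "\<And>x e e'. a < x \<Longrightarrow> x < b \<Longrightarrow> R x e \<Longrightarrow> 0 < e' \<Longrightarrow> e' \<le> e \<Longrightarrow> R x e'"
  obtains c d e where "a \<le> c" "c < d" "d \<le> b" "e > 0" "\<And>x. c < x \<Longrightarrow> x < d \<Longrightarrow> R x e"
proof -
  have Re: "dfn M (\<lambda>v. R (v 0) e)" for e by (intro dfn_app2[OF R] dft_intros)
  have "\<exists>e>0. infinite {x. a < x \<and> x < b \<and> R x e}"
  proof (rule ccontr)
    assume "\<not> (\<exists>e>0. infinite {x. a < x \<and> x < b \<and> R x e})"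
    then have fin: "finite {x. a < x \<and> x < b \<and> R x e}" if "e > 0" for e using that by blast
    define P where "P y \<longleftrightarrow> (\<exists>e. e > 0 \<and> R y e \<and> (\<forall>x. a < x \<and> x < y \<longrightarrow> \<not> R x e))" for y
    have P: "dfn1 M P" unfolding P_def
      by (intro dfn_intros dft_intros dfn_app2[OF R])
    have rec: "\<exists>y. a < y \<and> y \<le> x \<and> P y" if x: "a < x" "x < b" for x
    proof -
      obtain e where e: "e > 0" "R x e" using ex[OF x] by blast
      \<comment> \<open>Finiteness for this fixed \<open>e\<close> provides a first point at which
        \<open>e\<close> is admissible, and that point satisfies \<open>P\<close>.\<close>
      let ?E = "{x. a < x \<and> x < b \<and> R x e}"
      have "x \<in> ?E" using x e by simp
      then have "Min ?E \<in> ?E" "Min ?E \<le> x"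
        using fin[OF e(1)] Min_in[of ?E] by (blast, simp)
      moreover have "\<not> R z e" if "a < z" "z < Min ?E" for z
        using that calculation x Min_le[OF fin[OF e(1)], of z] by force
      ultimately show ?thesis using e(1) unfolding P_def by blast
    qed
    obtain x0 where "a < x0" "x0 < b" using dense[OF ab] by blast
    then have "infinite {x. a < x \<and> x < b \<and> P x}"
    proof (intro infinite_no_least)
      fix x assume "x \<in> {x. a < x \<and> x < b \<and> P x}"
      then have x: "a < x" "x < b" by auto
      obtain z where "a < z" "z < x" using dense[OF x(1)] by blast
      then show "\<exists>y\<in>{x. a < x \<and> x < b \<and> P x}. y < x" using rec[of z] x by force
    qed (use rec[of x0] in force)
    from infinite_has_subinterval[OF P this] obtain c d
      where cd: "a \<le> c" "c < d" "d \<le> b" "\<And>x. c < x \<Longrightarrow> x < d \<Longrightarrow> P x" by auto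
    obtain m where m: "c < m" "m < d" using dense[OF cd(2)] by blast
    obtain e where e: "e > 0" "R m e" using ex[of m] m cd by auto
    have "R y e" if y: "m < y" "y < d" for y
    proof -
      obtain f where f: "f > 0" "R y f" "\<not> R m f" using cd(4)[of y] y m cd(1) unfolding P_def by auto
      \<comment> \<open>Otherwise \<open>f\<close> would be admissible at \<open>m\<close> as well,
        because smaller values remain admissible.\<close>
      have "e \<le> f" using down[of m e f] f e m cd by force
      then show ?thesis using down[of y f e] f e y m cd by auto
    qed
    then have "{x. m < x \<and> x < d} \<subseteq> {x. a < x \<and> x < b \<and> R x e}" using m cd by auto
    then show False using infinite_interval[OF m(2)] fin[OF e(1)] finite_subset by blast
  qed
  then obtain e where "e > 0" "infinite {x. a < x \<and> x < b \<and> R x e}" by blast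
  with infinite_has_subinterval[OF Re this(2)] that show thesis by (metis greaterThanLessThan_iff)
qed

text \<open>A Ramsey property of definable relations on pairs. As \<open>y\<close> approaches
  \<open>x\<close> from the right, the truth of \<open>Q x y\<close> becomes fixed; on a subinterval
  the fixed value is the same for all \<open>x\<close>, and the range in which it is valid can be
  made uniform.\<close>

lemma pairs_homogeneous:
  assumes Q: "dfn2 M Q" and ab: "a < b"
  shows "\<exists>c d. a \<le> c \<and> c < d \<and> d \<le> b \<and>
    ((\<forall>x\<in>{c<..<d}. \<forall>y\<in>{c<..<d}. x < y \<longrightarrow> Q x y) \<or> (\<forall>x\<in>{c<..<d}. \<forall>y\<in>{c<..<d}. x < y \<longrightarrow> \<not> Q x y))"
proof -
  have core: "\<exists>c d. a \<le> c \<and> c < d \<and> d \<le> b \<and> (\<forall>x\<in>{c<..<d}. \<forall>y\<in>{c<..<d}. x < y \<longrightarrow> P x y)"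
    if P: "dfn2 M P" and ab: "a < b"
      and germ: "\<And>x. a < x \<Longrightarrow> x < b \<Longrightarrow> \<exists>e>0. \<forall>y. x < y \<and> y < x + e \<longrightarrow> P x y" for P a b
  proof -
    have "dfn M (\<lambda>v. \<forall>y. v 0 < y \<and> y < v 0 + v (Suc 0) \<longrightarrow> P (v 0) y)"
      by (intro dfn_intros dft_intros dfn_app2[OF P])
    then obtain c d e where cd: "a \<le> c" "c < d" "d \<le> b" "e > 0"
      and h: "\<And>x. c < x \<Longrightarrow> x < d \<Longrightarrow> \<forall>y. x < y \<and> y < x + e \<longrightarrow> P x y"
      by (rule uniform_on_subinterval[where R = "\<lambda>x e. \<forall>y. x < y \<and> y < x + e \<longrightarrow> P x y", OF _ ab germ]) auto
    \<comment> \<open>On an interval no longer than \<open>e\<close> every pair with x < y falls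
      into the uniform range.\<close>
    show ?thesis
      using cd by (intro exI[of _ c] exI[of _ "min d (c + e)"]) (use h in auto)
  qed
  define T where "T x \<longleftrightarrow> (\<exists>e. e > 0 \<and> (\<forall>y. x < y \<and> y < x + e \<longrightarrow> Q x y))" for x
  have T: "dfn1 M T" unfolding T_def
    by (intro dfn_intros dft_intros dfn_app2[OF Q])
  obtain c d where cd: "a \<le> c" "c < d" "d \<le> b"
    and "(\<forall>x\<in>{c<..<d}. T x) \<or> (\<forall>x\<in>{c<..<d}. \<not> T x)"
    using interval_split[OF T ab] by blast
  then show ?thesis
  proof (elim disjE)
    assume "\<forall>x\<in>{c<..<d}. T x"
    then have "\<exists>c' d'. c \<le> c' \<and> c' < d' \<and> d' \<le> d \<and> (\<forall>x\<in>{c'<..<d'}. \<forall>y\<in>{c'<..<d'}. x < y \<longrightarrow> Q x y)"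
      by (intro core Q cd) (auto simp: T_def)
    then show ?thesis using cd by (meson order_trans)
  next
    assume nT: "\<forall>x\<in>{c<..<d}. \<not> T x"
    have "\<exists>c' d'. c \<le> c' \<and> c' < d' \<and> d' \<le> d \<and> (\<forall>x\<in>{c'<..<d'}. \<forall>y\<in>{c'<..<d'}. x < y \<longrightarrow> \<not> Q x y)"
    proof (intro core dfn_not[OF Q] cd)
      fix x assume "c < x" "x < d"
      then have "\<not> T x" using nT by simp
      moreover have "dfn M (\<lambda>v. Q x (v 0))" by (intro dfn_app2[OF Q] dft_intros)
      ultimately show "\<exists>e>0. \<forall>y. x < y \<and> y < x + e \<longrightarrow> \<not> Q x y"
        using germ_right[of "Q x" x] unfolding T_def by blast
    qed
    then show ?thesis using cd by (meson order_trans)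
  qed
qed

end

section \<open>Definable choice\<close>

definition inf0 :: "('a::linordered_field \<Rightarrow> bool) \<Rightarrow> 'a" where
  "inf0 Q = (if \<exists>a. is_inf Q a then THE a. is_inf Q a else 0)"

text \<open>Meant for sets of nonnegative elements: the infimum if it is attained, otherwise the
  midpoint of an initial open interval of the set. That interval ends where the set is first left;
  the cap \<open>inf0 Q + 1\<close> guarantees that there is an end.\<close>

definition ch_nonneg :: "('a::linordered_field \<Rightarrow> bool) \<Rightarrow> 'a" where
  "ch_nonneg Q = (if Q (inf0 Q) then inf0 Q
     else (inf0 Q + inf0 (\<lambda>y. inf0 Q < y \<and> (\<not> Q y \<or> inf0 Q + 1 \<le> y))) / 2)"

text \<open>Passing to absolute values provides the lower bound. The choice depends on the set
  alone, so equal sets receive the same element; the canonical parameters and canonical codes below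
  rest on this.\<close>

definition ch :: "('a::linordered_field \<Rightarrow> bool) \<Rightarrow> 'a" where
  "ch Q = (if Q (ch_nonneg (\<lambda>r. 0 \<le> r \<and> (Q r \<or> Q (- r))))
     then ch_nonneg (\<lambda>r. 0 \<le> r \<and> (Q r \<or> Q (- r)))
     else - ch_nonneg (\<lambda>r. 0 \<le> r \<and> (Q r \<or> Q (- r))))"

primrec chl :: "nat \<Rightarrow> ('a::linordered_field list \<Rightarrow> bool) \<Rightarrow> 'a list" where
  "chl 0 Q = []"
| "chl (Suc n) Q = chl n (\<lambda>xs. Q (xs @ [ch (\<lambda>x. \<exists>xs. length xs = n \<and> Q (xs @ [x]))])) @
     [ch (\<lambda>x. \<exists>xs. length xs = n \<and> Q (xs @ [x]))]"

lemma inf0_eq: "is_inf Q a \<Longrightarrow> inf0 Q = a"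
  unfolding inf0_def using is_inf_unique[of Q] by (auto intro!: the_equality)

lemma dft_inf0:
  assumes "dfn M (\<lambda>v. Q (\<lambda>i. v (Suc i)) (v 0))"
  shows "dft M (\<lambda>v. inf0 (Q v))"
proof (rule dft_graph)
  show "dfn M (\<lambda>v. (\<lambda>v y. is_inf (Q v) y \<or> \<not> (\<exists>a. is_inf (Q v) a) \<and> y = 0) (\<lambda>i. v (Suc i)) (v 0))"
    unfolding is_inf_def by (intro dfn_intros dft_intros dfn_app_env[OF assms])
  show "(is_inf (Q v) y \<or> \<not> (\<exists>a. is_inf (Q v) a) \<and> y = 0) = (y = inf0 (Q v))" for v y
    using inf0_eq[of "Q v"] by (metis inf0_def)
qed

lemma dft_ch_nonneg:
  assumes "dfn M (\<lambda>v. Q (\<lambda>i. v (Suc i)) (v 0))"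
  shows "dft M (\<lambda>v. ch_nonneg (Q v))"
  unfolding ch_nonneg_def
  by (intro dft_intros dft_inf0 dfn_app_env[OF assms] dfn_intros)

lemma dft_ch:
  assumes "dfn M (\<lambda>v. Q (\<lambda>i. v (Suc i)) (v 0))"
  shows "dft M (\<lambda>v. ch (Q v))"
  unfolding ch_def
  by (intro dft_intros dft_ch_nonneg dfn_app_env[OF assms] dfn_intros)

lemma dfl_chl:
  assumes "dfn M (\<lambda>v. Q (\<lambda>i. v (i + n)) (map v [0..<n]))"
  shows "dfl M n (\<lambda>v. chl n (Q v))"
  using assms
proof (induction n arbitrary: Q)
  case 0
  then show ?case by (simp add: dfl_def)
next
  case (Suc n)
  have x: "dft M (\<lambda>v. ch (\<lambda>x. \<exists>xs. length xs = n \<and> Q v (xs @ [x])))"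
    by (rule dft_ch, rule dfn_exl) (use Suc.prems in simp)
  have "dfn M (\<lambda>v. Q (\<lambda>i. v (i + n)) (map v [0..<n] @
      [ch (\<lambda>x. \<exists>xs. length xs = n \<and> Q (\<lambda>i. v (i + n)) (xs @ [x]))]))"
    by (rule dfn_app_list[OF Suc.prems]) (intro dft_var dfl_snoc dfl_map_env dft_ren[OF x])+
  from Suc.IH[of "\<lambda>v xs. Q v (xs @ [ch (\<lambda>x. \<exists>xs. length xs = n \<and> Q v (xs @ [x]))])", OF this] x
  show ?case unfolding chl.simps by (rule dfl_snoc)
qed

lemma length_chl [simp]: "length (chl n Q) = n"
  by (induction n arbitrary: Q) simp_all

definition contat :: "('a::linordered_field \<Rightarrow> 'a) \<Rightarrow> 'a \<Rightarrow> bool" where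
  "contat f x \<longleftrightarrow> (\<forall>e>0. \<exists>\<delta>>0. \<forall>y. \<bar>y - x\<bar> < \<delta> \<longrightarrow> \<bar>f y - f x\<bar> < e)"

definition contat2 :: "('a::linordered_field \<Rightarrow> 'a \<Rightarrow> 'a) \<Rightarrow> 'a \<Rightarrow> 'a \<Rightarrow> bool" where
  "contat2 f x y \<longleftrightarrow> (\<forall>e>0. \<exists>\<delta>>0. \<forall>x' y'. \<bar>x' - x\<bar> < \<delta> \<and> \<bar>y' - y\<bar> < \<delta> \<longrightarrow> \<bar>f x' y' - f x y\<bar> < e)"

lemma contat_uminus: "contat (\<lambda>x. - f x) x \<longleftrightarrow> contat f x"
  unfolding contat_def by (simp add: abs_minus_commute)

context omin_structure
begin

lemma ch_nonneg_in:
  assumes Q: "dfn1 M Q" and x: "Q x" and nonneg: "\<And>y. Q y \<Longrightarrow> 0 \<le> y"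
  shows "Q (ch_nonneg Q)"
proof -
  obtain a where a: "is_inf Q a" using inf_exists[OF Q x nonneg] by blast
  have a0: "inf0 Q = a" by (rule inf0_eq[OF a])
  show ?thesis
  proof (cases "Q a")
    case False
    let ?B = "\<lambda>y. a < y \<and> (\<not> Q y \<or> a + 1 \<le> y)"
    have "dfn M (\<lambda>v. ?B (v 0))" by (intro dfn_intros dft_intros dfn_app1[OF Q])
    then obtain b where b: "is_inf ?B b" using inf_exists[of ?B "a + 1" a] by auto
    obtain e where e: "e > 0" "(\<forall>x. a < x \<and> x < a + e \<longrightarrow> Q x) \<or> (\<forall>x. a < x \<and> x < a + e \<longrightarrow> \<not> Q x)"
      using germ_right[OF Q, of a] by blast
    obtain y where y: "Q y" "a \<le> y" "y < a + e" using is_inf_approx[OF a, of "a + e"] e(1) by auto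
    with False have "a < y" by (cases "a = y") auto
    with y e have right: "\<And>x. a < x \<Longrightarrow> x < a + e \<Longrightarrow> Q x" by blast
    \<comment> \<open>\<open>Q\<close> holds just to the right of \<open>a\<close>, so nothing in
      \<open>?B\<close> comes earlier than \<open>a + min e 1\<close>. This separates
      \<open>b\<close> from \<open>a\<close> and places the midpoint in \<open>Q\<close>.\<close>
    have "a + min e 1 \<le> x" if "?B x" for x
      using that right[of x] by (cases "x < a + e") auto
    then have "a + min e 1 \<le> b" using b by (simp add: is_inf_def)
    then have "a < b" using e(1) by (simp add: min_def split: if_splits)
    then have m: "a < (a + b) / 2" "(a + b) / 2 < b" by (simp_all add: field_simps)
    have "\<not> ?B ((a + b) / 2)"
      using b m(2) unfolding is_inf_def by (meson not_le)
    then have "Q ((a + b) / 2)" using m by blast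
    then show ?thesis using False unfolding ch_nonneg_def a0 inf0_eq[OF b] by simp
  qed (simp add: ch_nonneg_def a0)
qed

lemma ch_in:
  assumes Q: "dfn1 M Q" and x: "Q x"
  shows "Q (ch Q)"
proof -
  let ?A = "\<lambda>r. 0 \<le> r \<and> (Q r \<or> Q (- r))"
  have "dfn M (\<lambda>v. ?A (v 0))" by (intro dfn_intros dft_intros dfn_app1[OF Q])
  then have "?A (ch_nonneg ?A)" by (rule ch_nonneg_in[of _ "\<bar>x\<bar>"]) (use x in \<open>auto simp: abs_if\<close>)
  then show ?thesis unfolding ch_def by presburger
qed

lemma chl_in:
  assumes "dfn M (\<lambda>v. Q (map v [0..<n]))" "length xs = n" "Q xs"
  shows "Q (chl n Q)"
  using assms
proof (induction n arbitrary: Q xs)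
  case (Suc n)
  define x where "x = ch (\<lambda>x. \<exists>xs. length xs = n \<and> Q (xs @ [x]))"
  obtain ys y where xs: "xs = ys @ [y]" "length ys = n" using Suc.prems(2) by (auto simp: length_Suc_conv_rev)
  have "dfn M (\<lambda>v. \<exists>xs. length xs = n \<and> Q (xs @ [v 0]))"
    by (rule dfn_exl) (use Suc.prems(1) in simp)
  then have "\<exists>xs. length xs = n \<and> Q (xs @ [x])"
    unfolding x_def by (rule ch_in[of _ y]) (use xs Suc.prems in auto)
  then obtain zs where zs: "length zs = n" "Q (zs @ [x])" by blast
  have "dfn M (\<lambda>v. Q (map v [0..<n] @ [x]))"
    by (rule dfn_app_list[where Q = "\<lambda>_. Q" and s = "\<lambda>v. v", OF Suc.prems(1)])
      (intro dft_var dft_const dfl_snoc dfl_map_env)+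
  from Suc.IH[of "\<lambda>xs. Q (xs @ [x])", OF this zs] show ?case by (simp add: x_def)
qed simp

section \<open>Generic monotonicity, continuity and finiteness\<close>

text \<open>Two applications of \<open>pairs_homogeneous\<close>, to \<open>f x < f y\<close> and to
  \<open>f x = f y\<close>, leave one and the same comparison for all pairs.\<close>

lemma generic_monotone:
  assumes f: "dft1 M f" and ab: "a < b"
  shows "\<exists>c d. a \<le> c \<and> c < d \<and> d \<le> b \<and>
    ((\<forall>x\<in>{c<..<d}. \<forall>y\<in>{c<..<d}. x < y \<longrightarrow> f x < f y) \<or>
     (\<forall>x\<in>{c<..<d}. \<forall>y\<in>{c<..<d}. x < y \<longrightarrow> f x = f y) \<or>
     (\<forall>x\<in>{c<..<d}. \<forall>y\<in>{c<..<d}. x < y \<longrightarrow> f y < f x))"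
proof -
  have less: "dfn M (\<lambda>v. f (v 0) < f (v (Suc 0)))" and eq: "dfn M (\<lambda>v. f (v 0) = f (v (Suc 0)))"
    by (intro dfn_intros dft_app1[OF f] dft_intros)+
  obtain c d where cd: "a \<le> c" "c < d" "d \<le> b" and 1:
    "(\<forall>x\<in>{c<..<d}. \<forall>y\<in>{c<..<d}. x < y \<longrightarrow> f x < f y) \<or> (\<forall>x\<in>{c<..<d}. \<forall>y\<in>{c<..<d}. x < y \<longrightarrow> \<not> f x < f y)"
    using pairs_homogeneous[OF less ab] by blast
  obtain c' d' where cd': "c \<le> c'" "c' < d'" "d' \<le> d" and 2:
    "(\<forall>x\<in>{c'<..<d'}. \<forall>y\<in>{c'<..<d'}. x < y \<longrightarrow> f x = f y) \<or> (\<forall>x\<in>{c'<..<d'}. \<forall>y\<in>{c'<..<d'}. x < y \<longrightarrow> f x \<noteq> f y)"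
    using pairs_homogeneous[OF eq cd(2)] by blast
  have sub: "x \<in> {c<..<d}" if "x \<in> {c'<..<d'}" for x using that cd' by auto
  have "(\<forall>x\<in>{c'<..<d'}. \<forall>y\<in>{c'<..<d'}. x < y \<longrightarrow> f x < f y) \<or>
     (\<forall>x\<in>{c'<..<d'}. \<forall>y\<in>{c'<..<d'}. x < y \<longrightarrow> f x = f y) \<or>
     (\<forall>x\<in>{c'<..<d'}. \<forall>y\<in>{c'<..<d'}. x < y \<longrightarrow> f y < f x)"
    using 1 2 sub by (meson linorder_neqE)
  then show ?thesis using cd cd' by (meson order_trans)
qed

text \<open>An injective function has infinite image, which therefore contains an interval. Between
  preimages of two points of that interval an increasing function cannot jump.\<close>

lemma generic_continuous_inc:
  assumes f: "dft1 M f" and cd: "c < d"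
    and inc: "\<And>x y. c < x \<Longrightarrow> x < y \<Longrightarrow> y < d \<Longrightarrow> f x < f y"
  shows "\<exists>c' d'. c \<le> c' \<and> c' < d' \<and> d' \<le> d \<and> (\<forall>x\<in>{c'<..<d'}. contat f x)"
proof -
  define I where "I z \<longleftrightarrow> (\<exists>x. c < x \<and> x < d \<and> f x = z)" for z
  have I: "dfn1 M I" unfolding I_def
    by (intro dfn_intros dft_intros dft_app1[OF f])
  have "inj_on f {x. c < x \<and> x < d}"
    using inc by (intro linorder_inj_onI) (auto, metis less_irrefl)
  then have "infinite (f ` {x. c < x \<and> x < d})"
    using infinite_interval[OF cd] finite_imageD by blast
  moreover have "f ` {x. c < x \<and> x < d} = {z. I z}" by (auto simp: I_def)
  ultimately obtain p q where pq: "p < q" "\<And>z. p < z \<Longrightarrow> z < q \<Longrightarrow> I z"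
    using infinite_has_interval[OF I] by auto
  obtain z1 where z1: "p < z1" "z1 < q" using dense[OF pq(1)] by blast
  obtain z2 where z2: "z1 < z2" "z2 < q" using dense[OF z1(2)] by blast
  obtain x1 where x1: "c < x1" "x1 < d" "f x1 = z1" using pq(2)[of z1] z1 by (auto simp: I_def)
  obtain x2 where x2: "c < x2" "x2 < d" "f x2 = z2" using pq(2)[of z2] z1 z2 by (auto simp: I_def)
  have inc_iff: "f x < f y \<longleftrightarrow> x < y" if "c < x" "x < d" "c < y" "y < d" for x y
    using that inc[of x y] inc[of y x] by (metis less_asym less_irrefl linorder_neqE)
  have x12: "x1 < x2" using inc_iff[of x1 x2] x1 x2 z2 by simp
  have "contat f x" if x: "x1 < x" "x < x2" for x
    unfolding contat_def
  proof (intro allI impI)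
    fix e :: 'a assume e: "e > 0"
    have cx: "c < x" "x < d" using x x1 x2 by auto
    have fx: "z1 < f x" "f x < z2" using inc_iff[of x1 x] inc_iff[of x x2] x x1 x2 cx by auto
    have "max z1 (f x - e) < f x" using fx e by simp
    then obtain w where w: "max z1 (f x - e) < w" "w < f x" using dense by blast
    have "f x < min z2 (f x + e)" using fx e by simp
    then obtain w' where w': "f x < w'" "w' < min z2 (f x + e)" using dense by blast
    obtain y where y: "c < y" "y < d" "f y = w" using pq(2)[of w] w fx z1 z2 by (auto simp: I_def)
    obtain y' where y': "c < y'" "y' < d" "f y' = w'" using pq(2)[of w'] w' fx z1 z2 by (auto simp: I_def)
    have yx: "y < x" "x < y'" using inc_iff[of y x] inc_iff[of x y'] y y' w w' cx by auto
    show "\<exists>\<delta>>0. \<forall>u. \<bar>u - x\<bar> < \<delta> \<longrightarrow> \<bar>f u - f x\<bar> < e"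
    proof (intro exI[of _ "min (x - y) (y' - x)"] conjI allI impI)
      fix u assume "\<bar>u - x\<bar> < min (x - y) (y' - x)"
      then have "y < u" "u < y'" by (auto simp: abs_less_iff)
      then have "f y < f u" "f u < f y'" using inc_iff[of y u] inc_iff[of u y'] y y' by auto
      then show "\<bar>f u - f x\<bar> < e" using y y' w w' by (auto simp: abs_less_iff)
    qed (use yx in auto)
  qed
  then show ?thesis using x12 x1 x2 by (intro exI[of _ x1] exI[of _ x2]) auto
qed

lemma generic_continuous:
  assumes f: "dft1 M f" and ab: "a < b"
  shows "\<exists>c d. a \<le> c \<and> c < d \<and> d \<le> b \<and> (\<forall>x\<in>{c<..<d}. contat f x)"
proof -
  obtain c d where cd: "a \<le> c" "c < d" "d \<le> b" and
    "(\<forall>x\<in>{c<..<d}. \<forall>y\<in>{c<..<d}. x < y \<longrightarrow> f x < f y) \<or>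
     (\<forall>x\<in>{c<..<d}. \<forall>y\<in>{c<..<d}. x < y \<longrightarrow> f x = f y) \<or>
     (\<forall>x\<in>{c<..<d}. \<forall>y\<in>{c<..<d}. x < y \<longrightarrow> f y < f x)"
    using generic_monotone[OF f ab] by blast
  then have "\<exists>c' d'. c \<le> c' \<and> c' < d' \<and> d' \<le> d \<and> (\<forall>x\<in>{c'<..<d'}. contat f x)"
  proof (elim disjE)
    assume "\<forall>x\<in>{c<..<d}. \<forall>y\<in>{c<..<d}. x < y \<longrightarrow> f x < f y"
    then show ?thesis by (intro generic_continuous_inc f cd) auto
  next
    assume eq: "\<forall>x\<in>{c<..<d}. \<forall>y\<in>{c<..<d}. x < y \<longrightarrow> f x = f y"
    have "contat f x" if x: "c < x" "x < d" for x
      unfolding contat_def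
    proof (intro allI impI)
      fix e :: 'a assume e: "e > 0"
      show "\<exists>\<delta>>0. \<forall>y. \<bar>y - x\<bar> < \<delta> \<longrightarrow> \<bar>f y - f x\<bar> < e"
      proof (intro exI[of _ "min (x - c) (d - x)"] conjI allI impI)
        fix y assume "\<bar>y - x\<bar> < min (x - c) (d - x)"
        then have "c < y" "y < d" by (auto simp: abs_less_iff)
        then have "f y = f x" using eq x by (metis greaterThanLessThan_iff linorder_neqE)
        then show "\<bar>f y - f x\<bar> < e" using e by simp
      qed (use x in simp)
    qed
    then show ?thesis using cd by (intro exI[of _ c] exI[of _ d]) auto
  next
    assume dec: "\<forall>x\<in>{c<..<d}. \<forall>y\<in>{c<..<d}. x < y \<longrightarrow> f y < f x"
    have "dft M (\<lambda>v. - f (v 0))" by (intro dft_intros f)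
    from generic_continuous_inc[OF this cd(2)] dec
    show ?thesis by (auto simp: contat_uminus)
  qed
  then show ?thesis using cd by (meson order_trans)
qed

text \<open>Intervals that vary with \<open>x\<close> are replaced by a common one. A centre
  \<open>m x\<close> is chosen definably and the radius is made uniform; near a point of continuity
  of \<open>m\<close> all these intervals contain the one of half the radius about a fixed
  centre.\<close>

lemma uniform_box:
  assumes R: "dfn3 M R" and ab: "a < b"
    and ex: "\<And>x. a < x \<Longrightarrow> x < b \<Longrightarrow> \<exists>l r. l < r \<and> R x l r"
    and sub: "\<And>x l r l' r'. a < x \<Longrightarrow> x < b \<Longrightarrow> R x l r \<Longrightarrow> l \<le> l' \<Longrightarrow> l' < r' \<Longrightarrow> r' \<le> r \<Longrightarrow> R x l' r'"
  obtains c d l r where "a \<le> c" "c < d" "d \<le> b" "l < r" "\<And>x. c < x \<Longrightarrow> x < d \<Longrightarrow> R x l r"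
proof -
  define m where "m x = ch (\<lambda>m. \<exists>e. 0 < e \<and> R x (m - e) (m + e))" for x
  have m: "dft1 M m" unfolding m_def
    by (intro dft_ch dfn_intros dft_intros dfn_app3[OF R])
  have mR: "\<exists>e>0. R x (m x - e) (m x + e)" if x: "a < x" "x < b" for x
  proof -
    obtain l r where lr: "l < r" "R x l r" using ex[OF x] by blast
    have *: "(l + r) / 2 - (r - l) / 2 = l" "(l + r) / 2 + (r - l) / 2 = r"
      by (simp_all add: field_simps)
    have "dfn M (\<lambda>v. \<exists>e. 0 < e \<and> R x (v 0 - e) (v 0 + e))"
      by (intro dfn_intros dft_intros dfn_app3[OF R])
    then show ?thesis unfolding m_def
      by (rule ch_in[of _ "(l + r) / 2"]) (use lr * in \<open>auto intro!: exI[of _ "(r - l) / 2"]\<close>)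
  qed
  have "dfn M (\<lambda>v. R (v 0) (m (v 0) - v (Suc 0)) (m (v 0) + v (Suc 0)))"
    by (intro dfn_intros dft_intros dfn_app3[OF R] dft_app1[OF m])
  moreover note ab mR
  moreover have "R x (m x - e') (m x + e')"
    if "a < x" "x < b" "R x (m x - e) (m x + e)" "0 < e'" "e' \<le> e" for x e e'
    by (rule sub[OF that(1-3)]) (use that in auto)
  ultimately obtain c d e where cd: "a \<le> c" "c < d" "d \<le> b" "e > 0"
    and Re: "\<And>x. c < x \<Longrightarrow> x < d \<Longrightarrow> R x (m x - e) (m x + e)"
    by (rule uniform_on_subinterval[where R = "\<lambda>x e. R x (m x - e) (m x + e)"]) blast+
  obtain c' d' where cd': "c \<le> c'" "c' < d'" "d' \<le> d" "\<And>x. c' < x \<Longrightarrow> x < d' \<Longrightarrow> contat m x"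
    using generic_continuous[OF m cd(2)] by auto
  obtain x0 where x0: "c' < x0" "x0 < d'" using dense[OF cd'(2)] by blast
  have "e / 2 > 0" using cd(4) by simp
  then obtain \<delta> where \<delta>: "\<delta> > 0" "\<And>y. \<bar>y - x0\<bar> < \<delta> \<Longrightarrow> \<bar>m y - m x0\<bar> < e / 2"
    using cd'(4)[OF x0] unfolding contat_def by blast
  have "R x (m x0 - e / 2) (m x0 + e / 2)" if x: "max c' (x0 - \<delta>) < x" "x < min d' (x0 + \<delta>)" for x
  proof (rule sub[of x "m x - e" "m x + e"])
    have "\<bar>m x - m x0\<bar> < e / 2" using x by (intro \<delta>) (auto simp: abs_less_iff)
    then have "m x - m x0 < e / 2" "m x0 - m x < e / 2"
      by (simp_all only: abs_less_iff minus_diff_eq)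
    then show "m x - e \<le> m x0 - e / 2" "m x0 + e / 2 \<le> m x + e" by linarith+
    show "R x (m x - e) (m x + e)" using x cd' by (intro Re) auto
  qed (use x cd cd' in auto)
  moreover have "max c' (x0 - \<delta>) < min d' (x0 + \<delta>)" using x0 \<delta>(1) by auto
  moreover have "a \<le> max c' (x0 - \<delta>)" "min d' (x0 + \<delta>) \<le> b" using cd cd' by (auto simp: le_max_iff_disj min_le_iff_disj)
  moreover have "m x0 - e / 2 < m x0 + e / 2" using cd(4) by simp
  ultimately show thesis by (intro that)
qed

text \<open>Monotonicity of unspecified direction, which may vary with \<open>x\<close>, captured by
  a single definable condition.\<close>

definition between :: "'a \<Rightarrow> 'a \<Rightarrow> 'a \<Rightarrow> bool" where
  "between u v w \<longleftrightarrow> (u \<le> v \<and> v \<le> w) \<or> (w \<le> v \<and> v \<le> u)"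

lemma dfn_contat:
  assumes "dft2 M f"
  shows "dfn M (\<lambda>v. contat (f (v 0)) (v (Suc 0)))"
  unfolding contat_def by (intro dfn_intros dft_intros dft_app2[OF assms])

text \<open>Separate continuity alone would not give joint continuity; monotonicity in
  \<open>y\<close> does. The value \<open>f x' y'\<close> lies between \<open>f x' (y - h)\<close>
  and \<open>f x' (y + h)\<close>, and these two are controlled by continuity in \<open>x\<close>
  along two fixed lines.\<close>

lemma generic_continuous2:
  assumes f: "dft2 M f" and ab: "a < b" and cd: "c < d"
  shows "\<exists>a' b' c' d'. a \<le> a' \<and> a' < b' \<and> b' \<le> b \<and> c \<le> c' \<and> c' < d' \<and> d' \<le> d \<and>
    (\<forall>x\<in>{a'<..<b'}. \<forall>y\<in>{c'<..<d'}. contat2 f x y)"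
proof -
  define R where "R x l r \<longleftrightarrow> c \<le> l \<and> r \<le> d \<and> (\<forall>y. l < y \<and> y < r \<longrightarrow> contat (f x) y) \<and>
    (\<forall>y1 y2 y3. l < y1 \<and> y1 < y2 \<and> y2 < y3 \<and> y3 < r \<longrightarrow> between (f x y1) (f x y2) (f x y3))" for x l r
  have fx: "dft M (\<lambda>v. f x (v 0))" for x by (intro dft_app2[OF f] dft_intros)
  have fy: "dft M (\<lambda>v. f (v 0) y)" for y by (intro dft_app2[OF f] dft_intros)
  have "dfn3 M R"
    unfolding R_def between_def
    by (intro dfn_intros dft_intros dft_app2[OF f] dfn_app2[OF dfn_contat[OF f]])
  moreover have "\<exists>l r. l < r \<and> R x l r" for x
  proof -
    obtain c1 d1 where cd1: "c \<le> c1" "c1 < d1" "d1 \<le> d" and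
      mono: "(\<forall>y\<in>{c1<..<d1}. \<forall>z\<in>{c1<..<d1}. y < z \<longrightarrow> f x y < f x z) \<or>
        (\<forall>y\<in>{c1<..<d1}. \<forall>z\<in>{c1<..<d1}. y < z \<longrightarrow> f x y = f x z) \<or>
        (\<forall>y\<in>{c1<..<d1}. \<forall>z\<in>{c1<..<d1}. y < z \<longrightarrow> f x z < f x y)"
      using generic_monotone[OF fx cd] by blast
    obtain c2 d2 where cd2: "c1 \<le> c2" "c2 < d2" "d2 \<le> d1" "\<And>y. c2 < y \<Longrightarrow> y < d2 \<Longrightarrow> contat (f x) y"
      using generic_continuous[OF fx cd1(2)] by (metis greaterThanLessThan_iff)
    have "between (f x y1) (f x y2) (f x y3)" if y: "c2 < y1" "y1 < y2" "y2 < y3" "y3 < d2" for y1 y2 y3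
    proof -
      have "y1 \<in> {c1<..<d1}" "y2 \<in> {c1<..<d1}" "y3 \<in> {c1<..<d1}" using y cd2 by auto
      then show ?thesis using mono y unfolding between_def by (metis less_imp_le order_refl)
    qed
    then have "R x c2 d2" unfolding R_def using cd1 cd2 by auto
    then show ?thesis using cd2(2) by blast
  qed
  moreover have "R x l' r'" if "R x l r" "l \<le> l'" "r' \<le> r" for x l r l' r'
    using that unfolding R_def by (meson le_less_trans less_le_trans order_trans)
  ultimately obtain a1 b1 l r where ab1: "a \<le> a1" "a1 < b1" "b1 \<le> b" "l < r"
    and R: "\<And>x. a1 < x \<Longrightarrow> x < b1 \<Longrightarrow> R x l r"
    by (rule uniform_box[of R, OF _ ab]) blast+
  define R' where "R' y l' r' \<longleftrightarrow> a1 \<le> l' \<and> r' \<le> b1 \<and> (\<forall>x. l' < x \<and> x < r' \<longrightarrow> contat (\<lambda>x. f x y) x)" for y l' r'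
  have "dft M (\<lambda>v. f (v (Suc 0)) (v 0))" by (intro dft_app2[OF f] dft_intros)
  then have "dfn3 M R'"
    unfolding R'_def
    by (intro dfn_intros dft_intros dfn_app2[where R = "\<lambda>y. contat (\<lambda>x. f x y)", OF dfn_contat])
  moreover have "\<exists>l r. l < r \<and> R' y l r" for y
    using generic_continuous[OF fy[of y] ab1(2)] unfolding R'_def by (metis greaterThanLessThan_iff)
  moreover have "R' y l' r'" if "R' y l r" "l \<le> l'" "r' \<le> r" for y l r l' r'
    using that unfolding R'_def by (meson le_less_trans less_le_trans order_trans)
  ultimately obtain c2 d2 a2 b2 where cd2: "l \<le> c2" "c2 < d2" "d2 \<le> r" "a2 < b2"
    and R': "\<And>y. c2 < y \<Longrightarrow> y < d2 \<Longrightarrow> R' y a2 b2"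
    by (rule uniform_box[of R', OF _ ab1(4)]) blast+
  obtain y0 where y0: "c2 < y0" "y0 < d2" using dense[OF cd2(2)] by blast
  have ab2: "a1 \<le> a2" "b2 \<le> b1" using R'[OF y0] by (auto simp: R'_def)
  obtain x0 where x0: "a2 < x0" "x0 < b2" using dense[OF cd2(4)] by blast
  have lr: "c \<le> l" "r \<le> d" using R[of x0] x0 ab2 by (auto simp: R_def)
  have "contat2 f x y" if x: "a2 < x" "x < b2" and y: "c2 < y" "y < d2" for x y
    unfolding contat2_def
  proof (intro allI impI)
    fix e :: 'a assume "e > 0"
    then have e: "e / 2 > 0" by simp
    have "contat (f x) y" using R[of x] x y ab2 cd2 by (auto simp: R_def)
    then obtain \<eta> where \<eta>: "\<eta> > 0" "\<And>z. \<bar>z - y\<bar> < \<eta> \<Longrightarrow> \<bar>f x z - f x y\<bar> < e / 2"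
      using e unfolding contat_def by blast
    have "0 < min \<eta> (min (y - c2) (d2 - y))" using \<eta>(1) y by simp
    then obtain h where "0 < h" "h < min \<eta> (min (y - c2) (d2 - y))" using dense by blast
    then have h: "h > 0" "h < \<eta>" "h < y - c2" "h < d2 - y" by simp_all
    have "contat (\<lambda>x. f x (y - h)) x" "contat (\<lambda>x. f x (y + h)) x"
      using R'[of "y - h"] R'[of "y + h"] h x y by (auto simp: R'_def)
    from this[unfolded contat_def, rule_format, OF e] obtain \<delta>1 \<delta>2 where \<delta>: "\<delta>1 > 0" "\<delta>2 > 0"
      "\<And>z. \<bar>z - x\<bar> < \<delta>1 \<Longrightarrow> \<bar>f z (y - h) - f x (y - h)\<bar> < e / 2"
      "\<And>z. \<bar>z - x\<bar> < \<delta>2 \<Longrightarrow> \<bar>f z (y + h) - f x (y + h)\<bar> < e / 2"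
      by blast
    have fh: "\<bar>f x (y - h) - f x y\<bar> < e / 2" "\<bar>f x (y + h) - f x y\<bar> < e / 2"
      using h by (intro \<eta>(2); simp)+
    define \<delta> where "\<delta> = min (min \<delta>1 \<delta>2) (min h (min (x - a2) (b2 - x)))"
    have "\<bar>f x' y' - f x y\<bar> < e" if "\<bar>x' - x\<bar> < \<delta> \<and> \<bar>y' - y\<bar> < \<delta>" for x' y'
    proof -
      have x': "\<bar>x' - x\<bar> < \<delta>1" "\<bar>x' - x\<bar> < \<delta>2" "a1 < x'" "x' < b1"
        using that ab2 by (auto simp: \<delta>_def abs_less_iff)
      have y': "y - h < y'" "y' < y + h" using that by (auto simp: \<delta>_def abs_less_iff)
      have "R x' l r" using R x' by blast
      then have bt: "between (f x' (y - h)) (f x' y') (f x' (y + h))"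
        using y' h cd2 unfolding R_def by (auto simp: algebra_simps)
      have "\<bar>f x' (y - h) - f x y\<bar> < e" "\<bar>f x' (y + h) - f x y\<bar> < e"
        using \<delta>(3)[OF x'(1)] \<delta>(4)[OF x'(2)] fh unfolding abs_less_iff by linarith+
      then show ?thesis using bt unfolding between_def abs_less_iff by linarith
    qed
    moreover have "\<delta> > 0" using \<delta>(1,2) h(1) x by (simp add: \<delta>_def)
    ultimately show "\<exists>\<delta>>0. \<forall>x' y'. \<bar>x' - x\<bar> < \<delta> \<and> \<bar>y' - y\<bar> < \<delta> \<longrightarrow> \<bar>f x' y' - f x y\<bar> < e" by blast
  qed
  then show ?thesis using ab1 ab2 cd2 lr
    by (intro exI[of _ a2] exI[of _ b2] exI[of _ c2] exI[of _ d2]) auto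
qed

text \<open>If all fibres were finite, each \<open>f x\<close> would be finite-to-one, so its values
  would contain an interval. Over some interval of \<open>x\<close> these intervals have a common
  part, and a value in that part is attained over every such \<open>x\<close>.\<close>

lemma infinite_fibre:
  assumes f: "dft2 M f" and ab: "a < b" and cd: "c < d"
  shows "\<exists>z. infinite {(x, y). a < x \<and> x < b \<and> c < y \<and> y < d \<and> f x y = z}"
proof (rule ccontr)
  assume "\<not> ?thesis"
  then have fin: "finite {(x, y). a < x \<and> x < b \<and> c < y \<and> y < d \<and> f x y = z}" for z by blast
  define R where "R x l r \<longleftrightarrow> (\<forall>z. l < z \<and> z < r \<longrightarrow> (\<exists>y. c < y \<and> y < d \<and> f x y = z))" for x l r
  have fx: "dft M (\<lambda>v. f x (v 0))" for x by (intro dft_app2[OF f] dft_intros)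
  have ex: "\<exists>l r. l < r \<and> R x l r" if x: "a < x" "x < b" for x
  proof -
    have Z: "dfn M (\<lambda>v. \<exists>y. c < y \<and> y < d \<and> f x y = v 0)"
      by (intro dfn_intros dft_intros dft_app2[OF f])
    have "infinite {z. \<exists>y. c < y \<and> y < d \<and> f x y = z}"
    proof
      assume "finite {z. \<exists>y. c < y \<and> y < d \<and> f x y = z}"
      then have "finite (f x ` {y. c < y \<and> y < d})" by (rule rev_finite_subset) auto
      from pigeonhole_infinite[OF infinite_interval[OF cd] this]
      obtain y0 where "infinite {y \<in> {y. c < y \<and> y < d}. f x y = f x y0}" by blast
      then have "infinite (Pair x ` {y \<in> {y. c < y \<and> y < d}. f x y = f x y0})"
        using finite_imageD[of "Pair x"] by (meson inj_onI prod.inject)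
      moreover have "finite (Pair x ` {y \<in> {y. c < y \<and> y < d}. f x y = f x y0})"
        using fin[of "f x y0"] by (rule rev_finite_subset) (use x in auto)
      ultimately show False by blast
    qed
    from infinite_has_interval[OF Z this] show ?thesis unfolding R_def by (metis greaterThanLessThan_iff)
  qed
  have "dfn3 M R"
    unfolding R_def by (intro dfn_intros dft_intros dft_app2[OF f])
  moreover note ex
  moreover have "R x l' r'" if "R x l r" "l \<le> l'" "r' \<le> r" for x l r l' r'
    using that unfolding R_def by (meson le_less_trans less_le_trans)
  ultimately obtain a' b' l r where ab': "a \<le> a'" "a' < b'" "b' \<le> b" "l < r"
    and R: "\<And>x. a' < x \<Longrightarrow> x < b' \<Longrightarrow> R x l r"
    by (rule uniform_box[of R, OF _ ab]) blast+
  obtain z where z: "l < z" "z < r" using dense[OF ab'(4)] by blast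
  have "{x. a' < x \<and> x < b'} \<subseteq> fst ` {(x, y). a < x \<and> x < b \<and> c < y \<and> y < d \<and> f x y = z}"
  proof
    fix x assume "x \<in> {x. a' < x \<and> x < b'}"
    then have x: "a' < x" "x < b'" by auto
    then obtain y where "c < y" "y < d" "f x y = z" using R[OF x] z unfolding R_def by blast
    then show "x \<in> fst ` {(x, y). a < x \<and> x < b \<and> c < y \<and> y < d \<and> f x y = z}"
      using x ab' by (intro image_eqI[of _ _ "(x, y)"]) auto
  qed
  then show False using infinite_interval[OF ab'(2)] fin[of z] by (meson finite_imageI finite_subset)
qed

text \<open>
  On a suitable subinterval distinct points of a fibre are at least \<open>\<delta>\<close> apart and every point of a
  fibre stays within \<open>\<delta> / 2\<close> of all nearby fibres, so the nearest-point maps between nearby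
  fibres are injective.
\<close>

definition stable_fibres :: "('a \<Rightarrow> 'a \<Rightarrow> bool) \<Rightarrow> 'a \<Rightarrow> bool" where
  "stable_fibres A x \<longleftrightarrow> (\<exists>e \<delta>. e > 0 \<and> \<delta> > 0 \<and>
    (\<forall>x1 x2. \<bar>x1 - x\<bar> < e \<and> \<bar>x2 - x\<bar> < e \<longrightarrow>
      (\<forall>b b'. A x1 b \<and> A x1 b' \<and> b \<noteq> b' \<longrightarrow> \<delta> \<le> \<bar>b - b'\<bar>) \<and>
      (\<forall>b. A x1 b \<longrightarrow> (\<exists>b'. A x2 b' \<and> \<bar>b - b'\<bar> < \<delta> / 2))))"

lemma finite_separated:
  fixes S :: "'a set"
  assumes "finite S"
  shows "\<exists>\<delta>>0. \<forall>b\<in>S. \<forall>b'\<in>S. b \<noteq> b' \<longrightarrow> \<delta> \<le> \<bar>b - b'\<bar>"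
proof -
  let ?D = "insert 1 ((\<lambda>(b, b'). \<bar>b - b'\<bar>) ` {(b, b'). b \<in> S \<and> b' \<in> S \<and> b \<noteq> b'})"
  have "{(b, b'). b \<in> S \<and> b' \<in> S \<and> b \<noteq> b'} \<subseteq> S \<times> S" by auto
  then have fin: "finite ?D" using assms by (simp add: finite_subset)
  have "Min ?D > 0" using fin by (subst Min_gr_iff) auto
  moreover have "Min ?D \<le> \<bar>b - b'\<bar>" if "b \<in> S" "b' \<in> S" "b \<noteq> b'" for b b'
    using that by (intro Min_le fin) auto
  ultimately show ?thesis by blast
qed

text \<open>The separation is uniform after shrinking. Points of fibres that are not followed by
  nearby fibres cannot occur over a whole interval: a definable choice of such points would be
  continuous somewhere, and there its own neighbouring values follow it.\<close>

lemma generic_stable_fibres: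
  assumes A: "dfn2 M A" and fin: "\<And>x. finite {b. A x b}" and ab: "a < b"
  shows "\<exists>x\<in>{a<..<b}. stable_fibres A x"
proof -
  define R where "R x \<delta> \<longleftrightarrow> (\<forall>b b'. A x b \<and> A x b' \<and> b \<noteq> b' \<longrightarrow> \<delta> \<le> \<bar>b - b'\<bar>)" for x \<delta>
  have "dfn2 M R"
    unfolding R_def by (intro dfn_intros dft_intros dfn_app2[OF A])
  moreover have "\<exists>\<delta>>0. R x \<delta>" for x
    using finite_separated[OF fin[of x]] unfolding R_def by (metis mem_Collect_eq)
  moreover have "R x \<delta>'" if "R x \<delta>" "\<delta>' \<le> \<delta>" for x \<delta> \<delta>'
    using that unfolding R_def by (meson order_trans)
  ultimately obtain c d \<delta> where cd: "a \<le> c" "c < d" "d \<le> b" "\<delta> > 0"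
    and R: "\<And>x. c < x \<Longrightarrow> x < d \<Longrightarrow> R x \<delta>"
    by (rule uniform_on_subinterval[of R, OF _ ab]) blast+
  define B where "B y b \<longleftrightarrow> A y b \<and>
    \<not> (\<exists>e. e > 0 \<and> (\<forall>x. \<bar>x - y\<bar> < e \<longrightarrow> (\<exists>b'. A x b' \<and> \<bar>b - b'\<bar> < \<delta> / 2)))" for y b
  have B: "dfn2 M B"
    unfolding B_def by (intro dfn_intros dft_intros dfn_app2[OF A])
  have "dfn M (\<lambda>v. \<exists>b. B (v 0) b)" by (intro dfn_intros dft_intros dfn_app2[OF B])
  from interval_split[OF this cd(2)] obtain c1 d1 where cd1: "c \<le> c1" "c1 < d1" "d1 \<le> d"
    and alt: "(\<forall>x\<in>{c1<..<d1}. \<exists>b. B x b) \<or> (\<forall>x\<in>{c1<..<d1}. \<not> (\<exists>b. B x b))" by blast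
  have "\<not> (\<forall>x\<in>{c1<..<d1}. \<exists>b. B x b)"
  proof
    assume ex: "\<forall>x\<in>{c1<..<d1}. \<exists>b. B x b"
    define \<beta> where "\<beta> x = ch (B x)" for x
    have \<beta>: "dft1 M \<beta>"
      unfolding \<beta>_def by (intro dft_ch dfn_app2[OF B] dft_intros)
    have B\<beta>: "B x (\<beta> x)" if "c1 < x" "x < d1" for x
    proof -
      have "dfn M (\<lambda>v. B x (v 0))" by (intro dfn_app2[OF B] dft_intros)
      then show ?thesis using ex that unfolding \<beta>_def by (metis ch_in greaterThanLessThan_iff)
    qed
    obtain c2 d2 where cd2: "c1 \<le> c2" "c2 < d2" "d2 \<le> d1" "\<forall>x\<in>{c2<..<d2}. contat \<beta> x"
      using generic_continuous[OF \<beta> cd1(2)] by blast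
    obtain y where y: "c2 < y" "y < d2" using dense[OF cd2(2)] by blast
    have "\<delta> / 2 > 0" using cd(4) by simp
    moreover have "contat \<beta> y" using cd2(4) y by simp
    ultimately obtain e where e: "e > 0" "\<And>x. \<bar>x - y\<bar> < e \<Longrightarrow> \<bar>\<beta> x - \<beta> y\<bar> < \<delta> / 2"
      unfolding contat_def by blast
    have "\<exists>b'. A x b' \<and> \<bar>\<beta> y - b'\<bar> < \<delta> / 2" if "\<bar>x - y\<bar> < min e (min (y - c1) (d1 - y))" for x
    proof -
      have "c1 < x" "x < d1" "\<bar>x - y\<bar> < e" using that by (auto simp: abs_less_iff)
      then show ?thesis using B\<beta>[of x] e(2)[of x] unfolding B_def by (metis abs_minus_commute)
    qed
    moreover have "min e (min (y - c1) (d1 - y)) > 0" using e(1) y cd2 by simp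
    moreover have "B y (\<beta> y)" using B\<beta> y cd2 by simp
    ultimately show False unfolding B_def by blast
  qed
  with alt have nB: "\<And>y b. c1 < y \<Longrightarrow> y < d1 \<Longrightarrow> \<not> B y b" by (meson greaterThanLessThan_iff)
  define S where "S y e \<longleftrightarrow> (\<forall>b. A y b \<longrightarrow> (\<forall>x. \<bar>x - y\<bar> < e \<longrightarrow> (\<exists>b'. A x b' \<and> \<bar>b - b'\<bar> < \<delta> / 2)))" for y e
  have "dfn2 M S"
    unfolding S_def by (intro dfn_intros dft_intros dfn_app2[OF A])
  moreover have "\<exists>e>0. S y e" if y: "c1 < y" "y < d1" for y
  proof -
    have "\<forall>b\<in>{b. A y b}. \<exists>e>0. \<forall>x. \<bar>x - y\<bar> < e \<longrightarrow> (\<exists>b'. A x b' \<and> \<bar>b - b'\<bar> < \<delta> / 2)"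
      using nB[OF y] unfolding B_def by blast
    then obtain g where g: "\<And>b. A y b \<Longrightarrow> g b > 0"
      "\<And>b x. A y b \<Longrightarrow> \<bar>x - y\<bar> < g b \<Longrightarrow> \<exists>b'. A x b' \<and> \<bar>b - b'\<bar> < \<delta> / 2"
      by (metis mem_Collect_eq)
    \<comment> \<open>The fibre is finite, so the least of the radii of its points serves for all of
      them; the \<open>1\<close> covers the empty fibre.\<close>
    let ?E = "insert 1 (g ` {b. A y b})"
    have fE: "finite ?E" using fin by simp
    have "Min ?E > 0" using fE g(1) by (subst Min_gr_iff) auto
    moreover have "Min ?E \<le> g b" if "A y b" for b using that by (intro Min_le fE) auto
    ultimately show ?thesis unfolding S_def using g(2) by (metis less_le_trans)
  qed
  moreover have "S y e'" if "S y e" "e' \<le> e" for y e e'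
    using that unfolding S_def by (meson less_le_trans)
  ultimately obtain c3 d3 e where cd3: "c1 \<le> c3" "c3 < d3" "d3 \<le> d1" "e > 0"
    and S: "\<And>x. c3 < x \<Longrightarrow> x < d3 \<Longrightarrow> S x e"
    by (rule uniform_on_subinterval[of S, OF _ cd1(2)]) blast+
  obtain x where x: "c3 < x" "x < d3" using dense[OF cd3(2)] by blast
  \<comment> \<open>\<open>x1\<close> and \<open>x2\<close> have to be within \<open>e\<close> of
    each other, hence the half.\<close>
  define h where "h = min (e / 2) (min (x - c3) (d3 - x))"
  have h: "h > 0" using x cd3 by (simp add: h_def)
  have "(\<forall>b b'. A x1 b \<and> A x1 b' \<and> b \<noteq> b' \<longrightarrow> \<delta> \<le> \<bar>b - b'\<bar>) \<and>
      (\<forall>b. A x1 b \<longrightarrow> (\<exists>b'. A x2 b' \<and> \<bar>b - b'\<bar> < \<delta> / 2))"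
    if *: "\<bar>x1 - x\<bar> < h \<and> \<bar>x2 - x\<bar> < h" for x1 x2
  proof -
    have x1: "c3 < x1" "x1 < d3" using * by (auto simp: abs_less_iff h_def)
    have "\<bar>x1 - x\<bar> < e / 2" "\<bar>x2 - x\<bar> < e / 2" using * by (simp_all add: h_def)
    then have "\<bar>x2 - x1\<bar> < e" unfolding abs_less_iff by linarith
    moreover have "R x1 \<delta>" "S x1 e" using R S x1 cd1 cd3 by auto
    ultimately show ?thesis unfolding R_def S_def by blast
  qed
  then have "stable_fibres A x" unfolding stable_fibres_def using h cd(4) by blast
  then show ?thesis using x cd cd1 cd3 by auto
qed

lemma stable_fibres_card:
  assumes "stable_fibres A x" and fin: "\<And>x. finite {b. A x b}"
  shows "\<exists>e>0. \<forall>y. \<bar>y - x\<bar> < e \<longrightarrow> card {b. A y b} = card {b. A x b}"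
proof -
  obtain e \<delta> where e: "e > 0" "\<delta> > 0"
    and sep: "\<And>x1 b b'. \<bar>x1 - x\<bar> < e \<Longrightarrow> A x1 b \<Longrightarrow> A x1 b' \<Longrightarrow> b \<noteq> b' \<Longrightarrow> \<delta> \<le> \<bar>b - b'\<bar>"
    and near: "\<And>x1 x2 b. \<bar>x1 - x\<bar> < e \<Longrightarrow> \<bar>x2 - x\<bar> < e \<Longrightarrow> A x1 b \<Longrightarrow> \<exists>b'. A x2 b' \<and> \<bar>b - b'\<bar> < \<delta> / 2"
    using assms(1) unfolding stable_fibres_def by blast
  have le: "card {b. A x1 b} \<le> card {b. A x2 b}" if x12: "\<bar>x1 - x\<bar> < e" "\<bar>x2 - x\<bar> < e" for x1 x2
  proof -
    obtain g where g: "\<And>b. A x1 b \<Longrightarrow> A x2 (g b) \<and> \<bar>b - g b\<bar> < \<delta> / 2"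
      using near[OF x12] by metis
    have "inj_on g {b. A x1 b}"
    proof (rule inj_onI, rule ccontr)
      fix b b' assume *: "b \<in> {b. A x1 b}" "b' \<in> {b. A x1 b}" "g b = g b'" "b \<noteq> b'"
      then have "\<bar>b - g b\<bar> < \<delta> / 2" "\<bar>b' - g b\<bar> < \<delta> / 2" using g[of b] g[of b'] by simp_all
      then have "\<bar>b - b'\<bar> < \<delta>" unfolding abs_less_iff by linarith
      then show False using sep[OF x12(1)] * by (metis mem_Collect_eq not_le)
    qed
    moreover have "g ` {b. A x1 b} \<subseteq> {b. A x2 b}" using g by auto
    ultimately show ?thesis using card_inj_on_le fin by blast
  qed
  show ?thesis using e(1) le by (intro exI[of _ e]) (simp add: order.antisym)
qed

text \<open>A cardinality is not a value in the field, so only comparisons with a fixed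
  \<open>k\<close> are expressed, by listing \<open>k\<close> distinct points.\<close>

lemma dfn_card_ge:
  assumes A: "dfn2 M A" and fin: "\<And>x. finite {b. A x b}"
  shows "dfn M (\<lambda>v. k \<le> card {b. A (v 0) b})"
proof -
  have "dfn M (\<lambda>v. \<exists>bs. length bs = k \<and> (\<forall>i<k. A (v 0) (bs ! i)) \<and> (\<forall>i<k. \<forall>j<k. i = j \<or> bs ! i \<noteq> bs ! j))"
    by (rule dfn_exl) (intro dfn_intros dfn_all_less dfn_app2[OF A] dft_intros dfn_const dfl_nth[OF dfl_map_env] | assumption)+
  then show ?thesis
  proof (rule dfn_cong)
    fix v :: "nat \<Rightarrow> 'a"
    show "(\<exists>bs. length bs = k \<and> (\<forall>i<k. A (v 0) (bs ! i)) \<and> (\<forall>i<k. \<forall>j<k. i = j \<or> bs ! i \<noteq> bs ! j)) =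
      (k \<le> card {b. A (v 0) b})" (is "?L = _")
    proof
      assume ?L
      then obtain bs where bs: "length bs = k" "\<forall>i<k. A (v 0) (bs ! i)"
        "\<forall>i<k. \<forall>j<k. i = j \<or> bs ! i \<noteq> bs ! j" by blast
      then have "set bs \<subseteq> {b. A (v 0) b}" "distinct bs"
        by (auto simp: distinct_conv_nth in_set_conv_nth)
      then show "k \<le> card {b. A (v 0) b}" using card_mono[OF fin] distinct_card bs(1) by metis
    next
      assume "k \<le> card {b. A (v 0) b}"
      then obtain T where T: "T \<subseteq> {b. A (v 0) b}" "card T = k" "finite T"
        by (meson obtain_subset_with_card_n)
      then obtain bs where bs: "set bs = T" "distinct bs" using finite_distinct_list by blast
      then have "length bs = k" using T distinct_card by metis
      then show ?L using bs T
        by (intro exI[of _ bs]) (auto simp: distinct_conv_nth subset_iff)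
    qed
  qed
qed

text \<open>Fibre sizes are locally constant at stable points, hence constant on each of the
  finitely many convex pieces of the stable set. Only finitely many points remain outside.\<close>

theorem uniform_finiteness:
  assumes A: "dfn2 M A" and fin: "\<And>x. finite {b. A x b}"
  shows "\<exists>N. \<forall>x. card {b. A x b} \<le> N"
proof -
  have st: "dfn M (\<lambda>v. stable_fibres A (v 0))"
    unfolding stable_fibres_def by (intro dfn_intros dft_intros dfn_app2[OF A])
  have bad: "finite {x. \<not> stable_fibres A x}"
    using infinite_has_interval[OF dfn_not[OF st]] generic_stable_fibres[OF A fin] by blast
  obtain \<I> where \<I>: "finite \<I>" "\<And>I. I \<in> \<I> \<Longrightarrow> point_or_open_interval I" "{x. stable_fibres A x} = \<Union>\<I>"
    using definable_pieces[OF st] by blast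
  have const: "card {b. A y b} = card {b. A x b}" if I: "I \<in> \<I>" "x \<in> I" "y \<in> I" for I x y
  proof -
    have *: "card {b. A y b} = card {b. A x b}" if xy: "x \<in> I" "y \<in> I" "x \<le> y" for x y
    proof -
      have mid: "stable_fibres A s" if "x \<le> s" "s \<le> y" for s
      proof -
        have "s \<in> I" using \<I>(2)[OF I(1)] that xy unfolding point_or_open_interval_def by force
        then show ?thesis using \<I>(3) I(1) by blast
      qed
      have loc: "\<exists>e>0. \<forall>u. x \<le> u \<and> u \<le> y \<and> \<bar>u - s\<bar> < e \<longrightarrow> P (card {b. A u b}) = P (card {b. A s b})"
        if "x \<le> s" "s \<le> y" for s and P :: "nat \<Rightarrow> bool"
        using stable_fibres_card[OF mid[OF that] fin] by metis
      define k where "k = card {b. A x b}"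
      \<comment> \<open>The transfer from \<open>x\<close> to \<open>y\<close> applies to definable
        predicates, so equality of the two sizes is obtained from two definable comparisons.\<close>
      have "k \<le> card {b. A y b}"
        by (rule locally_constant_imp_constant[OF dfn_card_ge[OF A fin] xy(3)])
          (use loc[of _ "\<lambda>c. k \<le> c"] in \<open>simp_all add: k_def\<close>)
      moreover have "\<not> Suc k \<le> card {b. A y b}"
        by (rule locally_constant_imp_constant[OF dfn_not[OF dfn_card_ge[OF A fin]] xy(3)])
          (use loc[of _ "\<lambda>c. \<not> Suc k \<le> c"] in \<open>simp_all add: k_def\<close>)
      ultimately show ?thesis by (simp add: k_def)
    qed
    then show ?thesis using I by (metis linear)
  qed
  have "finite ((\<lambda>x. card {b. A x b}) ` I)" if "I \<in> \<I>" for I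
  proof (cases "I = {}")
    case False
    then obtain x where "x \<in> I" by blast
    then have "(\<lambda>x. card {b. A x b}) ` I \<subseteq> {card {b. A x b}}" using const[OF that] by blast
    then show ?thesis by (rule finite_subset) simp
  qed simp
  then have "finite ((\<lambda>x. card {b. A x b}) ` ({x. \<not> stable_fibres A x} \<union> \<Union>\<I>))"
    using bad \<I>(1) by (simp add: image_Un image_Union)
  moreover have "{x. \<not> stable_fibres A x} \<union> \<Union>\<I> = UNIV" using \<I>(3) by blast
  ultimately have "finite (range (\<lambda>x. card {b. A x b}))" by simp
  then show ?thesis by (meson Max_ge rangeI)
qed

end

section \<open>Sets without two-dimensional cells are covered by definable curves\<close>

lemma dfl_if:
  assumes "dfn M c" "dfl M n k" "dfl M n l"
  shows "dfl M n (\<lambda>v. if c v then k v else l v)"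
proof -
  have "(if c v then k v else l v) ! i = (if c v then k v ! i else l v ! i)" for v i by simp
  then show ?thesis using assms by (auto simp: dfl_def intro!: dft_if)
qed

lemma dfl_take:
  assumes "dfl M (Suc n) l"
  shows "dfl M n (\<lambda>v. take n (l v))"
  using assms by (simp add: dfl_def)

context omin_structure
begin

text \<open>No continuity is asked of the curve and its domain is the whole line, so that a single
  curve can absorb finite unions.\<close>

definition thin :: "nat \<Rightarrow> 'a list set \<Rightarrow> bool" where
  "thin n X \<longleftrightarrow> (\<exists>\<phi>. dfl1 M n \<phi> \<and> X \<subseteq> range \<phi>)"

lemma thin_subset: "thin n Y \<Longrightarrow> X \<subseteq> Y \<Longrightarrow> thin n X"
  unfolding thin_def by blast

lemma thin_empty: "thin n {}"
  unfolding thin_def using dfl_const[of "replicate n 0" n M] by (intro exI[of _ "\<lambda>_. replicate n 0"]) simp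

lemma thin_Un:
  assumes "thin n X" "thin n Y"
  shows "thin n (X \<union> Y)"
proof -
  obtain \<phi> \<psi> where \<phi>: "dfl1 M n \<phi>" "X \<subseteq> range \<phi>" and \<psi>: "dfl1 M n \<psi>" "Y \<subseteq> range \<psi>"
    using assms unfolding thin_def by blast
  \<comment> \<open>Maps the positive half line onto the whole line: arguments from \<open>1\<close>
    on give the nonnegative values, those below \<open>1\<close> the negative ones. Each half line
    can thus carry one of the two curves.\<close>
  define g :: "'a \<Rightarrow> 'a" where "g x = (if 1 \<le> x then x - 1 else 1 - 1 / x)" for x
  have g: "dft1 M g" unfolding g_def by (intro dft_intros dfn_intros)
  have surj: "\<exists>x>0. g x = y" for y
  proof (cases "0 \<le> y")
    case True then show ?thesis by (intro exI[of _ "y + 1"]) (simp add: g_def)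
  next
    case False then show ?thesis by (intro exI[of _ "1 / (1 - y)"]) (simp add: g_def)
  qed
  define \<chi> where "\<chi> x = (if 0 < x then \<phi> (g x) else \<psi> (g (- x)))" for x
  have "dfl1 M n \<chi>" unfolding \<chi>_def
    by (intro dfl_if dfn_intros dft_intros dfl_app1[OF \<phi>(1)] dfl_app1[OF \<psi>(1)] dft_app1[OF g])
  moreover have "\<phi> y \<in> range \<chi>" for y
  proof -
    obtain x where "x > 0" "g x = y" using surj by blast
    then have "\<phi> y = \<chi> x" by (simp add: \<chi>_def)
    then show ?thesis by blast
  qed
  moreover have "\<psi> y \<in> range \<chi>" for y
  proof -
    obtain x where "x > 0" "g x = y" using surj by blast
    then have "\<psi> y = \<chi> (- x)" by (simp add: \<chi>_def)
    then show ?thesis by blast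
  qed
  ultimately show ?thesis using \<phi>(2) \<psi>(2) unfolding thin_def by (intro exI[of _ \<chi>]) blast
qed

lemma thin_UN: "finite T \<Longrightarrow> (\<And>t. t \<in> T \<Longrightarrow> thin n (X t)) \<Longrightarrow> thin n (\<Union>t\<in>T. X t)"
  by (induction T rule: finite_induct) (simp_all add: thin_empty thin_Un)

text \<open>Each round removes one definable section of the fibres, chosen by \<open>ch\<close>, and
  so lowers the bound on their size by one.\<close>

lemma thin_bounded_fibres:
  assumes \<phi>: "dfl1 M n \<phi>"
    and "dfn2 M A" "\<And>t. finite {y. A t y}" "\<And>t. card {y. A t y} \<le> N"
  shows "thin (Suc n) {\<phi> t @ [y] |t y. A t y}"
  using assms(2-)
proof (induction N arbitrary: A)
  case 0
  then have "{\<phi> t @ [y] |t y. A t y} = {}" by simp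
  then show ?case by (simp add: thin_empty)
next
  case (Suc N)
  define f where "f t = ch (A t)" for t
  have f: "dft1 M f" unfolding f_def by (intro dft_ch dfn_app2[OF Suc.prems(1)] dft_intros)
  have "thin (Suc n) {\<phi> t @ [y] |t y. A t y \<and> y \<noteq> f t}"
  proof (rule Suc.IH)
    show "dfn M (\<lambda>v. A (v 0) (v (Suc 0)) \<and> v (Suc 0) \<noteq> f (v 0))"
      by (intro dfn_intros dfn_app2[OF Suc.prems(1)] dft_intros dft_app1[OF f])
    show "finite {y. A t y \<and> y \<noteq> f t}" for t using Suc.prems(2)[of t] by simp
    show "card {y. A t y \<and> y \<noteq> f t} \<le> N" for t
    proof (cases "\<exists>y. A t y")
      case True
      have "dfn M (\<lambda>v. A t (v 0))" by (intro dfn_app2[OF Suc.prems(1)] dft_intros)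
      then have "A t (f t)" unfolding f_def using True ch_in by blast
      moreover have "{y. A t y \<and> y \<noteq> f t} = {y. A t y} - {f t}" by auto
      ultimately show ?thesis using Suc.prems(2)[of t] Suc.prems(3)[of t] by (simp add: card_Diff_singleton)
    qed simp
  qed
  moreover have "thin (Suc n) (range (\<lambda>t. \<phi> t @ [f t]))"
    unfolding thin_def by (intro exI[of _ "\<lambda>t. \<phi> t @ [f t]"] conjI dfl_snoc \<phi> f subset_refl)
  ultimately show ?case by (rule thin_subset[OF thin_Un]) auto
qed

text \<open>
  All subintervals and subboxes are required to have cells as images, because a further
  coordinate is only continuous after shrinking the domain.
\<close>

definition chart1 :: "nat \<Rightarrow> ('a \<Rightarrow> 'a list) \<Rightarrow> 'a \<Rightarrow> 'a \<Rightarrow> bool" where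
  "chart1 n \<phi> a b \<longleftrightarrow> a < b \<and> dfl1 M n \<phi> \<and> (\<exists>i<n. \<forall>s\<in>{a<..<b}. \<phi> s ! i = s) \<and>
     (\<forall>a' b'. a \<le> a' \<and> a' < b' \<and> b' \<le> b \<longrightarrow>
        (\<exists>is. length is = n \<and> sum_list is = 1 \<and> cell M is (\<phi> ` {a'<..<b'})))"

definition chart2 :: "nat \<Rightarrow> ('a \<Rightarrow> 'a \<Rightarrow> 'a list) \<Rightarrow> 'a \<Rightarrow> 'a \<Rightarrow> 'a \<Rightarrow> 'a \<Rightarrow> bool" where
  "chart2 n \<sigma> a b c d \<longleftrightarrow> a < b \<and> c < d \<and> dfl2 M n \<sigma> \<and>
     (\<exists>i<n. \<exists>j<n. \<forall>s\<in>{a<..<b}. \<forall>t\<in>{c<..<d}. \<sigma> s t ! i = s \<and> \<sigma> s t ! j = t) \<and>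
     (\<forall>a' b' c' d'. a \<le> a' \<and> a' < b' \<and> b' \<le> b \<and> c \<le> c' \<and> c' < d' \<and> d' \<le> d \<longrightarrow>
        (\<exists>is. length is = n \<and> sum_list is = 2 \<and>
           cell M is {\<sigma> s t |s t. s \<in> {a'<..<b'} \<and> t \<in> {c'<..<d'}}))"

lemma chart1_sub:
  assumes "chart1 n \<phi> a b" "a \<le> a'" "a' < b'" "b' \<le> b"
  shows "chart1 n \<phi> a' b'"
proof -
  have cell: "\<And>a' b'. a \<le> a' \<and> a' < b' \<and> b' \<le> b \<Longrightarrow>
        (\<exists>is. length is = n \<and> sum_list is = 1 \<and> cell M is (\<phi> ` {a'<..<b'}))"
    and def: "dfl1 M n \<phi>" and i: "\<exists>i<n. \<forall>s\<in>{a<..<b}. \<phi> s ! i = s"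
    using assms(1) unfolding chart1_def by blast+
  have "\<exists>i<n. \<forall>s\<in>{a'<..<b'}. \<phi> s ! i = s" using i assms by force
  moreover have "\<exists>is. length is = n \<and> sum_list is = 1 \<and> cell M is (\<phi> ` {a''<..<b''})"
    if "a' \<le> a'' \<and> a'' < b'' \<and> b'' \<le> b'" for a'' b''
    using that assms by (intro cell) auto
  ultimately show ?thesis unfolding chart1_def using assms def by blast
qed

lemma chart2_sub:
  assumes "chart2 n \<sigma> a b c d" "a \<le> a'" "a' < b'" "b' \<le> b" "c \<le> c'" "c' < d'" "d' \<le> d"
  shows "chart2 n \<sigma> a' b' c' d'"
proof -
  have "\<exists>i<n. \<exists>j<n. \<forall>s\<in>{a<..<b}. \<forall>t\<in>{c<..<d}. \<sigma> s t ! i = s \<and> \<sigma> s t ! j = t"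
    and cell: "\<And>a' b' c' d'. a \<le> a' \<and> a' < b' \<and> b' \<le> b \<and> c \<le> c' \<and> c' < d' \<and> d' \<le> d \<Longrightarrow>
        (\<exists>is. length is = n \<and> sum_list is = 2 \<and>
           cell M is {\<sigma> s t |s t. s \<in> {a'<..<b'} \<and> t \<in> {c'<..<d'}})"
    and def: "dfl2 M n \<sigma>"
    using assms(1) unfolding chart2_def by blast+
  then obtain i j where ij: "i < n" "j < n"
    "\<And>s t. s \<in> {a<..<b} \<Longrightarrow> t \<in> {c<..<d} \<Longrightarrow> \<sigma> s t ! i = s \<and> \<sigma> s t ! j = t" by blast
  have "\<sigma> s t ! i = s \<and> \<sigma> s t ! j = t" if "s \<in> {a'<..<b'}" "t \<in> {c'<..<d'}" for s t
    using that assms by (intro ij) auto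
  moreover have "\<exists>is. length is = n \<and> sum_list is = 2 \<and>
           cell M is {\<sigma> s t |s t. s \<in> {a''<..<b''} \<and> t \<in> {c''<..<d''}}"
    if "a' \<le> a'' \<and> a'' < b'' \<and> b'' \<le> b' \<and> c' \<le> c'' \<and> c'' < d'' \<and> d'' \<le> d'" for a'' b'' c'' d''
    using that assms by (intro cell) auto
  ultimately show ?thesis unfolding chart2_def using assms ij def by blast
qed

section \<open>Cells as graphs and bands over charts\<close>

lemma definable_cont_const: "definable M n C \<Longrightarrow> definable_cont M n C (\<lambda>_. x)"
  unfolding definable_cont_def cont_on_def
  by (auto intro!: definable_mapI dfl_const)

lemma definable_contI:
  assumes C: "definable M n C" and f: "dft M (\<lambda>v. f (map v [0..<n]))" and "cont_on C f"
  shows "definable_cont M n C f"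
proof -
  have "dfl M (Suc 0) (\<lambda>v. [f (map v [0..<n])])"
    by (intro dfl_Cons f dfl_const) simp
  then show ?thesis using assms unfolding definable_cont_def by (auto intro!: definable_mapI)
qed

lemma definable_image1:
  assumes \<phi>: "dfl1 M n \<phi>"
  shows "definable M n (\<phi> ` {a<..<b})"
proof (rule definableI)
  show "length xs = n" if "xs \<in> \<phi> ` {a<..<b}" for xs
    using that dfl_length[OF \<phi>, of "\<lambda>_. _"] by auto
  have "dfn M (\<lambda>v. \<exists>s. a < s \<and> s < b \<and> map v [0..<n] = \<phi> s)"
    by (intro dfn_intros dft_intros dfn_list_eq[OF dfl_map_env_shift dfl_app1[OF \<phi>]])
  then show "dfn M (\<lambda>v. map v [0..<n] \<in> \<phi> ` {a<..<b})" by (rule dfn_cong) auto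
qed

lemma definable_image2:
  assumes \<sigma>: "dfl2 M n \<sigma>"
  shows "definable M n {\<sigma> s t |s t. s \<in> {a<..<b} \<and> t \<in> {c<..<d}}"
proof (rule definableI)
  show "length xs = n" if "xs \<in> {\<sigma> s t |s t. s \<in> {a<..<b} \<and> t \<in> {c<..<d}}" for xs
  proof -
    obtain s t where "xs = \<sigma> s t" using \<open>xs \<in> _\<close> by blast
    then show ?thesis using dfl_length[OF \<sigma>, of "case_nat s (\<lambda>_. t)"] by simp
  qed
  have "dfn M (\<lambda>v. \<exists>s t. map v [0..<n] = \<sigma> s t \<and> a < s \<and> s < b \<and> c < t \<and> t < d)"
    by (intro dfn_intros dft_intros dfn_list_eq[OF dfl_map_env_shift dfl_app2[OF \<sigma>]])
  then show "dfn M (\<lambda>v. map v [0..<n] \<in> {\<sigma> s t |s t. s \<in> {a<..<b} \<and> t \<in> {c<..<d}})"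
    by (rule dfn_cong) auto
qed

lemma definable_point: "definable M (length xs) {xs}"
  by (rule definableI) (auto intro: dfn_list_eq dfl_map_env dfl_const)

lemma cell_point: "cell M (replicate (length xs) 0) {xs}"
proof (induction xs rule: rev_induct)
  case Nil
  show ?case using cell_Nil by simp
next
  case (snoc x xs)
  have "{ys @ [x] |ys. ys \<in> {xs}} = {xs @ [x]}" by auto
  then show ?case
    using cell_graph[OF snoc, of "\<lambda>_. x"] definable_cont_const[OF definable_point]
    by (simp add: replicate_append_same)
qed

lemma chart1_line:
  assumes "length xs = n" "a < b"
  shows "chart1 (Suc n) (\<lambda>s. xs @ [s]) a b"
  unfolding chart1_def
proof (intro conjI exI[of _ n] allI impI)
  show "dfl M (Suc n) (\<lambda>v. xs @ [v 0])" using assms by (intro dfl_snoc dfl_const dft_intros)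
  fix a' b' :: 'a assume ab: "a \<le> a' \<and> a' < b' \<and> b' \<le> b"
  have "{xs' @ [y] |xs' y. xs' \<in> {xs} \<and> (\<forall>f. Some (\<lambda>_. a') = Some f \<longrightarrow> f xs' < y) \<and>
      (\<forall>g. Some (\<lambda>_. b') = Some g \<longrightarrow> y < g xs')} = (\<lambda>s. xs @ [s]) ` {a'<..<b'}" by auto
  then have "cell M (replicate n 0 @ [1]) ((\<lambda>s. xs @ [s]) ` {a'<..<b'})"
    using cell_band[OF cell_point[of xs], of "Some (\<lambda>_. a')" "Some (\<lambda>_. b')"] ab
      definable_cont_const[OF definable_point[of xs]] assms(1) by auto
  then show "\<exists>is. length is = Suc n \<and> sum_list is = 1 \<and> cell M is ((\<lambda>s. xs @ [s]) ` {a'<..<b'})"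
    by (intro exI[of _ "replicate n 0 @ [1]"]) simp
qed (use assms in auto)

text \<open>In a cell the last coordinate has to be a continuous function of the earlier
  coordinates, not of the parameter. Since coordinate \<open>i\<close> equals the parameter,
  \<open>y (xs ! i)\<close> is such a function.\<close>

lemma chart1_graph:
  assumes \<phi>: "chart1 n \<phi> a b" and y: "dft1 M y" "\<And>s. a < s \<Longrightarrow> s < b \<Longrightarrow> contat y s"
  shows "chart1 (Suc n) (\<lambda>s. \<phi> s @ [y s]) a b"
proof -
  obtain i where i: "i < n" "\<And>s. a < s \<Longrightarrow> s < b \<Longrightarrow> \<phi> s ! i = s" and ab: "a < b"
    and def: "dfl1 M n \<phi>"
    using \<phi> unfolding chart1_def by auto
  have len: "length (\<phi> s) = n" for s using dfl_length[OF def, of "\<lambda>_. s"] by simp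
  show ?thesis unfolding chart1_def
  proof (intro conjI exI[of _ i] allI impI)
    show "dfl M (Suc n) (\<lambda>v. \<phi> (v 0) @ [y (v 0)])" by (intro dfl_snoc def y)
    show "\<forall>s\<in>{a<..<b}. (\<phi> s @ [y s]) ! i = s" using i len by (simp add: nth_append)
    fix a' b' assume ab': "a \<le> a' \<and> a' < b' \<and> b' \<le> b"
    then obtain "is" where isc: "length is = n" "sum_list is = 1" "cell M is (\<phi> ` {a'<..<b'})"
      using \<phi> unfolding chart1_def by blast
    have "cont_on (\<phi> ` {a'<..<b'}) (\<lambda>xs. y (xs ! i))" unfolding cont_on_def
    proof (intro ballI allI impI)
      fix xs and e :: 'a assume "xs \<in> \<phi> ` {a'<..<b'}" "e > 0"
      then obtain s where s: "xs = \<phi> s" "a' < s" "s < b'" by auto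
      then have "contat y s" using ab' by (intro y) auto
      then obtain \<delta> where \<delta>: "\<delta> > 0" "\<And>u. \<bar>u - s\<bar> < \<delta> \<Longrightarrow> \<bar>y u - y s\<bar> < e"
        using \<open>e > 0\<close> unfolding contat_def by blast
      have "\<bar>y (ys ! i) - y (xs ! i)\<bar> < e"
        if "ys \<in> \<phi> ` {a'<..<b'}" "list_all2 (\<lambda>x y. \<bar>y - x\<bar> < \<delta>) xs ys" for ys
      proof -
        have "\<bar>ys ! i - xs ! i\<bar> < \<delta>" using that(2) i(1) s len by (auto simp: list_all2_conv_all_nth)
        moreover have "xs ! i = s" using i(2) s ab' by auto
        ultimately show ?thesis using \<delta>(2) by simp
      qed
      then show "\<exists>\<delta>>0. \<forall>ys\<in>\<phi> ` {a'<..<b'}. list_all2 (\<lambda>x y. \<bar>y - x\<bar> < \<delta>) xs ys \<longrightarrow>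
          \<bar>y (ys ! i) - y (xs ! i)\<bar> < e" using \<delta>(1) by blast
    qed
    moreover have "dft M (\<lambda>v. y (map v [0..<n] ! i))"
      using dft_app1[OF y(1) dft_var, of i] i(1) by simp
    ultimately have "definable_cont M (length is) (\<phi> ` {a'<..<b'}) (\<lambda>xs. y (xs ! i))"
      unfolding isc(1) by (intro definable_contI definable_image1 def)
    from cell_graph[OF isc(3) this]
    have "cell M (is @ [0]) {xs @ [y (xs ! i)] |xs. xs \<in> \<phi> ` {a'<..<b'}}" .
    also have "{xs @ [y (xs ! i)] |xs. xs \<in> \<phi> ` {a'<..<b'}} = (\<lambda>s. \<phi> s @ [y s]) ` {a'<..<b'}"
    proof -
      have "\<phi> s @ [y (\<phi> s ! i)] = \<phi> s @ [y s]" if "s \<in> {a'<..<b'}" for s using that i(2) ab' by auto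
      then show ?thesis by (auto simp: image_iff)
    qed
    finally show "\<exists>is. length is = Suc n \<and> sum_list is = 1 \<and> cell M is ((\<lambda>s. \<phi> s @ [y s]) ` {a'<..<b'})"
      using isc by (intro exI[of _ "is @ [0]"]) simp
  qed (use i ab in auto)
qed

lemma chart1_band:
  assumes \<phi>: "chart1 n \<phi> a b" and cd: "c < d"
  shows "chart2 (Suc n) (\<lambda>s t. \<phi> s @ [t]) a b c d"
proof -
  obtain i where i: "i < n" "\<And>s. a < s \<Longrightarrow> s < b \<Longrightarrow> \<phi> s ! i = s" and ab: "a < b"
    and def: "dfl1 M n \<phi>"
    using \<phi> unfolding chart1_def by auto
  have len: "length (\<phi> s) = n" for s using dfl_length[OF def, of "\<lambda>_. s"] by simp
  show ?thesis unfolding chart2_def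
  proof (intro conjI allI impI)
    show "dfl M (Suc n) (\<lambda>v. \<phi> (v 0) @ [v (Suc 0)])" by (intro dfl_snoc def dft_intros)
    have "\<forall>s\<in>{a<..<b}. \<forall>t\<in>{c<..<d}. (\<phi> s @ [t]) ! i = s \<and> (\<phi> s @ [t]) ! n = t"
      using i len by (simp add: nth_append)
    then show "\<exists>i<Suc n. \<exists>j<Suc n. \<forall>s\<in>{a<..<b}. \<forall>t\<in>{c<..<d}. (\<phi> s @ [t]) ! i = s \<and> (\<phi> s @ [t]) ! j = t"
      using i(1) less_SucI by blast
    fix a' b' c' d' assume box: "a \<le> a' \<and> a' < b' \<and> b' \<le> b \<and> c \<le> c' \<and> c' < d' \<and> d' \<le> d"
    then obtain "is" where isc: "length is = n" "sum_list is = 1" "cell M is (\<phi> ` {a'<..<b'})"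
      using \<phi> unfolding chart1_def by blast
    have "definable_cont M (length is) (\<phi> ` {a'<..<b'}) (\<lambda>_. x)" for x
      unfolding isc(1) by (intro definable_cont_const definable_image1 def)
    then have "cell M (is @ [1]) {xs @ [y] |xs y. xs \<in> \<phi> ` {a'<..<b'} \<and>
        (\<forall>f. Some (\<lambda>_. c') = Some f \<longrightarrow> f xs < y) \<and> (\<forall>g. Some (\<lambda>_. d') = Some g \<longrightarrow> y < g xs)}"
      using box by (intro cell_band isc(3)) auto
    also have "{xs @ [y] |xs y. xs \<in> \<phi> ` {a'<..<b'} \<and>
        (\<forall>f. Some (\<lambda>_. c') = Some f \<longrightarrow> f xs < y) \<and> (\<forall>g. Some (\<lambda>_. d') = Some g \<longrightarrow> y < g xs)} =
      {\<phi> s @ [t] |s t. s \<in> {a'<..<b'} \<and> t \<in> {c'<..<d'}}" by auto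
    finally show "\<exists>is. length is = Suc n \<and> sum_list is = 2 \<and>
        cell M is {\<phi> s @ [t] |s t. s \<in> {a'<..<b'} \<and> t \<in> {c'<..<d'}}"
      using isc by (intro exI[of _ "is @ [1]"]) simp
  qed (use i ab cd in auto)
qed

lemma chart2_graph:
  assumes \<sigma>: "chart2 n \<sigma> a b c d" and y: "dft2 M y"
    "\<And>s t. a < s \<Longrightarrow> s < b \<Longrightarrow> c < t \<Longrightarrow> t < d \<Longrightarrow> contat2 y s t"
  shows "chart2 (Suc n) (\<lambda>s t. \<sigma> s t @ [y s t]) a b c d"
proof -
  obtain i j where i: "i < n" "j < n"
      "\<And>s t. a < s \<Longrightarrow> s < b \<Longrightarrow> c < t \<Longrightarrow> t < d \<Longrightarrow> \<sigma> s t ! i = s"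
      "\<And>s t. a < s \<Longrightarrow> s < b \<Longrightarrow> c < t \<Longrightarrow> t < d \<Longrightarrow> \<sigma> s t ! j = t"
    and ab: "a < b" "c < d" and def: "dfl2 M n \<sigma>"
    using \<sigma> unfolding chart2_def by auto
  have len: "length (\<sigma> s t) = n" for s t using dfl_length[OF def, of "case_nat s (\<lambda>_. t)"] by simp
  show ?thesis unfolding chart2_def
  proof (intro conjI allI impI)
    show "dfl M (Suc n) (\<lambda>v. \<sigma> (v 0) (v (Suc 0)) @ [y (v 0) (v (Suc 0))])" by (intro dfl_snoc def y)
    have "\<forall>s\<in>{a<..<b}. \<forall>t\<in>{c<..<d}. (\<sigma> s t @ [y s t]) ! i = s \<and> (\<sigma> s t @ [y s t]) ! j = t"
      using i len by (simp add: nth_append)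
    then show "\<exists>i<Suc n. \<exists>j<Suc n. \<forall>s\<in>{a<..<b}. \<forall>t\<in>{c<..<d}.
        (\<sigma> s t @ [y s t]) ! i = s \<and> (\<sigma> s t @ [y s t]) ! j = t"
      using i(1,2) less_SucI by blast
    fix a' b' c' d' assume box: "a \<le> a' \<and> a' < b' \<and> b' \<le> b \<and> c \<le> c' \<and> c' < d' \<and> d' \<le> d"
    let ?C = "{\<sigma> s t |s t. s \<in> {a'<..<b'} \<and> t \<in> {c'<..<d'}}"
    obtain "is" where isc: "length is = n" "sum_list is = 2" "cell M is ?C"
      using \<sigma> box unfolding chart2_def by blast
    have ij: "\<sigma> s t ! i = s" "\<sigma> s t ! j = t" if "a' < s" "s < b'" "c' < t" "t < d'" for s t
      using that i box by auto
    have "cont_on ?C (\<lambda>xs. y (xs ! i) (xs ! j))" unfolding cont_on_def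
    proof (intro ballI allI impI)
      fix xs and e :: 'a assume "xs \<in> ?C" "e > 0"
      then obtain s t where s: "xs = \<sigma> s t" "a' < s" "s < b'" "c' < t" "t < d'" by auto
      then have "contat2 y s t" using box by (intro y) auto
      then obtain \<delta> where \<delta>: "\<delta> > 0"
        "\<And>u w. \<bar>u - s\<bar> < \<delta> \<Longrightarrow> \<bar>w - t\<bar> < \<delta> \<Longrightarrow> \<bar>y u w - y s t\<bar> < e"
        using \<open>e > 0\<close> unfolding contat2_def by blast
      have "\<bar>y (ys ! i) (ys ! j) - y (xs ! i) (xs ! j)\<bar> < e"
        if "list_all2 (\<lambda>x y. \<bar>y - x\<bar> < \<delta>) xs ys" for ys
      proof -
        have "\<bar>ys ! i - xs ! i\<bar> < \<delta>" "\<bar>ys ! j - xs ! j\<bar> < \<delta>"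
          using that i(1,2) s(1) len by (auto simp: list_all2_conv_all_nth)
        moreover have "xs ! i = s" "xs ! j = t" using ij s by auto
        ultimately show ?thesis using \<delta>(2) by simp
      qed
      then show "\<exists>\<delta>>0. \<forall>ys\<in>?C. list_all2 (\<lambda>x y. \<bar>y - x\<bar> < \<delta>) xs ys \<longrightarrow>
          \<bar>y (ys ! i) (ys ! j) - y (xs ! i) (xs ! j)\<bar> < e" using \<delta>(1) by blast
    qed
    moreover have "dft M (\<lambda>v. y (map v [0..<n] ! i) (map v [0..<n] ! j))"
      using dft_app2[OF y(1) dft_var dft_var, of i j] i(1,2) by simp
    ultimately have "definable_cont M (length is) ?C (\<lambda>xs. y (xs ! i) (xs ! j))"
      unfolding isc(1) by (intro definable_contI definable_image2 def)
    from cell_graph[OF isc(3) this]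
    have "cell M (is @ [0]) {xs @ [y (xs ! i) (xs ! j)] |xs. xs \<in> ?C}" .
    also have "{xs @ [y (xs ! i) (xs ! j)] |xs. xs \<in> ?C} =
      {\<sigma> s t @ [y s t] |s t. s \<in> {a'<..<b'} \<and> t \<in> {c'<..<d'}}"
      using ij by auto metis+
    finally show "\<exists>is. length is = Suc n \<and> sum_list is = 2 \<and>
        cell M is {\<sigma> s t @ [y s t] |s t. s \<in> {a'<..<b'} \<and> t \<in> {c'<..<d'}}"
      using isc by (intro exI[of _ "is @ [0]"]) simp
  qed (use i ab in auto)
qed

text \<open>Induction on the number of coordinates. Over a constant initial part, the last
  coordinate is constant on a subinterval or its values contain an interval, which gives a vertical
  segment. Over a chart, the last coordinate is chosen definably along the chart and is continuous
  after shrinking.\<close>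

lemma curve_contains_chart:
  assumes "dfl1 M n \<phi>" "a < b"
  shows "(\<exists>c d x. a \<le> c \<and> c < d \<and> d \<le> b \<and> (\<forall>t\<in>{c<..<d}. \<phi> t = x)) \<or>
    (\<exists>\<psi> c d. chart1 n \<psi> c d \<and> \<psi> ` {c<..<d} \<subseteq> \<phi> ` {a<..<b})"
  using assms
proof (induction n arbitrary: \<phi> a b)
  case 0
  then have "\<phi> t = []" for t using dfl_length[OF 0(1), of "\<lambda>_. t"] by simp
  then show ?case using 0(2) by blast
next
  case (Suc n)
  define \<phi>' where "\<phi>' t = take n (\<phi> t)" for t
  define g where "g t = \<phi> t ! n" for t
  have \<phi>': "dfl1 M n \<phi>'" unfolding \<phi>'_def by (rule dfl_take[OF Suc.prems(1)])
  have g: "dft1 M g" unfolding g_def by (rule dfl_nth[OF Suc.prems(1)]) simp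
  have "length (\<phi> t) = Suc n" for t using dfl_length[OF Suc.prems(1), of "\<lambda>_. t"] by simp
  then have \<phi>: "\<phi> t = \<phi>' t @ [g t]" for t
    by (simp add: \<phi>'_def g_def take_Suc_conv_app_nth[symmetric])
  from Suc.IH[OF \<phi>' Suc.prems(2)] show ?case
  proof (elim disjE exE conjE)
    fix c d x assume cd: "a \<le> c" "c < d" "d \<le> b" and x: "\<forall>t\<in>{c<..<d}. \<phi>' t = x"
    define I where "I z \<longleftrightarrow> (\<exists>t. c < t \<and> t < d \<and> g t = z)" for z
    have I: "dfn1 M I" unfolding I_def by (intro dfn_intros dft_intros dft_app1[OF g])
    show ?case
    proof (cases "finite {z. I z}")
      case True
      then have "finite (g ` {t. c < t \<and> t < d})" by (rule rev_finite_subset) (auto simp: I_def)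
      from pigeonhole_infinite[OF infinite_interval[OF cd(2)] this]
      obtain t0 where "infinite {t. c < t \<and> t < d \<and> g t = g t0}" by (auto simp: conj_assoc)
      moreover have "dfn M (\<lambda>v. g (v 0) = g t0)" by (intro dfn_intros dft_intros g)
      ultimately obtain c' d' where cd': "c \<le> c'" "c' < d'" "d' \<le> d" "\<forall>t\<in>{c'<..<d'}. g t = g t0"
        using infinite_has_subinterval[of "\<lambda>t. g t = g t0"] by blast
      have "\<forall>t\<in>{c'<..<d'}. \<phi> t = x @ [g t0]" using x cd' by (auto simp: \<phi>)
      then show ?thesis using cd cd' by (meson order_trans)
    next
      case False
      obtain p q where pq: "p < q" "\<And>z. p < z \<Longrightarrow> z < q \<Longrightarrow> I z"
        using infinite_has_interval[OF I False] by auto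
      obtain t0 where "c < t0" "t0 < d" using dense[OF cd(2)] by blast
      then have "length x = n" using x dfl_length[OF \<phi>', of "\<lambda>_. t0"] by auto
      then have "chart1 (Suc n) (\<lambda>z. x @ [z]) p q" using pq(1) by (rule chart1_line)
      moreover have "x @ [z] \<in> \<phi> ` {a<..<b}" if z: "p < z" "z < q" for z
      proof -
        obtain t where "c < t" "t < d" "g t = z" using pq(2)[OF z] unfolding I_def by blast
        then show ?thesis using x cd by (intro image_eqI[of _ _ t]) (auto simp: \<phi>)
      qed
      ultimately show ?thesis by (intro disjI2 exI[of _ "\<lambda>z. x @ [z]"] exI[of _ p] exI[of _ q]) auto
    qed
  next
    fix \<psi> c d assume \<psi>: "chart1 n \<psi> c d" "\<psi> ` {c<..<d} \<subseteq> \<phi>' ` {a<..<b}"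
    have cd: "c < d" and \<psi>def: "dfl1 M n \<psi>" using \<psi>(1) by (auto simp: chart1_def)
    define Y where "Y z w \<longleftrightarrow> (\<exists>t. a < t \<and> t < b \<and> \<phi>' t = \<psi> z \<and> g t = w)" for z w
    have Y: "dfn2 M Y" unfolding Y_def
      by (intro dfn_intros dft_intros dfn_list_eq[OF dfl_app1[OF \<phi>'] dfl_app1[OF \<psi>def]] dft_app1[OF g])
    define y where "y z = ch (Y z)" for z
    have y: "dft1 M y" unfolding y_def by (intro dft_ch dfn_app2[OF Y] dft_intros)
    have Yy: "Y z (y z)" if "c < z" "z < d" for z
    proof -
      have "dfn M (\<lambda>v. Y z (v 0))" by (intro dfn_app2[OF Y] dft_intros)
      moreover have "\<psi> z \<in> \<phi>' ` {a<..<b}" using \<psi>(2) that by auto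
      then obtain t where "t \<in> {a<..<b}" "\<psi> z = \<phi>' t" by blast
      then have "Y z (g t)" unfolding Y_def by (intro exI[of _ t]) simp
      ultimately show ?thesis unfolding y_def by (rule ch_in)
    qed
    obtain c' d' where cd': "c \<le> c'" "c' < d'" "d' \<le> d" "\<forall>z\<in>{c'<..<d'}. contat y z"
      using generic_continuous[OF y cd] by (elim exE conjE)
    have "chart1 n \<psi> c' d'" by (rule chart1_sub[OF \<psi>(1) cd'(1-3)])
    then have "chart1 (Suc n) (\<lambda>z. \<psi> z @ [y z]) c' d'" using y by (rule chart1_graph) (use cd' in auto)
    moreover have "\<psi> z @ [y z] \<in> \<phi> ` {a<..<b}" if "c' < z" "z < d'" for z
    proof -
      have "Y z (y z)" using that cd' by (intro Yy) auto
      then obtain t where "a < t" "t < b" "\<phi>' t = \<psi> z" "g t = y z" unfolding Y_def by blast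
      then show ?thesis by (intro image_eqI[of _ _ t]) (auto simp: \<phi>)
    qed
    ultimately show ?case
      by (intro disjI2 exI[of _ "\<lambda>z. \<psi> z @ [y z]"] exI[of _ c'] exI[of _ d']) auto
  qed
qed

text \<open>Turns infinity of a fibre into a first-order condition on \<open>t\<close>.\<close>

lemma infinite_fibre_has_interval:
  assumes A: "dfn2 M A"
  shows "infinite {y. A t y} \<longleftrightarrow> (\<exists>l r. l < r \<and> (\<forall>y. l < y \<and> y < r \<longrightarrow> A t y))"
proof
  assume "infinite {y. A t y}"
  moreover have "dfn M (\<lambda>v. A t (v 0))" by (intro dfn_app2[OF A] dft_intros)
  ultimately obtain l r where "l < r" "\<forall>y\<in>{l<..<r}. A t y" using infinite_has_interval by blast
  then show "\<exists>l r. l < r \<and> (\<forall>y. l < y \<and> y < r \<longrightarrow> A t y)" by (metis greaterThanLessThan_iff)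
next
  assume "\<exists>l r. l < r \<and> (\<forall>y. l < y \<and> y < r \<longrightarrow> A t y)"
  then obtain l r where "l < r" "{y. l < y \<and> y < r} \<subseteq> {y. A t y}" by blast
  then show "infinite {y. A t y}" using infinite_interval finite_subset by blast
qed

text \<open>If only finitely many fibres are infinite, those lie on finitely many vertical lines,
  and the others are covered by boundedly many sections thanks to uniform finiteness. Otherwise the
  fibres over an interval of parameters share an interval, and a chart inside the curve turns the
  resulting box into a cell.\<close>

lemma thin_or_chart2_over_curve:
  assumes X: "definable M (Suc n) X" and \<phi>: "dfl1 M n \<phi>"
    and proj: "\<And>xs y. xs @ [y] \<in> X \<Longrightarrow> xs \<in> range \<phi>"
  shows "thin (Suc n) X \<or> (\<exists>\<sigma> a b c d. chart2 (Suc n) \<sigma> a b c d \<and>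
    (\<forall>s\<in>{a<..<b}. \<forall>t\<in>{c<..<d}. \<sigma> s t \<in> X))"
proof -
  \<comment> \<open>Only the canonical parameter of a point of the curve carries a fibre, so
    \<open>\<phi>\<close> is injective on the parameters with nonempty fibre.\<close>
  define A where "A t y \<longleftrightarrow> t = ch (\<lambda>u. \<phi> u = \<phi> t) \<and> \<phi> t @ [y] \<in> X" for t y
  have can: "dft M (\<lambda>v. ch (\<lambda>u. \<phi> u = \<phi> (v 0)))"
    by (intro dft_ch dfn_list_eq[OF dfl_app1[OF \<phi>] dfl_app1[OF \<phi>]] dft_intros)
  have A: "dfn2 M A" unfolding A_def
    by (intro dfn_intros dft_intros can dfn_mem[OF X] dfl_snoc \<phi>)
  have Xsub: "\<exists>t y. xs = \<phi> t @ [y] \<and> A t y" if "xs \<in> X" for xs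
  proof -
    have "length xs = Suc n" using that X by (simp add: definable_iff_dfn)
    then obtain ys y where xs: "xs = ys @ [y]" by (auto simp: length_Suc_conv_rev)
    then obtain t where t: "ys = \<phi> t" using proj \<open>xs \<in> X\<close> by blast
    define u where "u = ch (\<lambda>u. \<phi> u = ys)"
    have "dfn M (\<lambda>v. \<phi> (v 0) = ys)" unfolding t
      by (intro dfn_list_eq[OF dfl_app1[OF \<phi>] dfl_app1[OF \<phi>]] dft_intros)
    then have "\<phi> u = ys" unfolding u_def by (rule ch_in[of _ t]) (simp add: t)
    then have "A u y" using \<open>xs \<in> X\<close> by (simp add: A_def xs u_def[symmetric])
    then show ?thesis using xs \<open>\<phi> u = ys\<close> by blast
  qed
  define B where "B t \<longleftrightarrow> (\<exists>l r. l < r \<and> (\<forall>y. l < y \<and> y < r \<longrightarrow> A t y))" for t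
  have B: "dfn1 M B" unfolding B_def
    by (intro dfn_intros dft_intros dfn_app2[OF A])
  have B_iff: "B t \<longleftrightarrow> infinite {y. A t y}" for t
    unfolding B_def by (simp add: infinite_fibre_has_interval[OF A])
  show ?thesis
  proof (cases "finite {t. B t}")
    case True
    define A' where "A' t y \<longleftrightarrow> \<not> B t \<and> A t y" for t y
    have A': "dfn2 M A'" unfolding A'_def
      by (intro dfn_intros dfn_app1[OF B] dfn_app2[OF A] dft_intros)
    have fin: "finite {y. A' t y}" for t
      by (cases "B t") (auto simp: A'_def B_iff)
    obtain N where "\<And>t. card {y. A' t y} \<le> N" using uniform_finiteness[OF A' fin] by blast
    then have 1: "thin (Suc n) {\<phi> t @ [y] |t y. A' t y}"
      by (rule thin_bounded_fibres[OF \<phi> A' fin])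
    have 2: "thin (Suc n) (range (\<lambda>y. \<phi> t @ [y]))" for t
      unfolding thin_def
      by (intro exI[of _ "\<lambda>y. \<phi> t @ [y]"] conjI dfl_snoc dfl_app1[OF \<phi>] dft_intros subset_refl)
    have "X \<subseteq> {\<phi> t @ [y] |t y. A' t y} \<union> (\<Union>t\<in>{t. B t}. range (\<lambda>y. \<phi> t @ [y]))"
    proof
      fix xs assume "xs \<in> X"
      then obtain t y where ty: "xs = \<phi> t @ [y]" "A t y" using Xsub by blast
      then show "xs \<in> {\<phi> t @ [y] |t y. A' t y} \<union> (\<Union>t\<in>{t. B t}. range (\<lambda>y. \<phi> t @ [y]))"
        by (cases "B t") (auto simp: A'_def)
    qed
    then show ?thesis by (intro disjI1 thin_subset[OF thin_Un[OF 1 thin_UN[OF True 2]]])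
  next
    case False
    obtain a b where ab: "a < b" "\<forall>t\<in>{a<..<b}. B t" using infinite_has_interval[OF B False] by blast
    define R where "R t l r \<longleftrightarrow> (\<forall>y. l < y \<and> y < r \<longrightarrow> A t y)" for t l r
    have "dfn3 M R" unfolding R_def
      by (intro dfn_intros dft_intros dfn_app2[OF A])
    moreover note ab(1)
    moreover have "\<exists>l r. l < r \<and> R t l r" if "a < t" "t < b" for t
    proof -
      have "B t" using ab(2) that by simp
      then show ?thesis unfolding B_def R_def .
    qed
    moreover have "R x l' r'" if "R x l r" "l \<le> l'" "r' \<le> r" for x l r l' r'
      using that unfolding R_def by (meson le_less_trans less_le_trans)
    ultimately obtain a' b' l r where ab': "a \<le> a'" "a' < b'" "b' \<le> b" "l < r"
      and R: "\<And>t. a' < t \<Longrightarrow> t < b' \<Longrightarrow> R t l r"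
      by (rule uniform_box[of R]) blast+
    obtain y0 where y0: "l < y0" "y0 < r" using dense[OF ab'(4)] by blast
    have inj: "t = u" if "a' < t" "t < b'" "a' < u" "u < b'" "\<phi> t = \<phi> u" for t u
      using R[of t] R[of u] that y0 unfolding R_def A_def by metis
    \<comment> \<open>A constant stretch would contradict injectivity; this leaves the alternative
      of \<open>curve_contains_chart\<close> that produces a chart.\<close>
    have "\<not> (\<exists>c d x. a' \<le> c \<and> c < d \<and> d \<le> b' \<and> (\<forall>t\<in>{c<..<d}. \<phi> t = x))"
    proof (intro notI, elim exE conjE)
      fix c d x assume cd: "a' \<le> c" "c < d" "d \<le> b'" "\<forall>t\<in>{c<..<d}. \<phi> t = x"
      obtain t where t: "c < t" "t < d" using dense[OF cd(2)] by blast
      obtain u where u: "t < u" "u < d" using dense[OF t(2)] by blast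
      show False using inj[of t u] t u cd by auto
    qed
    with curve_contains_chart[OF \<phi> ab'(2)] obtain \<psi> c d
      where \<psi>: "chart1 n \<psi> c d" "\<psi> ` {c<..<d} \<subseteq> \<phi> ` {a'<..<b'}" by blast
    have "chart2 (Suc n) (\<lambda>s t. \<psi> s @ [t]) c d l r" by (rule chart1_band[OF \<psi>(1) ab'(4)])
    moreover have "\<psi> s @ [t] \<in> X" if "s \<in> {c<..<d}" "t \<in> {l<..<r}" for s t
    proof -
      have "\<psi> s \<in> \<phi> ` {a'<..<b'}" using \<psi>(2) that(1) by blast
      then obtain u where u: "a' < u" "u < b'" "\<psi> s = \<phi> u" by auto
      then have "A u t" using R[OF u(1,2)] that(2) by (simp add: R_def)
      then show ?thesis by (simp add: A_def u(3))
    qed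
    ultimately show ?thesis
      by (intro disjI2 exI[of _ "\<lambda>s t. \<psi> s @ [t]"] exI[of _ c] exI[of _ d] exI[of _ l] exI[of _ r]) simp
  qed
qed

text \<open>Induction over the projection. A box in the projection lifts by a definable choice of
  the last coordinate, which is continuous on a smaller box.\<close>

lemma thin_or_chart2:
  assumes "definable M n X"
  shows "thin n X \<or> (\<exists>\<sigma> a b c d. chart2 n \<sigma> a b c d \<and>
    (\<forall>s\<in>{a<..<b}. \<forall>t\<in>{c<..<d}. \<sigma> s t \<in> X))"
  using assms
proof (induction n arbitrary: X)
  case 0
  have "X \<subseteq> range (\<lambda>_. [])" using 0 by (auto simp: definable_iff_dfn)
  then show ?case unfolding thin_def by (auto intro!: disjI1 exI[of _ "\<lambda>_. []"] dfl_const)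
next
  case (Suc n)
  define X' where "X' = {xs. length xs = n \<and> (\<exists>y. xs @ [y] \<in> X)}"
  have "definable M n X'"
  proof (rule definableI)
    have "dfn M (\<lambda>v. \<exists>y. map v [0..<n] @ [y] \<in> X)"
      by (intro dfn_ex dfn_mem[OF Suc.prems] dfl_snoc dfl_map_env_shift dft_intros)
    then show "dfn M (\<lambda>v. map v [0..<n] \<in> X')" by (rule dfn_cong) (simp add: X'_def)
  qed (simp add: X'_def)
  from Suc.IH[OF this] show ?case
  proof (elim disjE exE conjE)
    assume "thin n X'"
    then obtain \<phi> where \<phi>: "dfl1 M n \<phi>" "X' \<subseteq> range \<phi>" unfolding thin_def by blast
    show ?case
    proof (rule thin_or_chart2_over_curve[OF Suc.prems \<phi>(1)])
      fix xs y assume *: "xs @ [y] \<in> X"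
      then have "length (xs @ [y]) = Suc n" using Suc.prems unfolding definable_iff_dfn by blast
      then show "xs \<in> range \<phi>" using * \<phi>(2) by (auto simp: X'_def)
    qed
  next
    fix \<sigma> a b c d
    assume \<sigma>: "chart2 n \<sigma> a b c d" "\<forall>s\<in>{a<..<b}. \<forall>t\<in>{c<..<d}. \<sigma> s t \<in> X'"
    have ab: "a < b" "c < d" and def: "dfl2 M n \<sigma>"
      using \<sigma>(1) by (auto simp: chart2_def)
    define y where "y s t = ch (\<lambda>y. \<sigma> s t @ [y] \<in> X)" for s t
    have y: "dft2 M y" unfolding y_def
      by (intro dft_ch dfn_mem[OF Suc.prems] dfl_snoc dfl_app2[OF def] dft_intros)
    have in_X: "\<sigma> s t @ [y s t] \<in> X" if st: "a < s" "s < b" "c < t" "t < d" for s t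
    proof -
      have "\<sigma> s t \<in> X'" using \<sigma>(2) st by auto
      then obtain z where "\<sigma> s t @ [z] \<in> X" by (auto simp: X'_def)
      moreover have "dfn M (\<lambda>v. \<sigma> s t @ [v 0] \<in> X)"
        by (intro dfn_mem[OF Suc.prems] dfl_snoc dfl_app2[OF def] dft_intros)
      ultimately show ?thesis unfolding y_def by (rule ch_in[rotated])
    qed
    obtain a' b' c' d' where box: "a \<le> a'" "a' < b'" "b' \<le> b" "c \<le> c'" "c' < d'" "d' \<le> d"
      and cont: "\<forall>s\<in>{a'<..<b'}. \<forall>t\<in>{c'<..<d'}. contat2 y s t"
      using generic_continuous2[OF y ab] by blast
    have "chart2 n \<sigma> a' b' c' d'" by (rule chart2_sub[OF \<sigma>(1) box])
    then have "chart2 (Suc n) (\<lambda>s t. \<sigma> s t @ [y s t]) a' b' c' d'"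
      using y by (rule chart2_graph) (use cont in auto)
    moreover have "\<sigma> s t @ [y s t] \<in> X" if "s \<in> {a'<..<b'}" "t \<in> {c'<..<d'}" for s t
      using that box by (intro in_X) auto
    ultimately show ?case
      by (intro disjI2 exI[of _ "\<lambda>s t. \<sigma> s t @ [y s t]"] exI[of _ a'] exI[of _ b'] exI[of _ c'] exI[of _ d']) simp
  qed
qed

theorem one_dimensional_imp_thin:
  assumes "definable M n X" "o_dim M X = 1"
  shows "thin n X"
proof (rule ccontr)
  assume "\<not> thin n X"
  then obtain \<sigma> a b c d where \<sigma>: "chart2 n \<sigma> a b c d" "\<forall>s\<in>{a<..<b}. \<forall>t\<in>{c<..<d}. \<sigma> s t \<in> X"
    using thin_or_chart2[OF assms(1)] by blast
  then obtain "is" where isc: "sum_list is = 2" "cell M is {\<sigma> s t |s t. s \<in> {a<..<b} \<and> t \<in> {c<..<d}}"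
    unfolding chart2_def by blast
  have "{\<sigma> s t |s t. s \<in> {a<..<b} \<and> t \<in> {c<..<d}} \<subseteq> X" using \<sigma>(2) by auto
  then have "ereal (real (sum_list is)) \<le> o_dim M X"
    unfolding o_dim_def using isc(2) by (intro Sup_upper) blast
  then show False using assms(2) isc(1) by (simp add: one_ereal_def)
qed

end

section \<open>Definable distributive lattices on subsets of the line\<close>

text \<open>Used with the order for joins and with its converse for meets, so that results on joins
  serve for both. The axioms are relative to \<open>S\<close>; order and operation are total, with
  arbitrary values elsewhere.\<close>

locale semilat =
  fixes S :: "'b set" and le :: "'b \<Rightarrow> 'b \<Rightarrow> bool" and jn :: "'b \<Rightarrow> 'b \<Rightarrow> 'b"
  assumes refl: "x \<in> S \<Longrightarrow> le x x"
    and trans: "x \<in> S \<Longrightarrow> y \<in> S \<Longrightarrow> z \<in> S \<Longrightarrow> le x y \<Longrightarrow> le y z \<Longrightarrow> le x z"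
    and antisym: "x \<in> S \<Longrightarrow> y \<in> S \<Longrightarrow> le x y \<Longrightarrow> le y x \<Longrightarrow> x = y"
    and closed: "x \<in> S \<Longrightarrow> y \<in> S \<Longrightarrow> jn x y \<in> S"
    and ub1: "x \<in> S \<Longrightarrow> y \<in> S \<Longrightarrow> le x (jn x y)"
    and ub2: "x \<in> S \<Longrightarrow> y \<in> S \<Longrightarrow> le y (jn x y)"
    and least: "x \<in> S \<Longrightarrow> y \<in> S \<Longrightarrow> z \<in> S \<Longrightarrow> le x z \<Longrightarrow> le y z \<Longrightarrow> le (jn x y) z"
begin

lemma comm: "x \<in> S \<Longrightarrow> y \<in> S \<Longrightarrow> jn x y = jn y x"
  by (intro antisym closed least ub1 ub2)

lemma mono: "x \<in> S \<Longrightarrow> y \<in> S \<Longrightarrow> x' \<in> S \<Longrightarrow> y' \<in> S \<Longrightarrow> le x x' \<Longrightarrow> le y y' \<Longrightarrow> le (jn x y) (jn x' y')"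
  by (intro least closed) (auto intro: trans[OF _ _ _ _ ub1] trans[OF _ _ _ _ ub2] closed)

end

locale dist_lat = J: semilat S le jn + Mt: semilat S "\<lambda>x y. le y x" mt
  for S :: "'b set" and le jn mt +
  fixes bt tp :: 'b
  assumes distr: "x \<in> S \<Longrightarrow> y \<in> S \<Longrightarrow> z \<in> S \<Longrightarrow> mt x (jn y z) = jn (mt x y) (mt x z)"
    and bt: "bt \<in> S" "x \<in> S \<Longrightarrow> le bt x"
    and tp: "tp \<in> S" "x \<in> S \<Longrightarrow> le x tp"
begin

text \<open>Distributivity gives v = (u \<sqinter> v) \<squnion> (v \<sqinter> w), and both parts
  lie below \<open>w\<close>. The chain argument uses distributivity only in this form.\<close>

lemma le_by_join_meet:
  assumes "u \<in> S" "v \<in> S" "w \<in> S" "le v (jn u w)" "le (mt u v) w"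
  shows "le v w"
proof -
  have "le v (mt v (jn u w))" using assms by (intro Mt.least J.closed J.refl)
  also have "mt v (jn u w) = jn (mt u v) (mt v w)"
    using assms by (simp add: distr Mt.comm[of v u])
  finally have "le v (jn (mt u v) (mt v w))" .
  moreover have "le (jn (mt u v) (mt v w)) w"
    using assms by (intro J.least Mt.closed Mt.ub2)
  ultimately show ?thesis
    using assms by (intro J.trans[of v "jn (mt u v) (mt v w)" w] J.closed Mt.closed)
qed

end

context omin_structure
begin

lemma pairs_homogeneous2:
  assumes Q1: "dfn2 M Q1" and Q2: "dfn2 M Q2" and ab: "a < b"
  obtains c d where "a \<le> c" "c < d" "d \<le> b"
    "(\<forall>x y. c < x \<and> x < y \<and> y < d \<longrightarrow> Q1 x y) \<or> (\<forall>x y. c < x \<and> x < y \<and> y < d \<longrightarrow> \<not> Q1 x y)"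
    "(\<forall>x y. c < x \<and> x < y \<and> y < d \<longrightarrow> Q2 x y) \<or> (\<forall>x y. c < x \<and> x < y \<and> y < d \<longrightarrow> \<not> Q2 x y)"
proof -
  obtain c d where cd: "a \<le> c" "c < d" "d \<le> b" and 1:
    "(\<forall>x\<in>{c<..<d}. \<forall>y\<in>{c<..<d}. x < y \<longrightarrow> Q1 x y) \<or> (\<forall>x\<in>{c<..<d}. \<forall>y\<in>{c<..<d}. x < y \<longrightarrow> \<not> Q1 x y)"
    using pairs_homogeneous[OF Q1 ab] by blast
  obtain c' d' where cd': "c \<le> c'" "c' < d'" "d' \<le> d" and 2:
    "(\<forall>x\<in>{c'<..<d'}. \<forall>y\<in>{c'<..<d'}. x < y \<longrightarrow> Q2 x y) \<or> (\<forall>x\<in>{c'<..<d'}. \<forall>y\<in>{c'<..<d'}. x < y \<longrightarrow> \<not> Q2 x y)"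
    using pairs_homogeneous[OF Q2 cd(2)] by blast
  have mem: "x \<in> {c<..<d} \<and> y \<in> {c<..<d} \<and> x \<in> {c'<..<d'} \<and> y \<in> {c'<..<d'}"
    if "c' < x \<and> x < y \<and> y < d'" for x y using that cd' by auto
  show thesis
  proof (rule that[of c' d'])
    show "(\<forall>x y. c' < x \<and> x < y \<and> y < d' \<longrightarrow> Q1 x y) \<or> (\<forall>x y. c' < x \<and> x < y \<and> y < d' \<longrightarrow> \<not> Q1 x y)"
      using 1 mem by meson
    show "(\<forall>x y. c' < x \<and> x < y \<and> y < d' \<longrightarrow> Q2 x y) \<or> (\<forall>x y. c' < x \<and> x < y \<and> y < d' \<longrightarrow> \<not> Q2 x y)"
      using 2 mem by meson
  qed (use cd cd' in auto)
qed

text \<open>Once the radius is uniform, any two nearby points satisfy u \<le> u' \<squnion> w and u'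
  \<le> u \<squnion> w, so their joins with \<open>w\<close> agree.\<close>

lemma join_locally_constant:
  fixes S :: "'a set" and le :: "'a \<Rightarrow> 'a \<Rightarrow> bool" and jn :: "'a \<Rightarrow> 'a \<Rightarrow> 'a"
  assumes "semilat S le jn" and le: "dfn2 M le"
    and jn: "dft2 M jn" and ab: "a < b" and sub: "{a<..<b} \<subseteq> S" and w: "w \<in> S"
    and nb: "\<And>x. a < x \<Longrightarrow> x < b \<Longrightarrow> \<exists>e>0. \<forall>u. \<bar>u - x\<bar> < e \<longrightarrow> le u (jn x w)"
  shows "\<exists>x e. a < x \<and> x < b \<and> e > 0 \<and>
    (\<forall>u. \<bar>u - x\<bar> < e \<longrightarrow> u \<in> S) \<and> (\<forall>u u'. \<bar>u - x\<bar> < e \<and> \<bar>u' - x\<bar> < e \<longrightarrow> jn u w = jn u' w)"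
proof -
  interpret semilat S le jn by fact
  have "dfn M (\<lambda>v. \<forall>u. \<bar>u - v 0\<bar> < v (Suc 0) \<longrightarrow> le u (jn (v 0) w))"
    by (intro dfn_intros dft_intros dfn_app2[OF le] dft_app2[OF jn])
  moreover note ab nb
  moreover have "\<forall>u. \<bar>u - x\<bar> < e' \<longrightarrow> le u (jn x w)"
    if "\<forall>u. \<bar>u - x\<bar> < e \<longrightarrow> le u (jn x w)" "e' \<le> e" for x e e' using that by auto
  ultimately obtain c d e where cd: "a \<le> c" "c < d" "d \<le> b" "e > 0"
    and near: "\<And>x. c < x \<Longrightarrow> x < d \<Longrightarrow> \<forall>u. \<bar>u - x\<bar> < e \<longrightarrow> le u (jn x w)"
    by (rule uniform_on_subinterval[where R = "\<lambda>x e. \<forall>u. \<bar>u - x\<bar> < e \<longrightarrow> le u (jn x w)"]) blast+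
  obtain x where x: "c < x" "x < d" using dense[OF cd(2)] by blast
  define h where "h = min (e / 2) (min (x - c) (d - x))"
  have h: "h > 0" using x cd(4) by (simp add: h_def)
  have nbh: "c < u" "u < d" "u \<in> S" "\<bar>u - x\<bar> < e / 2" if "\<bar>u - x\<bar> < h" for u
  proof -
    show "c < u" "u < d" using that by (auto simp: h_def abs_less_iff)
    then show "u \<in> S" using sub cd by auto
    show "\<bar>u - x\<bar> < e / 2" using that by (simp add: h_def)
  qed
  have half: "le (jn u w) (jn u' w)" if "\<bar>u - x\<bar> < h" "\<bar>u' - x\<bar> < h" for u u'
  proof -
    have "\<bar>u - u'\<bar> < e" using nbh(4)[OF that(1)] nbh(4)[OF that(2)] unfolding abs_less_iff by linarith
    then have "le u (jn u' w)" using near[OF nbh(1,2)[OF that(2)]] by blast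
    then show ?thesis using nbh(3)[OF that(1)] nbh(3)[OF that(2)] w by (intro least closed ub2)
  qed
  have "jn u w = jn u' w" if "\<bar>u - x\<bar> < h" "\<bar>u' - x\<bar> < h" for u u'
    using half[OF that] half[OF that(2,1)] nbh(3) that w by (intro antisym closed)
  then show ?thesis using x cd h nbh(3) by (intro exI[of _ x] exI[of _ h]) auto
qed

text \<open>
  A join \<open>z = jn x y\<close> for which neither \<open>x\<close> nor \<open>y\<close> is interior to \<open>{u. le u z}\<close> is determined by \<open>z\<close>
  up to finitely many choices, so by \<open>infinite_fibre\<close> this cannot be the generic behaviour.
\<close>

lemma generic_join:
  fixes S :: "'a set" and le :: "'a \<Rightarrow> 'a \<Rightarrow> bool" and jn :: "'a \<Rightarrow> 'a \<Rightarrow> 'a"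
  assumes "semilat S le jn" and le: "dfn2 M le"
    and jn: "dft2 M jn" and ab: "a < b" and sub: "{a<..<b} \<subseteq> S"
  obtains c d where "a \<le> c" "c < d" "d \<le> b"
    "(\<forall>x x' y. c < x \<and> x < x' \<and> x' < y \<and> y < d \<longrightarrow> jn x y = jn x' y) \<or>
     (\<forall>x y y'. c < x \<and> x < y \<and> y < y' \<and> y' < d \<longrightarrow> jn x y = jn x y')"
proof -
  interpret semilat S le jn by fact
  \<comment> \<open>\<open>U\<close> and \<open>V\<close>: the join is locally constant in its first
    or second argument. \<open>P\<close> and \<open>Q\<close>: that argument is interior to the
    lower set of the join.\<close>
  define U where "U x y \<longleftrightarrow> (\<exists>e. e > 0 \<and> (\<forall>u u'. \<bar>u - x\<bar> < e \<and> \<bar>u' - x\<bar> < e \<longrightarrow> jn u y = jn u' y))" for x y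
  define V where "V x y \<longleftrightarrow> (\<exists>e. e > 0 \<and> (\<forall>u u'. \<bar>u - y\<bar> < e \<and> \<bar>u' - y\<bar> < e \<longrightarrow> jn x u = jn x u'))" for x y
  define P where "P x y \<longleftrightarrow> (\<exists>e. e > 0 \<and> (\<forall>u. \<bar>u - x\<bar> < e \<longrightarrow> le u (jn x y)))" for x y
  define Q where "Q x y \<longleftrightarrow> (\<exists>e. e > 0 \<and> (\<forall>u. \<bar>u - y\<bar> < e \<longrightarrow> le u (jn x y)))" for x y
  have U: "dfn2 M U" unfolding U_def
    by (intro dfn_intros dft_intros dft_app2[OF jn])
  have V: "dfn2 M V" unfolding V_def
    by (intro dfn_intros dft_intros dft_app2[OF jn])
  have P: "dfn2 M P" unfolding P_def
    by (intro dfn_intros dft_intros dfn_app2[OF le] dft_app2[OF jn])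
  have Q: "dfn2 M Q" unfolding Q_def
    by (intro dfn_intros dft_intros dfn_app2[OF le] dft_app2[OF jn])
  obtain c1 d1 where cd1: "a \<le> c1" "c1 < d1" "d1 \<le> b"
    and hU: "(\<forall>x y. c1 < x \<and> x < y \<and> y < d1 \<longrightarrow> U x y) \<or> (\<forall>x y. c1 < x \<and> x < y \<and> y < d1 \<longrightarrow> \<not> U x y)"
    and hV: "(\<forall>x y. c1 < x \<and> x < y \<and> y < d1 \<longrightarrow> V x y) \<or> (\<forall>x y. c1 < x \<and> x < y \<and> y < d1 \<longrightarrow> \<not> V x y)"
    by (rule pairs_homogeneous2[OF U V ab])
  have eqd: "dfn M (\<lambda>v. jn (v 0) y = z)" "dfn M (\<lambda>v. jn y (v 0) = z)" for y z
    by (intro dfn_intros dft_intros dft_app2[OF jn])+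
  consider "\<forall>x y. c1 < x \<and> x < y \<and> y < d1 \<longrightarrow> U x y" | "\<forall>x y. c1 < x \<and> x < y \<and> y < d1 \<longrightarrow> V x y"
    | "\<forall>x y. c1 < x \<and> x < y \<and> y < d1 \<longrightarrow> \<not> U x y" "\<forall>x y. c1 < x \<and> x < y \<and> y < d1 \<longrightarrow> \<not> V x y"
    using hU hV by blast
  then show thesis
  proof cases
    case 1
    have "jn x y = jn x' y" if *: "c1 < x" "x < x'" "x' < y" "y < d1" for x x' y
    proof -
      have "jn x' y = jn x y"
      proof (rule locally_constant_imp_constant[OF eqd(1)])
        fix s assume "x \<le> s" "s \<le> x'"
        then have "U s y" using 1 * by auto
        then obtain e where "e > 0" "\<And>u u'. \<bar>u - s\<bar> < e \<Longrightarrow> \<bar>u' - s\<bar> < e \<Longrightarrow> jn u y = jn u' y"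
          unfolding U_def by blast
        then show "\<exists>e>0. \<forall>u. x \<le> u \<and> u \<le> x' \<and> \<bar>u - s\<bar> < e \<longrightarrow> (jn u y = jn x y) = (jn s y = jn x y)"
          by (intro exI[of _ e]) (metis abs_zero diff_self)
      qed (use * in auto)
      then show ?thesis by simp
    qed
    then show thesis using cd1 by (intro that[of c1 d1]) auto
  next
    case 2
    have "jn x y = jn x y'" if *: "c1 < x" "x < y" "y < y'" "y' < d1" for x y y'
    proof -
      have "jn x y' = jn x y"
      proof (rule locally_constant_imp_constant[OF eqd(2)])
        fix s assume "y \<le> s" "s \<le> y'"
        then have "V x s" using 2 * by auto
        then obtain e where "e > 0" "\<And>u u'. \<bar>u - s\<bar> < e \<Longrightarrow> \<bar>u' - s\<bar> < e \<Longrightarrow> jn x u = jn x u'"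
          unfolding V_def by blast
        then show "\<exists>e>0. \<forall>u. y \<le> u \<and> u \<le> y' \<and> \<bar>u - s\<bar> < e \<longrightarrow> (jn x u = jn x y) = (jn x s = jn x y)"
          by (intro exI[of _ e]) (metis abs_zero diff_self)
      qed (use * in auto)
      then show ?thesis by simp
    qed
    then show thesis using cd1 by (intro that[of c1 d1]) auto
  next
    case 3
    obtain c d where cd: "c1 \<le> c" "c < d" "d \<le> d1"
      and hP: "(\<forall>x y. c < x \<and> x < y \<and> y < d \<longrightarrow> P x y) \<or> (\<forall>x y. c < x \<and> x < y \<and> y < d \<longrightarrow> \<not> P x y)"
      and hQ: "(\<forall>x y. c < x \<and> x < y \<and> y < d \<longrightarrow> Q x y) \<or> (\<forall>x y. c < x \<and> x < y \<and> y < d \<longrightarrow> \<not> Q x y)"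
      by (rule pairs_homogeneous2[OF P Q cd1(2)])
    have inS: "x \<in> S" if "c < x" "x < d" for x using that sub cd cd1 by auto
    obtain m where m: "c < m" "m < d" using dense[OF cd(2)] by blast
    \<comment> \<open>By homogeneity one instance of \<open>P\<close> yields all of them. With the
      second argument fixed at \<open>m\<close>, the join would then be locally constant somewhere
      in the first, which the present case excludes.\<close>
    have nP: "\<not> P x y" if "c < x" "x < y" "y < d" for x y
    proof
      assume "P x y"
      with hP that have "\<forall>x y. c < x \<and> x < y \<and> y < d \<longrightarrow> P x y" by blast
      then have "\<exists>e>0. \<forall>u. \<bar>u - x\<bar> < e \<longrightarrow> le u (jn x m)" if "c < x" "x < m" for x
        using that m unfolding P_def by blast
      moreover have "{c<..<m} \<subseteq> S" "m \<in> S" using inS m by auto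
      ultimately obtain x where "c < x" "x < m" "U x m"
        using join_locally_constant[OF assms(1) le jn m(1), of m] unfolding U_def by blast
      then show False using 3(1) cd m by auto
    qed
    have nQ: "\<not> Q x y" if "c < x" "x < y" "y < d" for x y
    proof
      assume "Q x y"
      with hQ that have all: "\<forall>x y. c < x \<and> x < y \<and> y < d \<longrightarrow> Q x y" by blast
      have "\<exists>e>0. \<forall>u. \<bar>u - y\<bar> < e \<longrightarrow> le u (jn y m)" if y: "m < y" "y < d" for y
      proof -
        have "Q m y" using all m y by blast
        moreover have "jn m y = jn y m" using inS m y by (intro comm) auto
        ultimately show ?thesis unfolding Q_def by simp
      qed
      moreover have mS: "{m<..<d} \<subseteq> S" "m \<in> S" using inS m by auto
      ultimately obtain y e where y: "m < y" "y < d" "e > 0"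
        and eq: "\<And>u. \<bar>u - y\<bar> < e \<Longrightarrow> u \<in> S"
          "\<And>u u'. \<bar>u - y\<bar> < e \<Longrightarrow> \<bar>u' - y\<bar> < e \<Longrightarrow> jn u m = jn u' m"
        using join_locally_constant[OF assms(1) le jn m(2), of m] by blast
      have "jn m u = jn m u'" if "\<bar>u - y\<bar> < e" "\<bar>u' - y\<bar> < e" for u u'
        using eq(2)[OF that] comm[OF mS(2)] eq(1) that by metis
      then have "V m y" unfolding V_def using y(3) by blast
      then show False using 3(2) cd m y by auto
    qed
    \<comment> \<open>The non-interior points of the lower set of \<open>z\<close>. An interval of
      such points would consist of interior ones, so there are only finitely many between
      \<open>c\<close> and \<open>d\<close>.\<close>
    define B where "B z u \<longleftrightarrow> le u z \<and> \<not> (\<exists>e. e > 0 \<and> (\<forall>u'. \<bar>u' - u\<bar> < e \<longrightarrow> le u' z))" for z u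
    have B: "dfn M (\<lambda>v. B z (v 0))" for z unfolding B_def
      by (intro dfn_intros dft_intros dfn_app2[OF le])
    have finB: "finite {u. c < u \<and> u < d \<and> B z u}" for z
    proof (rule ccontr)
      assume "infinite {u. c < u \<and> u < d \<and> B z u}"
      from infinite_has_subinterval[OF B this] obtain p q
        where pq: "p < q" "\<And>u. p < u \<Longrightarrow> u < q \<Longrightarrow> B z u" by auto
      obtain u where u: "p < u" "u < q" using dense[OF pq(1)] by blast
      have "le u' z" if "\<bar>u' - u\<bar> < min (u - p) (q - u)" for u'
      proof -
        have "p < u'" "u' < q" using that by (auto simp: abs_less_iff)
        then show ?thesis using pq(2) by (simp add: B_def)
      qed
      moreover have "min (u - p) (q - u) > 0" using u by simp
      ultimately show False using pq(2)[OF u] unfolding B_def by blast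
    qed
    \<comment> \<open>Splitting at \<open>m\<close> makes every point of the box a pair with x <
      y.\<close>
    obtain z where z: "infinite {(x, y). c < x \<and> x < m \<and> m < y \<and> y < d \<and> jn x y = z}"
      using infinite_fibre[OF jn m] by blast
    have "{(x, y). c < x \<and> x < m \<and> m < y \<and> y < d \<and> jn x y = z} \<subseteq>
      {u. c < u \<and> u < d \<and> B z u} \<times> {u. c < u \<and> u < d \<and> B z u}"
    proof (intro subsetI, elim CollectE case_prodE conjE)
      fix w x y assume *: "w = (x, y)" "c < x" "x < m" "m < y" "y < d" "jn x y = z"
      then have "x \<in> S" "y \<in> S" using inS m by auto
      moreover have "\<not> P x y" "\<not> Q x y" using nP[of x y] nQ[of x y] * by auto
      ultimately have "B z x" "B z y" unfolding B_def P_def Q_def using ub1 ub2 * by auto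
      then show "w \<in> {u. c < u \<and> u < d \<and> B z u} \<times> {u. c < u \<and> u < d \<and> B z u}"
        using * m by auto
    qed
    moreover have "finite ({u. c < u \<and> u < d \<and> B z u} \<times> {u. c < u \<and> u < d \<and> B z u})"
      by (intro finite_cartesian_product finB)
    ultimately show thesis using z finite_subset by blast
  qed
qed

text \<open>Join and meet each depend only on the larger or only on the smaller argument. If it is
  the same argument for both, two distinct points have equal join and equal meet with a third, and
  distributivity identifies them. If not, \<open>le_by_join_meet\<close> orders all pairs in the
  same direction.\<close>

lemma generic_chain:
  fixes S :: "'a set" and le :: "'a \<Rightarrow> 'a \<Rightarrow> bool" and jn mt :: "'a \<Rightarrow> 'a \<Rightarrow> 'a"
  assumes "dist_lat S le jn mt bt tp" and le: "dfn2 M le"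
    and jn: "dft2 M jn" and mt: "dft2 M mt"
    and ab: "a < b" and sub: "{a<..<b} \<subseteq> S"
  obtains c d where "a \<le> c" "c < d" "d \<le> b"
    "(\<forall>x y. c < x \<and> x < y \<and> y < d \<longrightarrow> le x y) \<or> (\<forall>x y. c < x \<and> x < y \<and> y < d \<longrightarrow> le y x)"
proof -
  interpret dist_lat S le jn mt bt tp by fact
  obtain c1 d1 where cd1: "a \<le> c1" "c1 < d1" "d1 \<le> b"
    and join1: "(\<forall>x x' y. c1 < x \<and> x < x' \<and> x' < y \<and> y < d1 \<longrightarrow> jn x y = jn x' y) \<or>
     (\<forall>x y y'. c1 < x \<and> x < y \<and> y < y' \<and> y' < d1 \<longrightarrow> jn x y = jn x y')"
    by (rule generic_join[OF J.semilat_axioms le jn ab sub])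
  have ge: "dfn M (\<lambda>v. le (v (Suc 0)) (v 0))" by (intro dfn_app2[OF le] dft_intros)
  have "{c1<..<d1} \<subseteq> S" using sub cd1 by auto
  then obtain c d where cd: "c1 \<le> c" "c < d" "d \<le> d1"
    and meet: "(\<forall>x x' y. c < x \<and> x < x' \<and> x' < y \<and> y < d \<longrightarrow> mt x y = mt x' y) \<or>
     (\<forall>x y y'. c < x \<and> x < y \<and> y < y' \<and> y' < d \<longrightarrow> mt x y = mt x y')"
    by (rule generic_join[OF Mt.semilat_axioms ge mt cd1(2)])
  have up: "c1 < x" "x < d1" "x \<in> S" if "c < x" "x < d" for x
    using that cd cd1 sub by auto
  have join: "(\<forall>x x' y. c < x \<and> x < x' \<and> x' < y \<and> y < d \<longrightarrow> jn x y = jn x' y) \<or>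
     (\<forall>x y y'. c < x \<and> x < y \<and> y < y' \<and> y' < d \<longrightarrow> jn x y = jn x y')"
    using join1
  proof (elim disjE)
    assume *: "\<forall>x x' y. c1 < x \<and> x < x' \<and> x' < y \<and> y < d1 \<longrightarrow> jn x y = jn x' y"
    show ?thesis using cd by (intro disjI1 allI impI *[rule_format]) auto
  next
    assume *: "\<forall>x y y'. c1 < x \<and> x < y \<and> y < y' \<and> y' < d1 \<longrightarrow> jn x y = jn x y'"
    show ?thesis using cd by (intro disjI2 allI impI *[rule_format]) auto
  qed
  have cancel: "x = y" if xyz: "x \<in> S" "y \<in> S" "z \<in> S" "jn x z = jn y z" "mt x z = mt y z" for x y z
  proof (rule J.antisym)
    show "le x y"
    proof (rule le_by_join_meet[of z])
      show "le x (jn z y)" using J.ub1[of x z] xyz J.comm[of z y] by simp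
      show "le (mt z x) y" using Mt.ub1[of y z] xyz Mt.comm[of z x] by simp
    qed (use xyz in auto)
    show "le y x"
    proof (rule le_by_join_meet[of z])
      show "le y (jn z x)" using J.ub1[of y z] xyz J.comm[of z x] by simp
      show "le (mt z y) x" using Mt.ub1[of x z] xyz Mt.comm[of z y] by simp
    qed (use xyz in auto)
  qed (use xyz in auto)
  obtain p where p: "c < p" "p < d" using dense[OF cd(2)] by blast
  obtain q where q: "p < q" "q < d" using dense[OF p(2)] by blast
  obtain r where r: "q < r" "r < d" using dense[OF q(2)] by blast
  have pqr: "p \<in> S" "q \<in> S" "r \<in> S" using up p q r by auto
  from join meet show thesis
  proof (elim disjE)
    assume J1: "\<forall>x x' y. c < x \<and> x < x' \<and> x' < y \<and> y < d \<longrightarrow> jn x y = jn x' y"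
      and M1: "\<forall>x x' y. c < x \<and> x < x' \<and> x' < y \<and> y < d \<longrightarrow> mt x y = mt x' y"
    have "p = q" using J1 M1 p q r by (intro cancel[of p q r] pqr) auto
    then show thesis using q(1) by simp
  next
    assume J2: "\<forall>x y y'. c < x \<and> x < y \<and> y < y' \<and> y' < d \<longrightarrow> jn x y = jn x y'"
      and M2: "\<forall>x y y'. c < x \<and> x < y \<and> y < y' \<and> y' < d \<longrightarrow> mt x y = mt x y'"
    have "jn p q = jn p r" "mt p q = mt p r" using J2 M2 p q r by auto
    then have "jn q p = jn r p" "mt q p = mt r p" using pqr J.comm Mt.comm by metis+
    then have "q = r" by (intro cancel[of q r p] pqr)
    then show thesis using r(1) by simp
  next
    assume J1: "\<forall>x x' y. c < x \<and> x < x' \<and> x' < y \<and> y < d \<longrightarrow> jn x y = jn x' y"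
      and M2: "\<forall>x y y'. c < x \<and> x < y \<and> y < y' \<and> y' < d \<longrightarrow> mt x y = mt x y'"
    have "le y z" if yz: "c < y" "y < z" "z < d" for y z
    proof -
      \<comment> \<open>An auxiliary point to the left: the join with \<open>z\<close> is the same
        for \<open>x\<close> and \<open>y\<close>, and the meet with \<open>x\<close> is the same
        for \<open>y\<close> and \<open>z\<close>.\<close>
      obtain x where x: "c < x" "x < y" using dense[OF yz(1)] by blast
      have S: "x \<in> S" "y \<in> S" "z \<in> S" using up x yz by auto
      show ?thesis
      proof (rule le_by_join_meet[of x])
        show "le y (jn x z)" using J.ub1[of y z] J1 x yz S by auto
        show "le (mt x y) z" using Mt.ub2[of x z] M2 x yz S by auto
      qed (use S in auto)
    qed
    then show thesis using cd cd1 by (intro that[of c d]) auto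
  next
    assume J2: "\<forall>x y y'. c < x \<and> x < y \<and> y < y' \<and> y' < d \<longrightarrow> jn x y = jn x y'"
      and M1: "\<forall>x x' y. c < x \<and> x < x' \<and> x' < y \<and> y < d \<longrightarrow> mt x y = mt x' y"
    have "le y x" if xy: "c < x" "x < y" "y < d" for x y
    proof -
      obtain z where z: "y < z" "z < d" using dense[OF xy(3)] by blast
      have S: "x \<in> S" "y \<in> S" "z \<in> S" using up z xy by auto
      show ?thesis
      proof (rule le_by_join_meet[of z])
        have "jn z x = jn x y" using J2 J.comm[of z x] xy z S by auto
        then show "le y (jn z x)" using J.ub2[of x y] S by simp
        have "mt z y = mt x z" using M1 Mt.comm[of z y] xy z S by auto
        then show "le (mt z y) x" using Mt.ub1[of x z] S by simp
      qed (use S in auto)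
    qed
    then show thesis using cd cd1 by (intro that[of c d]) auto
  qed
qed

section \<open>From local to global chains\<close>

definition locally_chain :: "'a set \<Rightarrow> ('a \<Rightarrow> 'a \<Rightarrow> bool) \<Rightarrow> 'a \<Rightarrow> bool" where
  "locally_chain S R s \<longleftrightarrow> s \<in> S \<and>
    (\<exists>e. e > 0 \<and> (\<forall>u u'. \<bar>u - s\<bar> < e \<and> \<bar>u' - s\<bar> < e \<and> u < u' \<longrightarrow> u \<in> S \<and> u' \<in> S \<and> R u u'))"

lemma locally_chainI:
  fixes le :: "'a \<Rightarrow> 'a \<Rightarrow> bool"
  assumes "\<forall>x y. c < x \<and> x < y \<and> y < d \<longrightarrow> le x y" "{c<..<d} \<subseteq> S" "c < s" "s < d"
  shows "locally_chain S le s"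
proof -
  have "c < u \<and> u < d" if "\<bar>u - s\<bar> < min (s - c) (d - s)" for u
    using that by (auto simp: abs_less_iff)
  then have "\<forall>u u'. \<bar>u - s\<bar> < min (s - c) (d - s) \<and> \<bar>u' - s\<bar> < min (s - c) (d - s) \<and> u < u' \<longrightarrow>
      u \<in> S \<and> u' \<in> S \<and> le u u'"
    using assms(1,2) by (metis greaterThanLessThan_iff subsetD)
  moreover have "s \<in> S" using assms by auto
  moreover have "min (s - c) (d - s) > 0" using assms by simp
  ultimately show ?thesis unfolding locally_chain_def by blast
qed

text \<open>Transitivity carries comparability with \<open>x\<close> from one neighbourhood to the
  next. Definable connectedness makes this reach \<open>y\<close>, although finitely many
  neighbourhoods need not suffice to cover the segment.\<close>

lemma local_chain_imp_chain:
  fixes S :: "'a set" and le :: "'a \<Rightarrow> 'a \<Rightarrow> bool"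
  assumes le: "dfn2 M le"
    and refl: "\<And>x. x \<in> S \<Longrightarrow> le x x"
    and trans: "\<And>x y z. x \<in> S \<Longrightarrow> y \<in> S \<Longrightarrow> z \<in> S \<Longrightarrow> le x y \<Longrightarrow> le y z \<Longrightarrow> le x z"
    and loc: "\<And>s. x \<le> s \<Longrightarrow> s \<le> y \<Longrightarrow> locally_chain S le s"
    and xy: "x \<le> y"
  shows "le x y"
proof -
  have xS: "x \<in> S" using loc[of x] xy by (simp add: locally_chain_def)
  \<comment> \<open>Quantifying over the whole segment makes \<open>Q\<close> closed downwards,
    which is one half of its local constancy.\<close>
  define Q where "Q u \<longleftrightarrow> (\<forall>w. x \<le> w \<and> w \<le> u \<longrightarrow> le x w)" for u
  have "dfn1 M Q" unfolding Q_def
    by (intro dfn_intros dft_intros dfn_app2[OF le])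
  then have "Q y"
  proof (rule locally_constant_imp_constant[OF _ xy(1)])
    show "Q x" using refl xS by (auto simp: Q_def)
    fix s assume s: "x \<le> s" "s \<le> y"
    obtain e where e: "e > 0"
      "\<And>u u'. \<bar>u - s\<bar> < e \<Longrightarrow> \<bar>u' - s\<bar> < e \<Longrightarrow> u < u' \<Longrightarrow> u \<in> S \<and> u' \<in> S \<and> le u u'"
      using loc[OF s] unfolding locally_chain_def by blast
    have up: "Q u'" if u: "x \<le> u" "u < u'" "\<bar>u - s\<bar> < e" "\<bar>u' - s\<bar> < e" "Q u" for u u'
      unfolding Q_def
    proof (intro allI impI)
      fix w assume w: "x \<le> w \<and> w \<le> u'"
      show "le x w"
      proof (cases "w \<le> u")
        case False
        then have "\<bar>w - s\<bar> < e" using u w by (auto simp: abs_less_iff)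
        then have "u \<in> S \<and> w \<in> S \<and> le u w" using e(2)[of u w] u False by simp
        moreover have "le x u" using u by (simp add: Q_def)
        ultimately show ?thesis using trans xS by blast
      qed (use u w in \<open>simp add: Q_def\<close>)
    qed
    have down: "Q u" if "u \<le> u'" "Q u'" for u u' using that by (auto simp: Q_def)
    have "Q u = Q s" if u: "x \<le> u" "\<bar>u - s\<bar> < e" for u
    proof -
      have se: "\<bar>s - s\<bar> < e" using e(1) by simp
      consider "u < s" | "u = s" | "s < u" by (rule linorder_cases)
      then show ?thesis
      proof cases
        case 1
        have "Q u \<Longrightarrow> Q s" by (rule up[OF u(1) 1 u(2) se])
        moreover have "Q s \<Longrightarrow> Q u" using 1 by (intro down[of u s]) simp_all
        ultimately show ?thesis by blast
      next
        case 3
        have "Q s \<Longrightarrow> Q u" by (rule up[OF s(1) 3 se u(2)])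
        moreover have "Q u \<Longrightarrow> Q s" using 3 by (intro down[of s u]) simp_all
        ultimately show ?thesis by blast
      qed simp
    qed
    then show "\<exists>e>0. \<forall>u. x \<le> u \<and> u \<le> y \<and> \<bar>u - s\<bar> < e \<longrightarrow> Q u = Q s" using e(1) by blast
  qed
  then show ?thesis using xy by (simp add: Q_def)
qed

lemma dfn_piece:
  assumes "point_or_open_interval I"
  shows "dfn M (\<lambda>v. v 0 \<in> I)"
  using assms unfolding point_or_open_interval_def
proof (elim disjE exE)
  show ?thesis if "I = {a}" for a
    unfolding that by (simp, intro dfn_intros dft_intros)
  show ?thesis if "I = {a<..<b}" for a b
    unfolding that by (simp, intro dfn_intros dft_intros)
  show ?thesis if "I = {a<..}" for a
    unfolding that by (simp, intro dfn_intros dft_intros)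
  show ?thesis if "I = {..<b}" for b
    unfolding that by (simp, intro dfn_intros dft_intros)
  show ?thesis if "I = UNIV" unfolding that by (simp add: dfn_const)
qed

lemma piece_convex:
  assumes "point_or_open_interval I" "x \<in> I" "y \<in> I" "x \<le> s" "s \<le> y"
  shows "s \<in> I"
  using assms(1) unfolding point_or_open_interval_def
  by (elim disjE exE) (use assms in auto)

lemma locally_chain_pieces:
  fixes S :: "'a set" and le :: "'a \<Rightarrow> 'a \<Rightarrow> bool"
  assumes "semilat S le jn" and S: "dfn M (\<lambda>v. v 0 \<in> S)" and le: "dfn2 M le"
  obtains \<I> where "dfn M (\<lambda>v. locally_chain S le (v 0))" "finite \<I>" "\<Union>\<I> = {s. locally_chain S le s}"
    "\<And>I. I \<in> \<I> \<Longrightarrow> dfn M (\<lambda>v. v 0 \<in> I) \<and> (\<forall>x\<in>I. \<forall>y\<in>I. x < y \<longrightarrow> le x y)"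
proof -
  interpret semilat S le jn by fact
  have lc: "dfn M (\<lambda>v. locally_chain S le (v 0))" unfolding locally_chain_def
    by (intro dfn_intros dft_intros dfn_app2[OF le] dfn_app1[OF S])
  obtain \<I> where \<I>: "finite \<I>" "\<And>I. I \<in> \<I> \<Longrightarrow> point_or_open_interval I" "{s. locally_chain S le s} = \<Union>\<I>"
    using definable_pieces[OF lc] by blast
  have "dfn M (\<lambda>v. v 0 \<in> I) \<and> (\<forall>x\<in>I. \<forall>y\<in>I. x < y \<longrightarrow> le x y)" if I: "I \<in> \<I>" for I
  proof (intro conjI dfn_piece[OF \<I>(2)[OF I]] ballI impI)
    fix x y assume xy: "x \<in> I" "y \<in> I" "x < y"
    show "le x y"
    proof (rule local_chain_imp_chain[where le = le and S = S, OF le])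
      show "locally_chain S le s" if "x \<le> s" "s \<le> y" for s
        using piece_convex[OF \<I>(2)[OF I] xy(1,2) that] I \<I>(3) by blast
      show "le u u" if "u \<in> S" for u using that by (rule refl)
      show "le u w" if "u \<in> S" "z \<in> S" "w \<in> S" "le u z" "le z w" for u z w using that by (rule trans)
    qed (use xy in simp)
  qed
  then show thesis using lc \<I>(1) \<I>(3)[symmetric] by (intro that)
qed

text \<open>If infinitely many points of \<open>S\<close> were neither locally increasing nor
  locally decreasing, they would contain an interval, against \<open>generic_chain\<close>. The
  finitely many exceptions become one-point chains.\<close>

lemma chain_decomposition:
  fixes S :: "'a set" and le :: "'a \<Rightarrow> 'a \<Rightarrow> bool" and jn mt :: "'a \<Rightarrow> 'a \<Rightarrow> 'a"
  assumes "dist_lat S le jn mt bt tp" and S: "dfn M (\<lambda>v. v 0 \<in> S)" and le: "dfn2 M le"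
    and jn: "dft2 M jn" and mt: "dft2 M mt"
  shows "\<exists>\<I>. finite \<I> \<and> \<Union>\<I> = S \<and> (\<forall>I\<in>\<I>. dfn M (\<lambda>v. v 0 \<in> I) \<and>
    ((\<forall>x\<in>I. \<forall>y\<in>I. x < y \<longrightarrow> le x y) \<or> (\<forall>x\<in>I. \<forall>y\<in>I. x < y \<longrightarrow> le y x)))"
proof -
  interpret dist_lat S le jn mt bt tp by fact
  define inc where "inc = locally_chain S le"
  define dec where "dec = locally_chain S (\<lambda>x y. le y x)"
  have ge: "dfn M (\<lambda>v. le (v (Suc 0)) (v 0))" by (intro dfn_app2[OF le] dft_intros)
  obtain \<I> where inc: "dfn1 M inc" and \<I>: "finite \<I>" "\<Union>\<I> = {s. inc s}"
    and 1: "\<And>I. I \<in> \<I> \<Longrightarrow> dfn M (\<lambda>v. v 0 \<in> I) \<and> (\<forall>x\<in>I. \<forall>y\<in>I. x < y \<longrightarrow> le x y)"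
    unfolding inc_def by (rule locally_chain_pieces[OF J.semilat_axioms S le]) blast
  obtain \<J> where dec: "dfn1 M dec" and \<J>: "finite \<J>" "\<Union>\<J> = {s. dec s}"
    and 2: "\<And>I. I \<in> \<J> \<Longrightarrow> dfn M (\<lambda>v. v 0 \<in> I) \<and> (\<forall>x\<in>I. \<forall>y\<in>I. x < y \<longrightarrow> le y x)"
    unfolding dec_def by (rule locally_chain_pieces[OF Mt.semilat_axioms S ge]) blast
  have rest: "finite {x. x \<in> S \<and> \<not> inc x \<and> \<not> dec x}"
  proof (rule ccontr)
    assume inf: "infinite {x. x \<in> S \<and> \<not> inc x \<and> \<not> dec x}"
    have "dfn M (\<lambda>v. v 0 \<in> S \<and> \<not> inc (v 0) \<and> \<not> dec (v 0))" by (intro dfn_intros S inc dec)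
    from infinite_has_interval[OF this inf] obtain a b
      where ab: "a < b" and rest: "\<forall>x\<in>{a<..<b}. x \<in> S \<and> \<not> inc x \<and> \<not> dec x" by blast
    then have sub: "{a<..<b} \<subseteq> S" by blast
    obtain c d where cd: "a \<le> c" "c < d" "d \<le> b"
      and ch: "(\<forall>x y. c < x \<and> x < y \<and> y < d \<longrightarrow> le x y) \<or> (\<forall>x y. c < x \<and> x < y \<and> y < d \<longrightarrow> le y x)"
      by (rule generic_chain[OF assms(1) le jn mt ab sub])
    obtain s where s: "c < s" "s < d" using dense[OF cd(2)] by blast
    have "{c<..<d} \<subseteq> S" using sub cd by auto
    then have "inc s \<or> dec s" unfolding inc_def dec_def
      using ch locally_chainI[of c d le S s] locally_chainI[of c d "\<lambda>x y. le y x" S s] s by blast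
    moreover have "s \<in> {a<..<b}" using s cd by auto
    ultimately show False using rest by blast
  qed
  have 3: "dfn M (\<lambda>v. v 0 \<in> {x})" for x by (simp, intro dfn_intros dft_intros)
  let ?P = "(\<lambda>x. {x}) ` {x. x \<in> S \<and> \<not> inc x \<and> \<not> dec x}"
  have "\<Union>(\<I> \<union> \<J> \<union> ?P) = {x. inc x} \<union> {x. dec x} \<union> {x. x \<in> S \<and> \<not> inc x \<and> \<not> dec x}"
    using \<I>(2) \<J>(2) by auto
  also have "\<dots> = S" by (auto simp: inc_def dec_def locally_chain_def)
  finally have "\<Union>(\<I> \<union> \<J> \<union> ?P) = S" .
  moreover have "finite (\<I> \<union> \<J> \<union> ?P)" using \<I>(1) \<J>(1) rest by simp
  ultimately show ?thesis
    using 1 2 3 by (intro exI[of _ "\<I> \<union> \<J> \<union> ?P"]) auto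
qed

text \<open>
  A ray is given by its corner and three reals whose signs tell which of the two open half lines
  and of the corner itself belong to it.
\<close>

definition ray :: "'a \<Rightarrow> 'a \<Rightarrow> 'a \<Rightarrow> 'a \<Rightarrow> 'a \<Rightarrow> bool" where
  "ray t p q r x \<longleftrightarrow> x < t \<and> 0 < p \<or> x = t \<and> 0 < q \<or> t < x \<and> 0 < r"

text \<open>The corner of a proper nonempty segment is its supremum. Both sides are then decided and
  only membership of the corner itself is open, hence its separate sign.\<close>

lemma initial_segment_is_ray:
  assumes I: "dfn M (\<lambda>v. v 0 \<in> I)" and D: "dfn1 M D"
    and init: "\<And>x y. x \<in> I \<Longrightarrow> y \<in> I \<Longrightarrow> x < y \<Longrightarrow> D y \<Longrightarrow> D x"
  shows "\<exists>t p q r. \<forall>x\<in>I. D x \<longleftrightarrow> ray t p q r x"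
proof -
  consider "\<forall>x\<in>I. \<not> D x" | "\<forall>x\<in>I. D x" | u w where "u \<in> I" "D u" "w \<in> I" "\<not> D w" by blast
  then show ?thesis
  proof cases
    case 1
    then show ?thesis by (intro exI[of _ 0]) (simp add: ray_def)
  next
    case 2
    have "ray 0 1 1 1 x" for x by (simp add: ray_def, metis linorder_neqE)
    then show ?thesis using 2 by blast
  next
    case 3
    define T where "T x \<longleftrightarrow> x \<in> I \<and> D x" for x
    have "dfn1 M T" unfolding T_def by (intro dfn_intros I D)
    moreover have "T u" using 3 by (simp add: T_def)
    moreover have "y \<le> w" if "T y" for y using that 3 init[of w y] by (force simp: T_def)
    ultimately obtain t where t: "is_sup T t" using sup_exists[of T u w] by blast
    have "D x \<longleftrightarrow> ray t 1 (if D t then 1 else 0) 0 x" if x: "x \<in> I" for x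
    proof (cases x t rule: linorder_cases)
      case less
      then obtain y where "T y" "x < y" using is_sup_approx[OF t] by blast
      then have "D x" using init[OF x] by (auto simp: T_def)
      then show ?thesis using less by (simp add: ray_def)
    next
      case equal
      then show ?thesis by (simp add: ray_def)
    next
      case greater
      then have "\<not> T x" using t by (auto simp: is_sup_def)
      then show ?thesis using greater x by (simp add: ray_def T_def)
    qed
    then show ?thesis by blast
  qed
qed

text \<open>The complement is an initial segment, and flipping the three signs complements a
  ray.\<close>

lemma final_segment_is_ray:
  assumes I: "dfn M (\<lambda>v. v 0 \<in> I)" and D: "dfn1 M D"
    and fin: "\<And>x y. x \<in> I \<Longrightarrow> y \<in> I \<Longrightarrow> x < y \<Longrightarrow> D x \<Longrightarrow> D y"
  shows "\<exists>t p q r. \<forall>x\<in>I. D x \<longleftrightarrow> ray t p q r x"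
proof -
  have "\<exists>t p q r. \<forall>x\<in>I. \<not> D x \<longleftrightarrow> ray t p q r x"
    by (rule initial_segment_is_ray[OF I dfn_not[OF D]]) (use fin in blast)
  then obtain t p q r where r: "\<forall>x\<in>I. \<not> D x \<longleftrightarrow> ray t p q r x" by blast
  define flip :: "'a \<Rightarrow> 'a" where "flip z = (if 0 < z then 0 else 1)" for z
  have "ray t (flip p) (flip q) (flip r) x \<longleftrightarrow> \<not> ray t p q r x" for x
    unfolding ray_def flip_def by (cases x t rule: linorder_cases) auto
  then show ?thesis using r by blast
qed

text \<open>A down-set meets an increasing chain in an initial segment and a decreasing chain in a
  final one, so four reals per chain describe it. Only surjectivity is claimed: a down-set has many
  codes, and an arbitrary list need not decode to a down-set.\<close>

theorem downset_coding:
  fixes S :: "'a set" and le :: "'a \<Rightarrow> 'a \<Rightarrow> bool" and jn mt :: "'a \<Rightarrow> 'a \<Rightarrow> 'a"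
  assumes "dist_lat S le jn mt bt tp" and S: "dfn M (\<lambda>v. v 0 \<in> S)" and le: "dfn2 M le"
    and jn: "dft2 M jn" and mt: "dft2 M mt"
  obtains m and dec :: "'a list \<Rightarrow> 'a set"
  where "\<And>l t. dfl M m l \<Longrightarrow> dft M t \<Longrightarrow> dfn M (\<lambda>v. t v \<in> dec (l v))"
    and "\<And>D. D \<subseteq> S \<Longrightarrow> dfn M (\<lambda>v. v 0 \<in> D) \<Longrightarrow> \<forall>x\<in>D. \<forall>y\<in>S. le y x \<longrightarrow> y \<in> D \<Longrightarrow>
      \<exists>c. length c = m \<and> dec c = D"
proof -
  obtain \<I> where \<I>: "finite \<I>" "\<Union>\<I> = S" "\<And>I. I \<in> \<I> \<Longrightarrow> dfn M (\<lambda>v. v 0 \<in> I)"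
    "\<And>I. I \<in> \<I> \<Longrightarrow> (\<forall>x\<in>I. \<forall>y\<in>I. x < y \<longrightarrow> le x y) \<or> (\<forall>x\<in>I. \<forall>y\<in>I. x < y \<longrightarrow> le y x)"
    using chain_decomposition[OF assms] by blast
  obtain Is where Is: "set Is = \<I>" using finite_list[OF \<I>(1)] by blast
  define m where "m = 4 * length Is"
  define dec where "dec c = {x. \<exists>k<length Is. x \<in> Is ! k \<and>
    ray (c ! (4 * k)) (c ! (4 * k + 1)) (c ! (4 * k + 2)) (c ! (4 * k + 3)) x}" for c
  show thesis
  proof (rule that[of m dec])
    fix l t assume l: "dfl M m l" and t: "dft M t"
    have "dfn M (\<lambda>v. t v \<in> Is ! k)" if "k < length Is" for k
      using dfn_app1[OF \<I>(3) t] Is that by auto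
    moreover have "dft M (\<lambda>v. l v ! (4 * k + j))" if "k < length Is" "j < 4" for k j
      using that by (intro dfl_nth[OF l]) (simp add: m_def)
    from this[of _ 0] this[of _ 1] this[of _ 2] this[of _ 3]
    have "dft M (\<lambda>v. l v ! (4 * k))" "dft M (\<lambda>v. l v ! (4 * k + 1))" "dft M (\<lambda>v. l v ! (4 * k + 2))"
      "dft M (\<lambda>v. l v ! (4 * k + 3))" if "k < length Is" for k
      using that by simp_all
    ultimately show "dfn M (\<lambda>v. t v \<in> dec (l v))"
      unfolding dec_def mem_Collect_eq ray_def
      by (intro dfn_ex_less dfn_intros dft_const t)
  next
    fix D assume D: "D \<subseteq> S" "dfn M (\<lambda>v. v 0 \<in> D)" "\<forall>x\<in>D. \<forall>y\<in>S. le y x \<longrightarrow> y \<in> D"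
    have "\<exists>g. \<forall>x\<in>Is ! k. x \<in> D \<longleftrightarrow> ray (g 0) (g 1) (g 2) (g (3::nat)) x" if k: "k < length Is" for k
    proof -
      have I: "Is ! k \<in> \<I>" using k Is by auto
      then have sub: "Is ! k \<subseteq> S" using \<I>(2) by blast
      have "\<exists>t p q r. \<forall>x\<in>Is ! k. x \<in> D \<longleftrightarrow> ray t p q r x"
        using \<I>(4)[OF I]
      proof
        assume "\<forall>x\<in>Is ! k. \<forall>y\<in>Is ! k. x < y \<longrightarrow> le x y"
        then show ?thesis using D(3) sub by (intro initial_segment_is_ray[OF \<I>(3)[OF I] D(2)]) blast
      next
        assume "\<forall>x\<in>Is ! k. \<forall>y\<in>Is ! k. x < y \<longrightarrow> le y x"
        then show ?thesis using D(3) sub by (intro final_segment_is_ray[OF \<I>(3)[OF I] D(2)]) blast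
      qed
      then obtain t p q r where "\<forall>x\<in>Is ! k. x \<in> D \<longleftrightarrow> ray t p q r x" by blast
      then show ?thesis by (intro exI[of _ "nth [t, p, q, r]"]) (simp add: numeral_2_eq_2 numeral_3_eq_3)
    qed
    then obtain g where g: "\<And>k x. k < length Is \<Longrightarrow> x \<in> Is ! k \<Longrightarrow>
        x \<in> D \<longleftrightarrow> ray (g k 0) (g k 1) (g k 2) (g k (3::nat)) x" by metis
    define c where "c = map (\<lambda>j. g (j div 4) (j mod 4)) [0..<m]"
    have c: "c ! (4 * k) = g k 0" "c ! (4 * k + 1) = g k 1" "c ! (4 * k + 2) = g k 2" "c ! (4 * k + 3) = g k 3"
      if "k < length Is" for k
    proof -
      have "c ! (4 * k + j) = g k j" if "j < 4" for j
        using that \<open>k < length Is\<close> by (simp add: c_def m_def)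
      from this[of 0] this[of 1] this[of 2] this[of 3]
      show "c ! (4 * k) = g k 0" "c ! (4 * k + 1) = g k 1" "c ! (4 * k + 2) = g k 2" "c ! (4 * k + 3) = g k 3"
        by simp_all
    qed
    have "dec c = {x. \<exists>k<length Is. x \<in> Is ! k \<and> x \<in> D}"
      unfolding dec_def using c g by auto
    also have "\<dots> = D"
    proof -
      have "\<exists>k<length Is. x \<in> Is ! k" if "x \<in> D" for x
        using that D(1) \<I>(2) Is by (metis UnionE in_set_conv_nth subsetD)
      then show ?thesis by blast
    qed
    finally show "\<exists>c. length c = m \<and> dec c = D" by (intro exI[of _ c]) (simp add: c_def)
  qed
qed

end

section \<open>The Heyting algebra of definable ideals\<close>

context dist_lat
begin

text \<open>Closure under joins is what lets \<open>principal\<close> respect joins: the union of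
  two principal ideals need not be principal, whereas \<open>isup\<close> of them is. Requiring
  \<open>bt\<close> excludes the empty set and makes \<open>principal bt\<close> the least
  ideal.\<close>

definition ideal :: "'b set \<Rightarrow> bool" where
  "ideal D \<longleftrightarrow> D \<subseteq> S \<and> bt \<in> D \<and> (\<forall>x\<in>D. \<forall>y\<in>S. le y x \<longrightarrow> y \<in> D) \<and> (\<forall>x\<in>D. \<forall>y\<in>D. jn x y \<in> D)"

definition principal :: "'b \<Rightarrow> 'b set" where
  "principal x = {y \<in> S. le y x}"

definition isup :: "'b set \<Rightarrow> 'b set \<Rightarrow> 'b set" where
  "isup D E = {x \<in> S. \<exists>a\<in>D. \<exists>b\<in>E. le x (jn a b)}"

text \<open>For ideals, the largest ideal whose intersection with \<open>D\<close> is contained in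
  \<open>E\<close>, written without quantifying over ideals so that it stays first-order.\<close>

definition iimp :: "'b set \<Rightarrow> 'b set \<Rightarrow> 'b set" where
  "iimp D E = {x \<in> S. \<forall>y\<in>D. mt x y \<in> E}"

lemma idealD:
  assumes "ideal D"
  shows "x \<in> D \<Longrightarrow> x \<in> S" "bt \<in> D" "x \<in> D \<Longrightarrow> y \<in> S \<Longrightarrow> le y x \<Longrightarrow> y \<in> D"
    "x \<in> D \<Longrightarrow> y \<in> D \<Longrightarrow> jn x y \<in> D"
  using assms unfolding ideal_def by blast+

lemma ideal_principal: "x \<in> S \<Longrightarrow> ideal (principal x)"
  unfolding ideal_def principal_def by (auto intro: bt J.closed J.least J.trans)

lemma principal_inj: "x \<in> S \<Longrightarrow> y \<in> S \<Longrightarrow> principal x = principal y \<Longrightarrow> x = y"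
  unfolding principal_def by (intro J.antisym) (use J.refl in blast)+

lemma principal_bt: "principal bt = {bt}"
  unfolding principal_def using bt J.refl J.antisym by blast

lemma principal_tp: "principal tp = S"
  unfolding principal_def using tp by blast

lemma ideal_Int: "ideal D \<Longrightarrow> ideal E \<Longrightarrow> ideal (D \<inter> E)"
  unfolding ideal_def by blast

lemma ideal_isup:
  assumes D: "ideal D" and E: "ideal E"
  shows "ideal (isup D E)"
  unfolding ideal_def
proof (intro conjI ballI impI)
  show "isup D E \<subseteq> S" by (auto simp: isup_def)
  have "le bt (jn bt bt)" using bt J.closed by simp
  then show "bt \<in> isup D E" unfolding isup_def
    using idealD(2)[OF D] idealD(2)[OF E] bt(1) by blast
next
  fix x y assume xy: "x \<in> isup D E" "y \<in> S" "le y x"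
  then obtain a b where ab: "a \<in> D" "b \<in> E" "x \<in> S" "le x (jn a b)" unfolding isup_def by blast
  then have "jn a b \<in> S" using idealD(1)[OF D] idealD(1)[OF E] J.closed by blast
  then have "le y (jn a b)" using ab xy J.trans by blast
  then show "y \<in> isup D E" unfolding isup_def using ab xy by blast
next
  fix x y assume "x \<in> isup D E" "y \<in> isup D E"
  then obtain a b a' b' where ab: "a \<in> D" "b \<in> E" "a' \<in> D" "b' \<in> E"
    and xy: "x \<in> S" "y \<in> S" "le x (jn a b)" "le y (jn a' b')" unfolding isup_def by blast
  have S: "a \<in> S" "b \<in> S" "a' \<in> S" "b' \<in> S" using ab idealD(1)[OF D] idealD(1)[OF E] by auto
  have in_S: "jn a a' \<in> S" "jn b b' \<in> S" "jn (jn a a') (jn b b') \<in> S" using S by (auto intro: J.closed)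
  have "le (jn a b) (jn (jn a a') (jn b b'))" "le (jn a' b') (jn (jn a a') (jn b b'))"
    using S in_S by (auto intro!: J.mono J.ub1 J.ub2)
  then have "le x (jn (jn a a') (jn b b'))" "le y (jn (jn a a') (jn b b'))"
    using J.trans[OF _ J.closed in_S(3)] xy S by blast+
  then have "le (jn x y) (jn (jn a a') (jn b b'))" using xy in_S by (intro J.least)
  moreover have "jn a a' \<in> D" "jn b b' \<in> E" using ab idealD(4)[OF D] idealD(4)[OF E] by auto
  ultimately show "jn x y \<in> isup D E" unfolding isup_def using J.closed xy by blast
qed

lemma isup_upper: "ideal D \<Longrightarrow> ideal E \<Longrightarrow> D \<subseteq> isup D E" "ideal D \<Longrightarrow> ideal E \<Longrightarrow> E \<subseteq> isup D E"
  unfolding isup_def using idealD(1,2) J.ub1 J.ub2 by blast+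

lemma isup_least: "ideal F \<Longrightarrow> D \<subseteq> F \<Longrightarrow> E \<subseteq> F \<Longrightarrow> isup D E \<subseteq> F"
  unfolding isup_def using idealD(3,4) by blast

text \<open>Closure under joins is where distributivity enters: (x \<squnion> y) \<sqinter> z is the
  join of two elements of \<open>E\<close>.\<close>

lemma ideal_iimp:
  assumes D: "D \<subseteq> S" and E: "ideal E"
  shows "ideal (iimp D E)"
  unfolding ideal_def
proof (intro conjI ballI impI)
  show "iimp D E \<subseteq> S" by (auto simp: iimp_def)
  have "mt bt y \<in> E" if "y \<in> D" for y
    using that D bt Mt.ub1[of bt y] Mt.closed[of bt y] idealD(2,3)[OF E] by blast
  then show "bt \<in> iimp D E" using bt by (simp add: iimp_def)
next
  fix x y assume xy: "x \<in> iimp D E" "y \<in> S" "le y x"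
  then have x: "x \<in> S" by (simp add: iimp_def)
  have "mt y z \<in> E" if "z \<in> D" for z
  proof (rule idealD(3)[OF E])
    show "mt x z \<in> E" using xy that by (simp add: iimp_def)
    show "le (mt y z) (mt x z)" using that D x xy by (intro Mt.mono J.refl) auto
    show "mt y z \<in> S" using that D xy by (intro Mt.closed) auto
  qed
  then show "y \<in> iimp D E" using xy by (simp add: iimp_def)
next
  fix x y assume xy: "x \<in> iimp D E" "y \<in> iimp D E"
  then have S: "x \<in> S" "y \<in> S" by (auto simp: iimp_def)
  have "mt (jn x y) z \<in> E" if z: "z \<in> D" for z
  proof -
    have zS: "z \<in> S" using z D by blast
    have "mt (jn x y) z = jn (mt x z) (mt y z)"
      using S zS by (metis Mt.comm J.closed distr)
    then show ?thesis using xy z idealD(4)[OF E] by (simp add: iimp_def)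
  qed
  then show "jn x y \<in> iimp D E" using S J.closed by (simp add: iimp_def)
qed

text \<open>From left to right, the meet of an element of \<open>F\<close> with one of
  \<open>D\<close> lies in both ideals. From right to left, an element is its own meet with
  itself.\<close>

lemma Int_subset_iff_iimp:
  assumes D: "ideal D" and E: "ideal E" and F: "ideal F"
  shows "D \<inter> F \<subseteq> E \<longleftrightarrow> F \<subseteq> iimp D E"
proof
  assume sub: "D \<inter> F \<subseteq> E"
  show "F \<subseteq> iimp D E"
  proof
    fix x assume x: "x \<in> F"
    have "mt x y \<in> E" if y: "y \<in> D" for y
    proof -
      have S: "x \<in> S" "y \<in> S" using x y idealD(1) D F by auto
      then have "mt x y \<in> D" "mt x y \<in> F"
        using idealD(3)[OF D y] idealD(3)[OF F x] Mt.closed Mt.ub1 Mt.ub2 by auto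
      then show ?thesis using sub by blast
    qed
    then show "x \<in> iimp D E" using x idealD(1)[OF F] by (simp add: iimp_def)
  qed
next
  assume sub: "F \<subseteq> iimp D E"
  show "D \<inter> F \<subseteq> E"
  proof
    fix x assume x: "x \<in> D \<inter> F"
    then have "mt x x \<in> E" using sub by (auto simp: iimp_def)
    moreover have "le x (mt x x)" using x idealD(1)[OF D] by (intro Mt.least J.refl) auto
    ultimately show "x \<in> E" using idealD(3)[OF E] x idealD(1)[OF D] by blast
  qed
qed

text \<open>If x \<le> a \<squnion> b, then x \<le> (x \<sqinter> a) \<squnion> (x \<sqinter> b),
  and these two parts lie in \<open>D\<close> because \<open>x\<close> does.\<close>

lemma Int_isup_distrib:
  assumes D: "ideal D" and E: "ideal E" and F: "ideal F"
  shows "D \<inter> isup E F = isup (D \<inter> E) (D \<inter> F)"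
proof
  show "D \<inter> isup E F \<subseteq> isup (D \<inter> E) (D \<inter> F)"
  proof
    fix x assume "x \<in> D \<inter> isup E F"
    then obtain a b where x: "x \<in> D" "x \<in> S" "a \<in> E" "b \<in> F" "le x (jn a b)" unfolding isup_def by blast
    have S: "a \<in> S" "b \<in> S" using x idealD(1) E F by auto
    have "mt x a \<in> D \<inter> E" "mt x b \<in> D \<inter> F"
      using x S idealD(3)[OF D x(1)] idealD(3)[OF E x(3)] idealD(3)[OF F x(4)] Mt.closed Mt.ub1 Mt.ub2 by auto
    moreover have "le x (mt x (jn a b))" using x S by (intro Mt.least J.refl J.closed)
    then have "le x (jn (mt x a) (mt x b))" using x S by (simp add: distr)
    ultimately show "x \<in> isup (D \<inter> E) (D \<inter> F)" unfolding isup_def using x(2) by blast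
  qed
  have "isup (D \<inter> E) (D \<inter> F) \<subseteq> D" by (rule isup_least[OF D]) auto
  moreover have "isup (D \<inter> E) (D \<inter> F) \<subseteq> isup E F" unfolding isup_def by blast
  ultimately show "isup (D \<inter> E) (D \<inter> F) \<subseteq> D \<inter> isup E F" by blast
qed

lemma principal_jn: "x \<in> S \<Longrightarrow> y \<in> S \<Longrightarrow> principal (jn x y) = isup (principal x) (principal y)"
proof (intro equalityI subsetI)
  fix z assume xy: "x \<in> S" "y \<in> S" and "z \<in> principal (jn x y)"
  then show "z \<in> isup (principal x) (principal y)"
    unfolding principal_def isup_def using J.refl by blast
next
  fix z assume xy: "x \<in> S" "y \<in> S" and "z \<in> isup (principal x) (principal y)"
  then obtain a b where ab: "z \<in> S" "a \<in> S" "b \<in> S" "le a x" "le b y" "le z (jn a b)"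
    unfolding principal_def isup_def by blast
  then have "le (jn a b) (jn x y)" using xy by (intro J.mono)
  then show "z \<in> principal (jn x y)"
    unfolding principal_def using ab xy J.trans[of z "jn a b" "jn x y"] J.closed by blast
qed

lemma principal_mt:
  assumes "x \<in> S" "y \<in> S"
  shows "principal (mt x y) = principal x \<inter> principal y"
proof -
  have "le z (mt x y) \<longleftrightarrow> le z x \<and> le z y" if "z \<in> S" for z
    using that assms Mt.least[of x y z] J.trans[of z "mt x y" x] J.trans[of z "mt x y" y]
      Mt.closed Mt.ub1 Mt.ub2 by blast
  then show ?thesis by (auto simp: principal_def)
qed

end

section \<open>The Heyting algebra on codes\<close>

lemma (in partial_order) join_eqI: "least L z (Upper L {x, y}) \<Longrightarrow> x \<squnion> y = z"
  unfolding join_def sup_def by (rule some_equality) (auto intro: least_unique)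

lemma (in partial_order) meet_eqI: "greatest L z (Lower L {x, y}) \<Longrightarrow> x \<sqinter> y = z"
  unfolding meet_def inf_def by (rule some_equality) (auto intro: greatest_unique)

lemma (in partial_order) bottom_eqI: "least L z (carrier L) \<Longrightarrow> \<bottom> = z"
  unfolding bottom_def by (rule some_equality) (auto intro: least_unique)

lemma (in partial_order) top_eqI: "greatest L z (carrier L) \<Longrightarrow> \<top> = z"
  unfolding top_def by (rule some_equality) (auto intro: greatest_unique)

text \<open>Separates the algebra from definability: the image of \<open>C\<close> under
  \<open>dec\<close> stands for the definable ideals, known here only through closure properties.
  Injectivity makes inclusion of decoded ideals an antisymmetric order on codes.\<close>

locale coded_ideals = dist_lat S le jn mt bt tp
  for S :: "'b set" and le jn mt bt tp +
  fixes C :: "'c set" and dec :: "'c \<Rightarrow> 'b set"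
  assumes inj: "inj_on dec C"
    and ideals: "c \<in> C \<Longrightarrow> ideal (dec c)"
    and code_principal: "x \<in> S \<Longrightarrow> principal x \<in> dec ` C"
    and code_Int: "c \<in> C \<Longrightarrow> d \<in> C \<Longrightarrow> dec c \<inter> dec d \<in> dec ` C"
    and code_isup: "c \<in> C \<Longrightarrow> d \<in> C \<Longrightarrow> isup (dec c) (dec d) \<in> dec ` C"
    and code_iimp: "c \<in> C \<Longrightarrow> d \<in> C \<Longrightarrow> iimp (dec c) (dec d) \<in> dec ` C"
begin

definition K :: "'c gorder" where
  "K = \<lparr>carrier = C, eq = (=), le = (\<lambda>c d. dec c \<subseteq> dec d)\<rparr>"

lemma K_simps [simp]: "carrier K = C" "c \<sqsubseteq>\<^bsub>K\<^esub> d \<longleftrightarrow> dec c \<subseteq> dec d" "c .=\<^bsub>K\<^esub> d \<longleftrightarrow> c = d"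
  by (simp_all add: K_def)

lemma partial_order_K: "partial_order K"
proof
  show "x .=\<^bsub>K\<^esub> y" if "x \<sqsubseteq>\<^bsub>K\<^esub> y" "y \<sqsubseteq>\<^bsub>K\<^esub> x" "x \<in> carrier K" "y \<in> carrier K" for x y
    using that inj by (auto simp: inj_on_def)
qed (auto simp: K_def)

interpretation K: partial_order K by (rule partial_order_K)

lemma least_code:
  assumes "e \<in> C" "c \<in> C" "d \<in> C" "dec e = isup (dec c) (dec d)"
  shows "least K e (Upper K {c, d})"
proof (rule least_UpperI)
  show "x \<sqsubseteq>\<^bsub>K\<^esub> e" if "x \<in> {c, d}" for x
    using that assms isup_upper[of "dec c" "dec d"] ideals by auto
  show "e \<sqsubseteq>\<^bsub>K\<^esub> y" if "y \<in> Upper K {c, d}" for y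
  proof -
    have y: "y \<in> C" "dec c \<subseteq> dec y" "dec d \<subseteq> dec y" using that assms by (auto simp: Upper_def)
    then have "isup (dec c) (dec d) \<subseteq> dec y" by (intro isup_least ideals)
    then show ?thesis using assms(4) by simp
  qed
qed (use assms in auto)

lemma greatest_code: "e \<in> C \<Longrightarrow> c \<in> C \<Longrightarrow> d \<in> C \<Longrightarrow> dec e = dec c \<inter> dec d \<Longrightarrow> greatest K e (Lower K {c, d})"
  by (auto simp: greatest_def Lower_def)

lemma bot_code: "e \<in> C \<Longrightarrow> dec e = {bt} \<Longrightarrow> least K e (carrier K)"
  using ideals idealD(2) by (auto simp: least_def)

lemma top_code: "e \<in> C \<Longrightarrow> dec e = S \<Longrightarrow> greatest K e (carrier K)"
  using ideals idealD(1) by (auto simp: greatest_def)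

lemma lattice_K: "lattice K"
proof
  fix c d assume "c \<in> carrier K" "d \<in> carrier K"
  then have cd: "c \<in> C" "d \<in> C" by simp_all
  obtain e where e: "e \<in> C" "isup (dec c) (dec d) = dec e" using code_isup[OF cd] by blast
  show "\<exists>s. least K s (Upper K {c, d})" using least_code[OF e(1) cd e(2)[symmetric]] by blast
  obtain e' where e': "e' \<in> C" "dec c \<inter> dec d = dec e'" using code_Int[OF cd] by blast
  show "\<exists>s. greatest K s (Lower K {c, d})" using greatest_code[OF e'(1) cd e'(2)[symmetric]] by blast
qed

lemma join_K:
  assumes "c \<in> C" "d \<in> C"
  shows "c \<squnion>\<^bsub>K\<^esub> d \<in> C" "dec (c \<squnion>\<^bsub>K\<^esub> d) = isup (dec c) (dec d)"
proof -
  obtain e where e: "e \<in> C" "isup (dec c) (dec d) = dec e" using code_isup[OF assms] by blast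
  then have "c \<squnion>\<^bsub>K\<^esub> d = e" using assms by (intro K.join_eqI least_code) auto
  then show "c \<squnion>\<^bsub>K\<^esub> d \<in> C" "dec (c \<squnion>\<^bsub>K\<^esub> d) = isup (dec c) (dec d)" using e by auto
qed

lemma meet_K:
  assumes "c \<in> C" "d \<in> C"
  shows "c \<sqinter>\<^bsub>K\<^esub> d \<in> C" "dec (c \<sqinter>\<^bsub>K\<^esub> d) = dec c \<inter> dec d"
proof -
  obtain e where e: "e \<in> C" "dec c \<inter> dec d = dec e" using code_Int[OF assms] by blast
  then have "c \<sqinter>\<^bsub>K\<^esub> d = e" using assms by (intro K.meet_eqI greatest_code) auto
  then show "c \<sqinter>\<^bsub>K\<^esub> d \<in> C" "dec (c \<sqinter>\<^bsub>K\<^esub> d) = dec c \<inter> dec d" using e by auto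
qed

lemma bottom_K: "e \<in> C \<Longrightarrow> dec e = {bt} \<Longrightarrow> \<bottom>\<^bsub>K\<^esub> = e"
  by (intro K.bottom_eqI bot_code)

lemma top_K: "e \<in> C \<Longrightarrow> dec e = S \<Longrightarrow> \<top>\<^bsub>K\<^esub> = e"
  by (intro K.top_eqI top_code)

lemma heyting_K: "heyting_algebra K"
  unfolding heyting_algebra_def bounded_distrib_lattice_def
proof (intro conjI ballI)
  interpret lattice K by (rule lattice_K)
  obtain e where e: "e \<in> C" "dec e = {bt}" using code_principal[OF bt(1)] by (auto simp: principal_bt)
  obtain f where f: "f \<in> C" "dec f = S" using code_principal[OF tp(1)] by (auto simp: principal_tp)
  show "bounded_lattice K"
    by unfold_locales (use bot_code[OF e] top_code[OF f] in auto)
  show "x \<sqinter>\<^bsub>K\<^esub> (y \<squnion>\<^bsub>K\<^esub> z) = (x \<sqinter>\<^bsub>K\<^esub> y) \<squnion>\<^bsub>K\<^esub> (x \<sqinter>\<^bsub>K\<^esub> z)"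
    if "x \<in> carrier K" "y \<in> carrier K" "z \<in> carrier K" for x y z
    using that by (intro inj_onD[OF inj]) (simp_all add: join_K meet_K Int_isup_distrib ideals)
  show "\<exists>m. greatest K m {z \<in> carrier K. x \<sqinter>\<^bsub>K\<^esub> z \<sqsubseteq>\<^bsub>K\<^esub> y}"
    if "x \<in> carrier K" "y \<in> carrier K" for x y
  proof -
    have "iimp (dec x) (dec y) \<in> dec ` C" using that by (intro code_iimp) simp_all
    then obtain m where m: "m \<in> C" "dec m = iimp (dec x) (dec y)" by auto
    \<comment> \<open>By the adjunction, the candidates for the implication are the codes below that
      of \<open>iimp\<close>, which is itself one of them.\<close>
    have "{z \<in> carrier K. x \<sqinter>\<^bsub>K\<^esub> z \<sqsubseteq>\<^bsub>K\<^esub> y} = {z \<in> C. dec z \<subseteq> iimp (dec x) (dec y)}"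
      using that by (intro Collect_cong) (simp add: meet_K Int_subset_iff_iimp ideals cong: conj_cong)
    then have "greatest K m {z \<in> carrier K. x \<sqinter>\<^bsub>K\<^esub> z \<sqsubseteq>\<^bsub>K\<^esub> y}"
      using m by (simp add: greatest_def)
    then show ?thesis by blast
  qed
qed

end

section \<open>The definable embedding\<close>

lemma dfl_append:
  assumes "dfl M m k" "dfl M n l"
  shows "dfl M (m + n) (\<lambda>v. k v @ l v)"
proof -
  have "dft M (\<lambda>v. (k v @ l v) ! i)" if "i < m + n" for i
    using that assms by (cases "i < m") (simp_all add: dfl_def nth_append)
  then show ?thesis using assms by (simp add: dfl_def)
qed

lemma definable_relD:
  fixes M :: "('f, 'r, 'a::linordered_field) fo_structure" and P :: "'a list \<Rightarrow> 'a list \<Rightarrow> bool"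
  assumes G: "definable M (n + n) {xs @ ys |xs ys. P xs ys}" and len: "\<And>xs ys. P xs ys \<Longrightarrow> length xs = n"
    and k: "dfl M n k" and l: "dfl M n l"
  shows "dfn M (\<lambda>v. P (k v) (l v))"
proof (rule dfn_cong[OF dfn_mem[OF G dfl_append[OF k l]]])
  fix v
  show "(k v @ l v \<in> {xs @ ys |xs ys. P xs ys}) = P (k v) (l v)"
  proof
    assume "k v @ l v \<in> {xs @ ys |xs ys. P xs ys}"
    then obtain xs ys where *: "k v @ l v = xs @ ys" "P xs ys" by blast
    then have "k v = xs \<and> l v = ys" using len dfl_length[OF k, of v] by (simp add: append_eq_append_conv)
    then show "P (k v) (l v)" using * by simp
  qed blast
qed

context omin_structure
begin

theorem one_dimensional_lattice_embeds:
  fixes H :: "'a list gorder"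
  assumes bdl: "bounded_distrib_lattice H" and def: "definable_order M n H" and dim: "o_dim M (carrier H) = 1"
  shows "\<exists>m K h. heyting_algebra K \<and> definable_order M m K \<and> definable_embedding M n H m K h"
proof -
  interpret H: bounded_lattice H using bdl by (simp add: bounded_distrib_lattice_def)
  have X: "definable M n (carrier H)" using def by (simp add: definable_order_def)
  obtain \<phi> where \<phi>: "dfl1 M n \<phi>" and range: "carrier H \<subseteq> range \<phi>"
    using one_dimensional_imp_thin[OF X dim] unfolding thin_def by blast
  \<comment> \<open>The chosen parameter depends only on the point, so \<open>\<iota>\<close> is a
    definable section of \<open>\<phi>\<close> over the lattice, and its values form a copy of the
    lattice inside the line.\<close>
  define \<iota> where "\<iota> xs = ch (\<lambda>u. \<phi> u = xs)" for xs
  have \<iota>: "dft M (\<lambda>v. \<iota> (l v))" if l: "dfl M n l" for l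
    unfolding \<iota>_def by (intro dft_ch dfn_list_eq[OF dfl_app1[OF \<phi>] dfl_ren[OF l]] dft_intros)
  have \<phi>_\<iota>: "\<phi> (\<iota> xs) = xs" if xs: "xs \<in> carrier H" for xs
  proof -
    obtain t where t: "xs = \<phi> t" using subsetD[OF range xs] by (rule rangeE)
    have "dfn M (\<lambda>v. \<phi> (v 0) = \<phi> t)"
      by (intro dfn_list_eq[OF \<phi> dfl_app1[OF \<phi>]] dft_intros)
    then show ?thesis unfolding \<iota>_def t by (rule ch_in) simp
  qed
  define S where "S = {t. \<phi> t \<in> carrier H \<and> t = \<iota> (\<phi> t)}"
  have S: "dfn M (\<lambda>v. v 0 \<in> S)" unfolding S_def mem_Collect_eq
    by (intro dfn_intros dfn_mem[OF X] \<phi> \<iota> dft_intros)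
  have \<phi>_S: "\<phi> t \<in> carrier H" "\<iota> (\<phi> t) = t" if "t \<in> S" for t
    using that by (auto simp: S_def)
  have \<iota>_S: "\<iota> xs \<in> S" if "xs \<in> carrier H" for xs
    using that \<phi>_\<iota> by (simp add: S_def)
  have \<phi>_eqD: "s = t" if "s \<in> S" "t \<in> S" "\<phi> s = \<phi> t" for s t
    by (rule trans[OF \<phi>_S(2)[OF that(1), symmetric] trans[OF arg_cong[OF that(3), of \<iota>] \<phi>_S(2)[OF that(2)]]])
  \<comment> \<open>Membership in the carrier is built in, because the order is given as definable
    only between elements of \<open>H\<close>.\<close>
  define les where "les s t \<longleftrightarrow> \<phi> s \<in> carrier H \<and> \<phi> t \<in> carrier H \<and> \<phi> s \<sqsubseteq>\<^bsub>H\<^esub> \<phi> t" for s t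
  have les: "dfn2 M les"
    unfolding les_def
  proof (rule definable_relD[where P = "\<lambda>xs ys. xs \<in> carrier H \<and> ys \<in> carrier H \<and> xs \<sqsubseteq>\<^bsub>H\<^esub> ys"])
    show "definable M (n + n) {xs @ ys |xs ys. xs \<in> carrier H \<and> ys \<in> carrier H \<and> xs \<sqsubseteq>\<^bsub>H\<^esub> ys}"
      using def by (simp add: definable_order_def)
    show "length xs = n" if "xs \<in> carrier H \<and> ys \<in> carrier H \<and> xs \<sqsubseteq>\<^bsub>H\<^esub> ys" for xs ys
      using that X unfolding definable_iff_dfn by blast
  qed (intro \<phi> dfl_app1[OF \<phi>] dft_intros)+
  have les_S: "les s t \<longleftrightarrow> \<phi> s \<sqsubseteq>\<^bsub>H\<^esub> \<phi> t" if "s \<in> S" "t \<in> S" for s t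
    using that \<phi>_S by (simp add: les_def)
  have les_antisym: "s = t" if "s \<in> S" "t \<in> S" "les s t" "les t s" for s t
    using that by (intro \<phi>_eqD H.le_antisym \<phi>_S(1)) (simp_all add: les_S)
  \<comment> \<open>Join and meet are pinned down by their first-order characterisations;
    \<open>ch\<close> then returns the unique witness on \<open>S\<close> and some definable value
    elsewhere.\<close>
  define J where "J s t z \<longleftrightarrow> z \<in> S \<and> les s z \<and> les t z \<and> (\<forall>w. w \<in> S \<and> les s w \<and> les t w \<longrightarrow> les z w)" for s t z
  define N where "N s t z \<longleftrightarrow> z \<in> S \<and> les z s \<and> les z t \<and> (\<forall>w. w \<in> S \<and> les w s \<and> les w t \<longrightarrow> les w z)" for s t z
  define jn where "jn s t = ch (J s t)" for s t
  define mt where "mt s t = ch (N s t)" for s t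
  have jn: "dft2 M jn" and mt: "dft2 M mt"
    unfolding jn_def mt_def J_def N_def
    by (intro dft_ch dfn_intros dft_intros dfn_app2[OF les] dfn_app1[OF S])+
  have jn_eq: "jn s t = \<iota> (\<phi> s \<squnion>\<^bsub>H\<^esub> \<phi> t)" if st: "s \<in> S" "t \<in> S" for s t
  proof -
    let ?z = "\<iota> (\<phi> s \<squnion>\<^bsub>H\<^esub> \<phi> t)"
    have c: "\<phi> s \<in> carrier H" "\<phi> t \<in> carrier H" "\<phi> s \<squnion>\<^bsub>H\<^esub> \<phi> t \<in> carrier H"
      using \<phi>_S(1) st by auto
    have z: "?z \<in> S" "\<phi> ?z = \<phi> s \<squnion>\<^bsub>H\<^esub> \<phi> t" using c \<iota>_S \<phi>_\<iota> by auto
    have "les s ?z" "les t ?z" using c z H.join_left H.join_right by (auto simp: les_def)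
    moreover have "les ?z w" if "w \<in> S" "les s w" "les t w" for w
      using that c z H.join_le by (simp add: les_def)
    ultimately have Jz: "J s t ?z" using z(1) by (simp add: J_def)
    have "dfn M (\<lambda>v. J s t (v 0))" unfolding J_def
      by (intro dfn_intros dft_intros dfn_app2[OF les] dfn_app1[OF S])
    then have "J s t (jn s t)" unfolding jn_def using Jz by (rule ch_in)
    then show ?thesis using Jz unfolding J_def by (intro les_antisym) auto
  qed
  have mt_eq: "mt s t = \<iota> (\<phi> s \<sqinter>\<^bsub>H\<^esub> \<phi> t)" if st: "s \<in> S" "t \<in> S" for s t
  proof -
    let ?z = "\<iota> (\<phi> s \<sqinter>\<^bsub>H\<^esub> \<phi> t)"
    have c: "\<phi> s \<in> carrier H" "\<phi> t \<in> carrier H" "\<phi> s \<sqinter>\<^bsub>H\<^esub> \<phi> t \<in> carrier H"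
      using \<phi>_S(1) st by auto
    have z: "?z \<in> S" "\<phi> ?z = \<phi> s \<sqinter>\<^bsub>H\<^esub> \<phi> t" using c \<iota>_S \<phi>_\<iota> by auto
    have "les ?z s" "les ?z t" using c z H.meet_left H.meet_right by (auto simp: les_def)
    moreover have "les w ?z" if "w \<in> S" "les w s" "les w t" for w
      using that c z H.meet_le by (simp add: les_def)
    ultimately have Nz: "N s t ?z" using z(1) by (simp add: N_def)
    have "dfn M (\<lambda>v. N s t (v 0))" unfolding N_def
      by (intro dfn_intros dft_intros dfn_app2[OF les] dfn_app1[OF S])
    then have "N s t (mt s t)" unfolding mt_def using Nz by (rule ch_in)
    then show ?thesis using Nz unfolding N_def by (intro les_antisym) auto
  qed
  have jn_S: "jn s t \<in> S" "\<phi> (jn s t) = \<phi> s \<squnion>\<^bsub>H\<^esub> \<phi> t" if "s \<in> S" "t \<in> S" for s t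
    using that \<phi>_S(1) \<phi>_\<iota> \<iota>_S by (auto simp: jn_eq)
  have mt_S: "mt s t \<in> S" "\<phi> (mt s t) = \<phi> s \<sqinter>\<^bsub>H\<^esub> \<phi> t" if "s \<in> S" "t \<in> S" for s t
    using that \<phi>_S(1) \<phi>_\<iota> \<iota>_S by (auto simp: mt_eq)
  define bt tp where "bt = \<iota> \<bottom>\<^bsub>H\<^esub>" and "tp = \<iota> \<top>\<^bsub>H\<^esub>"
  have dl: "dist_lat S les jn mt bt tp"
  proof
    show "les s s" if "s \<in> S" for s using that \<phi>_S(1) by (simp add: les_S)
    show "les s u" if "s \<in> S" "t \<in> S" "u \<in> S" "les s t" "les t u" for s t u
      using that \<phi>_S(1) H.le_trans[of "\<phi> s" "\<phi> t" "\<phi> u"] by (simp add: les_S)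
    then show "les u s" if "s \<in> S" "t \<in> S" "u \<in> S" "les t s" "les u t" for s t u
      using that by blast
    show "les s (jn s t)" "les t (jn s t)" if "s \<in> S" "t \<in> S" for s t
      using that jn_S \<phi>_S(1) H.join_left H.join_right by (simp_all add: les_S)
    show "les (mt s t) s" "les (mt s t) t" if "s \<in> S" "t \<in> S" for s t
      using that mt_S \<phi>_S(1) H.meet_left H.meet_right by (simp_all add: les_S)
    show "les (jn s t) u" if "s \<in> S" "t \<in> S" "u \<in> S" "les s u" "les t u" for s t u
      using that jn_S \<phi>_S(1) H.join_le by (simp add: les_S)
    show "les u (mt s t)" if "s \<in> S" "t \<in> S" "u \<in> S" "les u s" "les u t" for s t u
      using that mt_S \<phi>_S(1) H.meet_le by (simp add: les_S)
    show "mt s (jn t u) = jn (mt s t) (mt s u)" if "s \<in> S" "t \<in> S" "u \<in> S" for s t u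
      using that jn_S mt_S \<phi>_S(1) bdl unfolding bounded_distrib_lattice_def
      by (intro \<phi>_eqD) simp_all
    show "bt \<in> S" "tp \<in> S" unfolding bt_def tp_def by (intro \<iota>_S H.bottom_closed H.top_closed)+
    show "les bt s" "les s tp" if "s \<in> S" for s
      using that \<phi>_S(1) by (simp_all add: les_def bt_def tp_def \<phi>_\<iota>)
  qed (use les_antisym jn_S mt_S in blast)+
  interpret dist_lat S les jn mt bt tp by (rule dl)
  obtain m and dec :: "'a list \<Rightarrow> 'a set" where
    dec: "\<And>l t. dfl M m l \<Longrightarrow> dft M t \<Longrightarrow> dfn M (\<lambda>v. t v \<in> dec (l v))"
    and surj: "\<And>D. D \<subseteq> S \<Longrightarrow> dfn M (\<lambda>v. v 0 \<in> D) \<Longrightarrow> \<forall>x\<in>D. \<forall>y\<in>S. les y x \<longrightarrow> y \<in> D \<Longrightarrow>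
      \<exists>c. length c = m \<and> dec c = D"
    by (rule downset_coding[OF dl S les jn mt]) blast
  \<comment> \<open>The codes of a definable ideal form a definable set, and choosing from it gives
    one code per ideal; \<open>C\<close> collects exactly these. Without this selection the order on
    codes would not be antisymmetric.\<close>
  define enc where "enc D = chl m (\<lambda>c. dec c = D)" for D
  define C where "C = {c. length c = m \<and> ideal (dec c) \<and> c = enc (dec c)}"
  have enc: "enc D \<in> C" "dec (enc D) = D" if D: "ideal D" "dfn M (\<lambda>v. v 0 \<in> D)" for D
  proof -
    have "D \<subseteq> S" using idealD(1)[OF D(1)] by blast
    moreover have "\<forall>x\<in>D. \<forall>y\<in>S. les y x \<longrightarrow> y \<in> D" using idealD(3)[OF D(1)] by blast
    ultimately obtain c where c: "length c = m" "dec c = D" using surj[OF _ D(2)] by blast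
    have "dfn M (\<lambda>v. dec (map v [0..<m]) = D)" unfolding set_eq_iff
      by (intro dfn_intros dec dfl_map_env_shift dft_intros dfn_app1[OF D(2)])
    then show "dec (enc D) = D" unfolding enc_def using c by (rule chl_in)
    then show "enc D \<in> C" using D(1) by (simp add: C_def) (simp add: enc_def)
  qed
  have encI: "D \<in> dec ` C" if "ideal D" "dfn M (\<lambda>v. v 0 \<in> D)" for D
    using enc[OF that] by (metis imageI)
  have dfn_dec: "dfn M (\<lambda>v. v 0 \<in> dec c)" if "c \<in> C" for c
    using that by (intro dec dfl_const dft_intros) (simp add: C_def)
  have ideal_dec: "ideal (dec c)" if "c \<in> C" for c using that by (simp add: C_def)
  have dfn_principal: "dfn M (\<lambda>v. v 0 \<in> principal x)" for x
    unfolding principal_def mem_Collect_eq by (intro dfn_intros S dfn_app2[OF les] dft_intros)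
  interpret coded_ideals S les jn mt bt tp C dec
  proof
    show "inj_on dec C"
    proof (rule inj_onI)
      fix c d assume cd: "c \<in> C" "d \<in> C" "dec c = dec d"
      then have "c = enc (dec c)" "d = enc (dec d)" unfolding C_def by blast+
      with cd(3) show "c = d" by argo
    qed
    show "ideal (dec c)" if "c \<in> C" for c by (rule ideal_dec[OF that])
    show "principal x \<in> dec ` C" if "x \<in> S" for x
      using that by (intro encI ideal_principal dfn_principal)
    fix c d assume cd: "c \<in> C" "d \<in> C"
    then have sub: "dec c \<subseteq> S" using idealD(1)[OF ideal_dec] by blast
    show "dec c \<inter> dec d \<in> dec ` C"
    proof (intro encI ideal_Int ideal_dec cd)
      show "dfn M (\<lambda>v. v 0 \<in> dec c \<inter> dec d)"
        unfolding Int_iff by (intro dfn_intros dfn_dec cd)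
    qed
    show "isup (dec c) (dec d) \<in> dec ` C"
    proof (intro encI ideal_isup ideal_dec cd)
      show "dfn M (\<lambda>v. v 0 \<in> isup (dec c) (dec d))"
        unfolding isup_def mem_Collect_eq Bex_def
        by (intro dfn_intros S dfn_app1[OF dfn_dec] cd dfn_app2[OF les] dft_app2[OF jn] dft_intros)
    qed
    show "iimp (dec c) (dec d) \<in> dec ` C"
    proof (intro encI ideal_iimp ideal_dec cd sub)
      show "dfn M (\<lambda>v. v 0 \<in> iimp (dec c) (dec d))"
        unfolding iimp_def mem_Collect_eq Ball_def
        by (intro dfn_intros S dfn_app1[OF dfn_dec] cd dft_app2[OF mt] dft_intros)
    qed
  qed
  have C_length: "length c = m" if "c \<in> C" for c using that by (simp add: C_def)
  have dfn_C: "dfn M (\<lambda>v. l v \<in> C)" if l: "dfl M m l" for l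
  proof -
    have "dfl M m (\<lambda>v. enc (dec (l v)))" unfolding enc_def set_eq_iff
      by (intro dfl_chl dfn_intros dec dfl_map_env_shift dfl_ren[OF l] dft_intros)
    then have "dfn M (\<lambda>v. ideal (dec (l v)) \<and> l v = enc (dec (l v)))"
      unfolding ideal_def subset_iff Ball_def
      by (intro dfn_intros dfn_list_eq[OF l] dec[OF l] dec[OF dfl_ren[OF l]] dfn_app1[OF S] dfn_app2[OF les]
          dft_app2[OF jn] dft_intros)
    then show ?thesis by (rule dfn_cong) (simp add: C_def dfl_length[OF l])
  qed
  have "definable_order M m K"
    unfolding definable_order_def K_simps
  proof
    show "definable M m C" using dfn_C[OF dfl_map_env] C_length by (intro definableI)
    show "definable M (m + m) {xs @ ys |xs ys. xs \<in> C \<and> ys \<in> C \<and> dec xs \<subseteq> dec ys}"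
    proof (rule definable_relI)
      show "dfn M (\<lambda>v. map v [0..<m] \<in> C \<and> map (\<lambda>i. v (i + m)) [0..<m] \<in> C \<and>
          dec (map v [0..<m]) \<subseteq> dec (map (\<lambda>i. v (i + m)) [0..<m]))"
        unfolding subset_iff
        by (intro dfn_intros dfn_C dec dfl_map_env dfl_map_env_shift dft_intros)
    qed (use C_length in auto)
  qed
  moreover define h where "h xs = enc (principal (\<iota> xs))" for xs
  have h: "h xs \<in> C" "dec (h xs) = principal (\<iota> xs)" if "xs \<in> carrier H" for xs
    unfolding h_def using enc[OF ideal_principal[OF \<iota>_S[OF that]] dfn_principal] by simp_all
  have h_eq: "h xs = c" if "xs \<in> carrier H" "c \<in> C" "dec c = principal (\<iota> xs)" for xs c
    using h[OF that(1)] that(2,3) by (intro inj_onD[OF inj]) auto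
  have "definable_embedding M n H m K h"
    unfolding definable_embedding_def
  proof (intro conjI)
    \<comment> \<open>\<open>dfl_chl\<close> reads the candidate code from the first
      \<open>m\<close> entries, so the argument of \<open>h\<close> is taken from the entries after
      them.\<close>
    have "dfn M (\<lambda>v. dec (map v [0..<m]) = principal (\<iota> (map (\<lambda>i. v (i + m)) [0..<n])))"
      unfolding set_eq_iff principal_def mem_Collect_eq
      by (intro dfn_intros dec dfl_map_env_shift dfn_app1[OF S] dfn_app2[OF les] \<iota> dft_intros)
    then have "dfl M m (\<lambda>v. h (map v [0..<n]))" unfolding h_def enc_def by (intro dfl_chl)
    then show "definable_map M n m (carrier H) h" by (rule definable_mapI[OF X])
    show "h \<in> carrier H \<rightarrow> carrier K" using h(1) by simp
    show "inj_on h (carrier H)"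
    proof (rule inj_onI)
      fix x y assume xy: "x \<in> carrier H" "y \<in> carrier H" "h x = h y"
      have "principal (\<iota> x) = principal (\<iota> y)"
        unfolding h(2)[OF xy(1), symmetric] h(2)[OF xy(2), symmetric] xy(3) ..
      then have "\<iota> x = \<iota> y" using xy by (intro principal_inj \<iota>_S)
      then show "x = y"
        using \<phi>_\<iota>[OF xy(1)] \<phi>_\<iota>[OF xy(2)] by argo
    qed
    show "meet_pres H K h" unfolding meet_pres_def
    proof (intro conjI ballI lattice_K)
      show "lattice H" by (rule H.lattice_axioms)
      fix x y assume xy: "x \<in> carrier H" "y \<in> carrier H"
      have "\<iota> (x \<sqinter>\<^bsub>H\<^esub> y) = mt (\<iota> x) (\<iota> y)" using xy by (simp add: mt_eq \<iota>_S \<phi>_\<iota>)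
      then show "h (x \<sqinter>\<^bsub>H\<^esub> y) = h x \<sqinter>\<^bsub>K\<^esub> h y"
        using xy h by (intro h_eq) (simp_all add: meet_K principal_mt \<iota>_S)
    qed
    show "join_pres H K h" unfolding join_pres_def
    proof (intro conjI ballI lattice_K)
      show "lattice H" by (rule H.lattice_axioms)
      fix x y assume xy: "x \<in> carrier H" "y \<in> carrier H"
      have "\<iota> (x \<squnion>\<^bsub>H\<^esub> y) = jn (\<iota> x) (\<iota> y)" using xy by (simp add: jn_eq \<iota>_S \<phi>_\<iota>)
      then show "h (x \<squnion>\<^bsub>H\<^esub> y) = h x \<squnion>\<^bsub>K\<^esub> h y"
        using xy h by (intro h_eq) (simp_all add: join_K principal_jn \<iota>_S)
    qed
    show "h \<bottom>\<^bsub>H\<^esub> = \<bottom>\<^bsub>K\<^esub>"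
      by (intro bottom_K[symmetric] h H.bottom_closed) (simp add: h principal_bt[unfolded bt_def] bt_def)
    show "h \<top>\<^bsub>H\<^esub> = \<top>\<^bsub>K\<^esub>"
      by (intro top_K[symmetric] h H.top_closed) (simp add: h principal_tp[unfolded tp_def])
  qed
  ultimately show ?thesis using heyting_K by blast
qed

end

theorem theorem3p26:
  fixes M :: "('f, 'r, 'a::real_closed_field) fo_structure"
    and n :: nat
    and H :: "'a list gorder"
  assumes "o_minimal M"
    and "bounded_distrib_lattice H"
    and "definable_order M n H"
    and "o_dim M (carrier H) = 1"
  shows "\<exists>m K h. heyting_algebra K \<and> definable_order M m K \<and> definable_embedding M n H m K h"
proof -
  interpret omin_structure M by unfold_locales fact
  show ?thesis by (rule one_dimensional_lattice_embeds[OF assms(2-4)])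
qed

end
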